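(* Let $\mathcal C$ be a rigid, cocomplete braided monoidal category with braiding $\Phi$ and let $H\in\mathcal C$ be a quasitriangular Hopf algebra with bijective antipode such that $H\in\mathcal Z_2(\mathcal C)$, i.e. $\Phi_{X,H}\Phi_{H,X}=\mathrm{id}_{H\otimes X}$ for all $X\in\mathcal C$. Then there is a monoidal isomorphism of categories $$\mathcal Z_l(\mathcal C_H)\cong\mathcal C_{H\ltimes\mathrm{Aut}(\mathcal C_H)},$$ where $\mathcal Z_l(\mathcal C_H)$ is the left center of the category $\mathcal C_H$ of right $H$-modules in $\mathcal C$, $\mathrm{Aut}(\mathcal C_H)$ is the coend Hopf algebra in $\mathcal C_H$, and $H\ltimes\mathrm{Aut}(\mathcal C_H)$ is its bosonization.
   Context: $\mathcal C$ is taken strict; an object name also denotes its identity morphism and composition is written by juxtaposition. $H$ has multiplication $\nabla$, comultiplication $\Delta$. For an algebra $A$, $\mathcal C_A$ denotes the category of right $A$-modules in $\mathcal C$ (monoidal if $A$ is a bialgebra). Quasitriangular structure (Majid): a morphism $\mathcal R:I\to H\otimes H$, convolution invertible (in the algebras $H^{\otimes n}$, formed with $\Phi$), with $(\Delta\otimes H)\mathcal R=\mathcal R_{13}\mathcal R_{23}$, $(H\otimes\Delta)\mathcal R=\mathcal R_{13}\mathcal R_{12}$ and $\Delta^{op}\cdot\mathcal R=\mathcal R\cdot\Delta$ (products in $H\otimes H$), where $\Delta^{op}=\Phi_{H,H}\Delta$ (the opposite comultiplication, valid for all $H$-modules since $H\in\mathcal Z_2(\mathcal C)$). Then $\mathcal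 C_H$ is braided by $\Phi(\mathcal R)_{M,N}=(\nu_N\otimes\nu_M)(N\otimes\Phi_{M,H}\otimes H)(\Phi_{M,N}\otimes\mathcal R)$, where $\nu$ denotes right $H$-actions. Coend. For a rigid cocomplete braided monoidal category $\mathcal D$ with braiding $\Omega$ (here $\mathcal D=\mathcal C_H$, $\Omega=\Phi(\mathcal R)$), $\mathrm{Aut}(\mathcal D)=\int^{X\in\mathcal D}X^*\otimes X$, with universal dinatural morphisms $i_X:X^*\otimes X\to\mathrm{Aut}(\mathcal D)$ (its existence is part of the cocompleteness assumption). It is a Hopf algebra in $\mathcal D$ with comultiplication $\Delta i_X=(i_X\otimes i_X)(X^*\otimes d_X\otimes X)$ ($d_X:I\to X\otimes X^*$ the coevaluation), counit $\varepsilon i_X=ev_X$, unit $i_I$ and multiplication $\nabla(i_X\otimes i_Y)=i_{X\otimes Y}(\Omega_{X^*\otimes X,Y^*}\otimes Y)$, where $(X\otimes Y)^*=Y^*\otimes X^*$. Bosonization. For a Hopf algebra $B$ in $\mathcal C_H$ with right action $\nu_B$, put $\rho_B=(\nu_B\otimes H)(B\otimes\mathcal R):B\to B\otimes H$. $H\ltimes B$ is the object $H\otimes B$ with the tensor product unit and counit, multiplication $(\nabla\otimes\nabla_B)(H\otimes H\otimes\nu_B\otimes B)(H\otimes\Phi_{B,H}\otimes H\otimes B)(H\otimes B\otimes\Delta\otimes B)$ and comultiplication $(H\otimes B\otimes\nabla\otimes B)(H\otimes\Phi_{H,B}\otimes H\otimes B)(\Delta\otimes\rho_B\otimes B)(H\otimes\Delta_B)$;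 it is a Hopf algebra in $\mathcal C$. Left center. For a monoidal category $\mathcal D$, $\mathcal Z_l(\mathcal D)$ has objects $(V,c_{V,-})$ with natural isomorphisms $c_{V,X}:V\otimes X\to X\otimes V$ such that $c_{V,X\otimes Y}=(X\otimes c_{V,Y})(c_{V,X}\otimes Y)$; morphisms $f:V\to W$ satisfy $(X\otimes f)c_{V,X}=c_{W,X}(f\otimes X)$; the tensor product is given by $c_{V\otimes W,X}=(c_{V,X}\otimes W)(V\otimes c_{W,X})$. *)

theory Defs
  imports "HOL-Library.FuncSet" "HOL-Library.Equipollence"
begin

section \<open>Strict monoidal categories\<close>

record ('o, 'a) category =
  Obj :: "'o set"
  Arr :: "'a set"
  Dom :: "'a \<Rightarrow> 'o"
  Cod :: "'a \<Rightarrow> 'o"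
  Id :: "'o \<Rightarrow> 'a"  (\<open>\<iota>\<index>\<close>)
  Comp :: "'a \<Rightarrow> 'a \<Rightarrow> 'a"  (infixr \<open>\<cdot>\<index>\<close> 60)

record ('o, 'a) moncat = "('o, 'a) category" +
  TensO :: "'o \<Rightarrow> 'o \<Rightarrow> 'o"  (infixr \<open>\<odot>\<index>\<close> 70)
  Tens :: "'a \<Rightarrow> 'a \<Rightarrow> 'a"  (infixr \<open>\<otimes>\<index>\<close> 70)
  UnitO :: "'o"  (\<open>\<I>\<index>\<close>)

definition Hom :: "('o, 'a, 'z) category_scheme \<Rightarrow> 'o \<Rightarrow> 'o \<Rightarrow> 'a set" where
  "Hom C X Y = {f \<in> Arr C. Dom C f = X \<and> Cod C f = Y}"

locale category =
  fixes C :: "('o, 'a, 'z) category_scheme" (structure)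
  assumes dom_obj: "f \<in> Arr C \<Longrightarrow> Dom C f \<in> Obj C"
    and cod_obj: "f \<in> Arr C \<Longrightarrow> Cod C f \<in> Obj C"
    and id_hom: "X \<in> Obj C \<Longrightarrow> \<iota> X \<in> Hom C X X"
    and comp_hom: "f \<in> Hom C X Y \<Longrightarrow> g \<in> Hom C Y Z \<Longrightarrow> g \<cdot> f \<in> Hom C X Z"
    and comp_id_right: "f \<in> Hom C X Y \<Longrightarrow> f \<cdot> \<iota> X = f"
    and comp_id_left: "f \<in> Hom C X Y \<Longrightarrow> \<iota> Y \<cdot> f = f"
    and comp_assoc: "f \<in> Hom C W X \<Longrightarrow> g \<in> Hom C X Y \<Longrightarrow> h \<in> Hom C Y Z \<Longrightarrow>
      (h \<cdot> g) \<cdot> f = h \<cdot> (g \<cdot> f)"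

definition is_iso :: "('o, 'a, 'z) category_scheme \<Rightarrow> 'a \<Rightarrow> bool" where
  "is_iso C f \<longleftrightarrow> f \<in> Arr C \<and> (\<exists>g \<in> Hom C (Cod C f) (Dom C f).
     g \<cdot>\<^bsub>C\<^esub> f = \<iota>\<^bsub>C\<^esub> (Dom C f) \<and> f \<cdot>\<^bsub>C\<^esub> g = \<iota>\<^bsub>C\<^esub> (Cod C f))"

locale strict_monoidal_category = category C
  for C :: "('o, 'a, 'z) moncat_scheme" (structure) +
  assumes unit_obj: "\<I> \<in> Obj C"
    and tens_obj: "X \<in> Obj C \<Longrightarrow> Y \<in> Obj C \<Longrightarrow> X \<odot> Y \<in> Obj C"
    and tens_hom: "f \<in> Hom C X Y \<Longrightarrow> g \<in> Hom C X' Y' \<Longrightarrow> f \<otimes> g \<in> Hom C (X \<odot> X') (Y \<odot> Y')"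
    and tens_id: "X \<in> Obj C \<Longrightarrow> Y \<in> Obj C \<Longrightarrow> \<iota> X \<otimes> \<iota> Y = \<iota> (X \<odot> Y)"
    and interchange: "f \<in> Hom C X Y \<Longrightarrow> g \<in> Hom C Y Z \<Longrightarrow>
      f' \<in> Hom C X' Y' \<Longrightarrow> g' \<in> Hom C Y' Z' \<Longrightarrow>
      (g \<cdot> f) \<otimes> (g' \<cdot> f') = (g \<otimes> g') \<cdot> (f \<otimes> f')"
    and assoc_obj: "X \<in> Obj C \<Longrightarrow> Y \<in> Obj C \<Longrightarrow> Z \<in> Obj C \<Longrightarrow> (X \<odot> Y) \<odot> Z = X \<odot> (Y \<odot> Z)"
    and assoc_arr: "f \<in> Arr C \<Longrightarrow> g \<in> Arr C \<Longrightarrow> h \<in> Arr C \<Longrightarrow> (f \<otimes> g) \<otimes> h = f \<otimes> (g \<otimes> h)"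
    and unit_obj_left: "X \<in> Obj C \<Longrightarrow> \<I> \<odot> X = X"
    and unit_obj_right: "X \<in> Obj C \<Longrightarrow> X \<odot> \<I> = X"
    and unit_arr_left: "f \<in> Arr C \<Longrightarrow> \<iota> \<I> \<otimes> f = f"
    and unit_arr_right: "f \<in> Arr C \<Longrightarrow> f \<otimes> \<iota> \<I> = f"

locale braided_monoidal_category = strict_monoidal_category C
  for C :: "('o, 'a, 'z) moncat_scheme" (structure) +
  fixes \<Phi> :: "'o \<Rightarrow> 'o \<Rightarrow> 'a"
  assumes braid_hom: "X \<in> Obj C \<Longrightarrow> Y \<in> Obj C \<Longrightarrow> \<Phi> X Y \<in> Hom C (X \<odot> Y) (Y \<odot> X)"
    and braid_iso: "X \<in> Obj C \<Longrightarrow> Y \<in> Obj C \<Longrightarrow> is_iso C (\<Phi> X Y)"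
    and braid_natural: "f \<in> Hom C X X' \<Longrightarrow> g \<in> Hom C Y Y' \<Longrightarrow>
      \<Phi> X' Y' \<cdot> (f \<otimes> g) = (g \<otimes> f) \<cdot> \<Phi> X Y"
    and hexagon_left: "X \<in> Obj C \<Longrightarrow> Y \<in> Obj C \<Longrightarrow> Z \<in> Obj C \<Longrightarrow>
      \<Phi> (X \<odot> Y) Z = (\<Phi> X Z \<otimes> \<iota> Y) \<cdot> (\<iota> X \<otimes> \<Phi> Y Z)"
    and hexagon_right: "X \<in> Obj C \<Longrightarrow> Y \<in> Obj C \<Longrightarrow> Z \<in> Obj C \<Longrightarrow>
      \<Phi> X (Y \<odot> Z) = (\<iota> Y \<otimes> \<Phi> X Z) \<cdot> (\<Phi> X Y \<otimes> \<iota> Z)"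


section \<open>Functors, cocompleteness, monoidal isomorphisms\<close>

locale cat_functor = A: category A + B: category B
  for A :: "('o, 'a, 'y) category_scheme" and B :: "('p, 'b, 'z) category_scheme" +
  fixes Fo :: "'o \<Rightarrow> 'p" and Fa :: "'a \<Rightarrow> 'b"
  assumes functor_obj: "X \<in> Obj A \<Longrightarrow> Fo X \<in> Obj B"
    and functor_hom: "f \<in> Hom A X Y \<Longrightarrow> Fa f \<in> Hom B (Fo X) (Fo Y)"
    and functor_id: "X \<in> Obj A \<Longrightarrow> Fa (\<iota>\<^bsub>A\<^esub> X) = \<iota>\<^bsub>B\<^esub> (Fo X)"
    and functor_comp: "f \<in> Hom A X Y \<Longrightarrow> g \<in> Hom A Y Z \<Longrightarrow>
      Fa (g \<cdot>\<^bsub>A\<^esub> f) = Fa g \<cdot>\<^bsub>B\<^esub> Fa f"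

definition cocone where
  "cocone J C Fo Fa L l \<longleftrightarrow> L \<in> Obj C \<and> (\<forall>j \<in> Obj J. l j \<in> Hom C (Fo j) L) \<and>
     (\<forall>j \<in> Obj J. \<forall>k \<in> Obj J. \<forall>u \<in> Hom J j k. l k \<cdot>\<^bsub>C\<^esub> Fa u = l j)"

definition is_colimit where
  "is_colimit J C Fo Fa L l \<longleftrightarrow> cocone J C Fo Fa L l \<and>
     (\<forall>M m. cocone J C Fo Fa M m \<longrightarrow> (\<exists>!g. g \<in> Hom C L M \<and> (\<forall>j \<in> Obj J. g \<cdot>\<^bsub>C\<^esub> l j = m j)))"

text \<open>
  \<^term>\<open>cocomplete TYPE('u) C\<close>: every small diagram in C has a colimit, where ``small'' means of
  cardinality less than that of the type \<^typ>\<open>'u\<close>. The type plays the role of the ambient universe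
  relative to which categories are small or large. It must be kept apart from the type of arrows
  of C: a category that has all colimits of the size of its own set of arrows is a preorder.
\<close>

definition cocomplete :: "'u itself \<Rightarrow> ('o, 'a, 'z) category_scheme \<Rightarrow> bool" where
  "cocomplete U C \<longleftrightarrow> (\<forall>(J :: ('u, 'u) category) Fo Fa.
     Arr J \<prec> (UNIV :: 'u set) \<and> cat_functor J C Fo Fa \<longrightarrow> (\<exists>L l. is_colimit J C Fo Fa L l))"

locale monoidal_functor =
  A: strict_monoidal_category A + B: strict_monoidal_category B + cat_functor A B Fo Fa
  for A :: "('o, 'a, 'y) moncat_scheme" and B :: "('p, 'b, 'z) moncat_scheme" and Fo Fa +
  fixes F2 :: "'o \<Rightarrow> 'o \<Rightarrow> 'b" and F0 :: 'b
  assumes F2_hom: "X \<in> Obj A \<Longrightarrow> Y \<in> Obj A \<Longrightarrow>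
      F2 X Y \<in> Hom B (Fo X \<odot>\<^bsub>B\<^esub> Fo Y) (Fo (X \<odot>\<^bsub>A\<^esub> Y))"
    and F2_iso: "X \<in> Obj A \<Longrightarrow> Y \<in> Obj A \<Longrightarrow> is_iso B (F2 X Y)"
    and F2_natural: "f \<in> Hom A X X' \<Longrightarrow> g \<in> Hom A Y Y' \<Longrightarrow>
      F2 X' Y' \<cdot>\<^bsub>B\<^esub> (Fa f \<otimes>\<^bsub>B\<^esub> Fa g) = Fa (f \<otimes>\<^bsub>A\<^esub> g) \<cdot>\<^bsub>B\<^esub> F2 X Y"
    and F0_hom: "F0 \<in> Hom B \<I>\<^bsub>B\<^esub> (Fo \<I>\<^bsub>A\<^esub>)"
    and F0_iso: "is_iso B F0"
    and F2_assoc: "X \<in> Obj A \<Longrightarrow> Y \<in> Obj A \<Longrightarrow> Z \<in> Obj A \<Longrightarrow>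
      F2 (X \<odot>\<^bsub>A\<^esub> Y) Z \<cdot>\<^bsub>B\<^esub> (F2 X Y \<otimes>\<^bsub>B\<^esub> \<iota>\<^bsub>B\<^esub> (Fo Z)) =
      F2 X (Y \<odot>\<^bsub>A\<^esub> Z) \<cdot>\<^bsub>B\<^esub> (\<iota>\<^bsub>B\<^esub> (Fo X) \<otimes>\<^bsub>B\<^esub> F2 Y Z)"
    and F2_unit_left: "X \<in> Obj A \<Longrightarrow>
      F2 \<I>\<^bsub>A\<^esub> X \<cdot>\<^bsub>B\<^esub> (F0 \<otimes>\<^bsub>B\<^esub> \<iota>\<^bsub>B\<^esub> (Fo X)) = \<iota>\<^bsub>B\<^esub> (Fo X)"
    and F2_unit_right: "X \<in> Obj A \<Longrightarrow>
      F2 X \<I>\<^bsub>A\<^esub> \<cdot>\<^bsub>B\<^esub> (\<iota>\<^bsub>B\<^esub> (Fo X) \<otimes>\<^bsub>B\<^esub> F0) = \<iota>\<^bsub>B\<^esub> (Fo X)"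

definition iso_functor where
  "iso_functor A B Fo Fa \<longleftrightarrow> cat_functor A B Fo Fa \<and> (\<exists>Go Ga. cat_functor B A Go Ga \<and>
     (\<forall>X \<in> Obj A. Go (Fo X) = X) \<and> (\<forall>f \<in> Arr A. Ga (Fa f) = f) \<and>
     (\<forall>Y \<in> Obj B. Fo (Go Y) = Y) \<and> (\<forall>g \<in> Arr B. Fa (Ga g) = g))"

definition monoidally_isomorphic where
  "monoidally_isomorphic A B \<longleftrightarrow>
     (\<exists>Fo Fa F2 F0. monoidal_functor A B Fo Fa F2 F0 \<and> iso_functor A B Fo Fa)"


section \<open>Duals and rigidity\<close>

definition is_left_dual where
  "is_left_dual D X Y e d \<longleftrightarrow> Y \<in> Obj D \<and>
     e \<in> Hom D (Y \<odot>\<^bsub>D\<^esub> X) \<I>\<^bsub>D\<^esub> \<and> d \<in> Hom D \<I>\<^bsub>D\<^esub> (X \<odot>\<^bsub>D\<^esub> Y) \<and>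
     (\<iota>\<^bsub>D\<^esub> X \<otimes>\<^bsub>D\<^esub> e) \<cdot>\<^bsub>D\<^esub> (d \<otimes>\<^bsub>D\<^esub> \<iota>\<^bsub>D\<^esub> X) = \<iota>\<^bsub>D\<^esub> X \<and>
     (e \<otimes>\<^bsub>D\<^esub> \<iota>\<^bsub>D\<^esub> Y) \<cdot>\<^bsub>D\<^esub> (\<iota>\<^bsub>D\<^esub> Y \<otimes>\<^bsub>D\<^esub> d) = \<iota>\<^bsub>D\<^esub> Y"

definition rigid where
  "rigid D \<longleftrightarrow> (\<forall>X \<in> Obj D. (\<exists>Y e d. is_left_dual D X Y e d) \<and>
     (\<exists>Y \<in> Obj D. \<exists>e d. is_left_dual D Y X e d))"

definition dual_triple :: "('o, 'a, 'z) moncat_scheme \<Rightarrow> 'o \<Rightarrow> 'o \<times> 'a \<times> 'a" where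
  "dual_triple D X = (SOME (Y, e, d). is_left_dual D X Y e d)"

definition dual where "dual D X = fst (dual_triple D X)"
definition ev where "ev D X = fst (snd (dual_triple D X))"
definition coev where "coev D X = snd (snd (dual_triple D X))"

definition dual_arr where
  "dual_arr D f = (let X = Dom D f; Y = Cod D f in
     (ev D Y \<otimes>\<^bsub>D\<^esub> \<iota>\<^bsub>D\<^esub> (dual D X)) \<cdot>\<^bsub>D\<^esub>
     (\<iota>\<^bsub>D\<^esub> (dual D Y) \<otimes>\<^bsub>D\<^esub> f \<otimes>\<^bsub>D\<^esub> \<iota>\<^bsub>D\<^esub> (dual D X)) \<cdot>\<^bsub>D\<^esub>
     (\<iota>\<^bsub>D\<^esub> (dual D Y) \<otimes>\<^bsub>D\<^esub> coev D X))"

text \<open>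
  The chosen duals need not satisfy \<open>(X \<otimes> Y)* = Y* \<otimes> X*\<close> and \<open>I* = I\<close> on the nose;
  the canonical isomorphisms \<open>Y* \<otimes> X* \<rightarrow> (X \<otimes> Y)*\<close> and \<open>I \<rightarrow> I*\<close> identify the two sides.
\<close>

definition dual_tens where
  "dual_tens D X Y =
     ((ev D Y \<cdot>\<^bsub>D\<^esub> (\<iota>\<^bsub>D\<^esub> (dual D Y) \<otimes>\<^bsub>D\<^esub> ev D X \<otimes>\<^bsub>D\<^esub> \<iota>\<^bsub>D\<^esub> Y)) \<otimes>\<^bsub>D\<^esub> \<iota>\<^bsub>D\<^esub> (dual D (X \<odot>\<^bsub>D\<^esub> Y))) \<cdot>\<^bsub>D\<^esub>
     (\<iota>\<^bsub>D\<^esub> (dual D Y) \<otimes>\<^bsub>D\<^esub> \<iota>\<^bsub>D\<^esub> (dual D X) \<otimes>\<^bsub>D\<^esub> coev D (X \<odot>\<^bsub>D\<^esub> Y))"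

definition dual_unit where "dual_unit D = coev D \<I>\<^bsub>D\<^esub>"


section \<open>Hopf algebras and their right modules\<close>

record ('o, 'a) bialg =
  carr :: 'o
  mlt :: 'a
  unt :: 'a
  cml :: 'a
  cnt :: 'a

record ('o, 'a) hopf = "('o, 'a) bialg" +
  antip :: 'a

context
  fixes C :: "('o, 'a, 'z) moncat_scheme" (structure) and \<Phi> :: "'o \<Rightarrow> 'o \<Rightarrow> 'a"
begin

definition algebra :: "'o \<Rightarrow> 'a \<Rightarrow> 'a \<Rightarrow> bool" where
  "algebra A m u \<longleftrightarrow> A \<in> Obj C \<and> m \<in> Hom C (A \<odot> A) A \<and> u \<in> Hom C \<I> A \<and>
     m \<cdot> (m \<otimes> \<iota> A) = m \<cdot> (\<iota> A \<otimes> m) \<and>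
     m \<cdot> (u \<otimes> \<iota> A) = \<iota> A \<and> m \<cdot> (\<iota> A \<otimes> u) = \<iota> A"

definition coalgebra :: "'o \<Rightarrow> 'a \<Rightarrow> 'a \<Rightarrow> bool" where
  "coalgebra A d e \<longleftrightarrow> A \<in> Obj C \<and> d \<in> Hom C A (A \<odot> A) \<and> e \<in> Hom C A \<I> \<and>
     (d \<otimes> \<iota> A) \<cdot> d = (\<iota> A \<otimes> d) \<cdot> d \<and>
     (e \<otimes> \<iota> A) \<cdot> d = \<iota> A \<and> (\<iota> A \<otimes> e) \<cdot> d = \<iota> A"

text \<open>Multiplication of the tensor product of the algebras (A, m) and (B, n).\<close>

definition tens_mlt :: "'o \<Rightarrow> 'a \<Rightarrow> 'o \<Rightarrow> 'a \<Rightarrow> 'a" where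
  "tens_mlt A m B n = (m \<otimes> n) \<cdot> (\<iota> A \<otimes> \<Phi> B A \<otimes> \<iota> B)"

definition bialgebra :: "('o, 'a, 'x) bialg_scheme \<Rightarrow> bool" where
  "bialgebra A \<longleftrightarrow> algebra (carr A) (mlt A) (unt A) \<and> coalgebra (carr A) (cml A) (cnt A) \<and>
     cml A \<cdot> mlt A = tens_mlt (carr A) (mlt A) (carr A) (mlt A) \<cdot> (cml A \<otimes> cml A) \<and>
     cml A \<cdot> unt A = unt A \<otimes> unt A \<and>
     cnt A \<cdot> mlt A = cnt A \<otimes> cnt A \<and>
     cnt A \<cdot> unt A = \<iota> \<I>"

definition hopf_algebra :: "('o, 'a, 'x) hopf_scheme \<Rightarrow> bool" where
  "hopf_algebra H \<longleftrightarrow> bialgebra H \<and> antip H \<in> Hom C (carr H) (carr H) \<and>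
     mlt H \<cdot> (antip H \<otimes> \<iota> (carr H)) \<cdot> cml H = unt H \<cdot> cnt H \<and>
     mlt H \<cdot> (\<iota> (carr H) \<otimes> antip H) \<cdot> cml H = unt H \<cdot> cnt H"

text \<open>Membership of an object in the symmetric (Mueger) center \<open>Z\<^sub>2(C)\<close>.\<close>

definition in_sym_center :: "'o \<Rightarrow> bool" where
  "in_sym_center V \<longleftrightarrow> V \<in> Obj C \<and> (\<forall>X \<in> Obj C. \<Phi> X V \<cdot> \<Phi> V X = \<iota> (V \<odot> X))"

definition quasitriangular :: "('o, 'a, 'x) bialg_scheme \<Rightarrow> 'a \<Rightarrow> bool" where
  "quasitriangular H R \<longleftrightarrow>
     (let h = carr H; \<eta> = unt H; \<Delta> = cml H;
          m2 = tens_mlt h (mlt H) h (mlt H);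
          m3 = tens_mlt (h \<odot> h) m2 h (mlt H);
          R12 = R \<otimes> \<eta>; R13 = (\<iota> h \<otimes> \<eta> \<otimes> \<iota> h) \<cdot> R; R23 = \<eta> \<otimes> R
      in R \<in> Hom C \<I> (h \<odot> h) \<and>
         (\<exists>S \<in> Hom C \<I> (h \<odot> h). m2 \<cdot> (R \<otimes> S) = \<eta> \<otimes> \<eta> \<and> m2 \<cdot> (S \<otimes> R) = \<eta> \<otimes> \<eta>) \<and>
         (\<Delta> \<otimes> \<iota> h) \<cdot> R = m3 \<cdot> (R13 \<otimes> R23) \<and>
         (\<iota> h \<otimes> \<Delta>) \<cdot> R = m3 \<cdot> (R13 \<otimes> R12) \<and>
         m2 \<cdot> ((\<Phi> h h \<cdot> \<Delta>) \<otimes> R) = m2 \<cdot> (R \<otimes> \<Delta>))"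

definition is_rmodule :: "('o, 'a, 'x) bialg_scheme \<Rightarrow> 'o \<times> 'a \<Rightarrow> bool" where
  "is_rmodule A = (\<lambda>(M, \<nu>). M \<in> Obj C \<and> \<nu> \<in> Hom C (M \<odot> carr A) M \<and>
     \<nu> \<cdot> (\<nu> \<otimes> \<iota> (carr A)) = \<nu> \<cdot> (\<iota> M \<otimes> mlt A) \<and>
     \<nu> \<cdot> (\<iota> M \<otimes> unt A) = \<iota> M)"

definition rmodule_tens :: "('o, 'a, 'x) bialg_scheme \<Rightarrow> 'o \<times> 'a \<Rightarrow> 'o \<times> 'a \<Rightarrow> 'o \<times> 'a" where
  "rmodule_tens A = (\<lambda>(M, \<nu>) (N, \<mu>).
     (M \<odot> N, (\<nu> \<otimes> \<mu>) \<cdot> (\<iota> M \<otimes> \<Phi> N (carr A) \<otimes> \<iota> (carr A)) \<cdot> (\<iota> M \<otimes> \<iota> N \<otimes> cml A)))"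

text \<open>
  The monoidal category of right modules over a bialgebra. Objects are pairs (object, action);
  an arrow carries its source and target, since one arrow of C may be linear for several actions.
\<close>

definition rmod :: "('o, 'a, 'x) bialg_scheme \<Rightarrow>
    ('o \<times> 'a, ('o \<times> 'a) \<times> 'a \<times> ('o \<times> 'a)) moncat" where
  "rmod A = \<lparr>
     Obj = {M. is_rmodule A M},
     Arr = {(M, f, N). is_rmodule A M \<and> is_rmodule A N \<and> f \<in> Hom C (fst M) (fst N) \<and>
              f \<cdot> snd M = snd N \<cdot> (f \<otimes> \<iota> (carr A))},
     Dom = (\<lambda>(M, f, N). M),
     Cod = (\<lambda>(M, f, N). N),
     Id = (\<lambda>M. (M, \<iota> (fst M), M)),
     Comp = (\<lambda>(M', g, N') (M, f, N). (M, g \<cdot> f, N')),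
     TensO = rmodule_tens A,
     Tens = (\<lambda>(M, f, N) (M', g, N'). (rmodule_tens A M M', f \<otimes> g, rmodule_tens A N N')),
     UnitO = (\<I>, cnt A) \<rparr>"

definition und :: "('o \<times> 'a) \<times> 'a \<times> ('o \<times> 'a) \<Rightarrow> 'a" where
  "und = (\<lambda>(M, f, N). f)"

definition rmod_braiding :: "('o, 'a, 'x) bialg_scheme \<Rightarrow> 'a \<Rightarrow>
    'o \<times> 'a \<Rightarrow> 'o \<times> 'a \<Rightarrow> ('o \<times> 'a) \<times> 'a \<times> ('o \<times> 'a)" where
  "rmod_braiding H R = (\<lambda>(M, \<nu>) (N, \<mu>).
     (rmodule_tens H (M, \<nu>) (N, \<mu>),
      (\<mu> \<otimes> \<nu>) \<cdot> (\<iota> N \<otimes> \<Phi> M (carr H) \<otimes> \<iota> (carr H)) \<cdot> (\<Phi> M N \<otimes> R),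
      rmodule_tens H (N, \<mu>) (M, \<nu>)))"

definition bosonization :: "('o, 'a, 'x) bialg_scheme \<Rightarrow> 'a \<Rightarrow>
    ('o \<times> 'a, ('o \<times> 'a) \<times> 'a \<times> ('o \<times> 'a), 'y) bialg_scheme \<Rightarrow> ('o, 'a) bialg" where
  "bosonization H R B =
     (let h = carr H; b = fst (carr B); \<nu> = snd (carr B);
          \<rho> = (\<nu> \<otimes> \<iota> h) \<cdot> (\<iota> b \<otimes> R)
      in \<lparr> carr = h \<odot> b,
           mlt = (mlt H \<otimes> und (mlt B)) \<cdot> (\<iota> h \<otimes> \<iota> h \<otimes> \<nu> \<otimes> \<iota> b) \<cdot>
                 (\<iota> h \<otimes> \<Phi> b h \<otimes> \<iota> h \<otimes> \<iota> b) \<cdot> (\<iota> h \<otimes> \<iota> b \<otimes> cml H \<otimes> \<iota> b),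
           unt = unt H \<otimes> und (unt B),
           cml = (\<iota> h \<otimes> \<iota> b \<otimes> mlt H \<otimes> \<iota> b) \<cdot> (\<iota> h \<otimes> \<Phi> h b \<otimes> \<iota> h \<otimes> \<iota> b) \<cdot>
                 (cml H \<otimes> \<rho> \<otimes> \<iota> b) \<cdot> (\<iota> h \<otimes> und (cml B)),
           cnt = cnt H \<otimes> und (cnt B) \<rparr>)"

end


section \<open>The coend Hopf algebra\<close>

context
  fixes D :: "('o, 'a, 'z) moncat_scheme" (structure)
begin

definition dinatural :: "'o \<Rightarrow> ('o \<Rightarrow> 'a) \<Rightarrow> bool" where
  "dinatural Z j \<longleftrightarrow> Z \<in> Obj D \<and> (\<forall>X \<in> Obj D. j X \<in> Hom D (dual D X \<odot> X) Z) \<and>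
     (\<forall>X \<in> Obj D. \<forall>Y \<in> Obj D. \<forall>f \<in> Hom D X Y.
        j X \<cdot> (dual_arr D f \<otimes> \<iota> X) = j Y \<cdot> (\<iota> (dual D Y) \<otimes> f))"

definition is_aut_coend :: "'o \<Rightarrow> ('o \<Rightarrow> 'a) \<Rightarrow> bool" where
  "is_aut_coend A i \<longleftrightarrow> dinatural A i \<and>
     (\<forall>Z j. dinatural Z j \<longrightarrow> (\<exists>!g. g \<in> Hom D A Z \<and> (\<forall>X \<in> Obj D. g \<cdot> i X = j X)))"

definition aut_bialg :: "('o \<Rightarrow> 'o \<Rightarrow> 'a) \<Rightarrow> 'o \<Rightarrow> ('o \<Rightarrow> 'a) \<Rightarrow> ('o, 'a) bialg" where
  "aut_bialg \<Omega> A i = \<lparr>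
     carr = A,
     mlt = (THE m. m \<in> Hom D (A \<odot> A) A \<and> (\<forall>X \<in> Obj D. \<forall>Y \<in> Obj D.
              m \<cdot> (i X \<otimes> i Y) =
              i (X \<odot> Y) \<cdot> (dual_tens D X Y \<otimes> \<iota> X \<otimes> \<iota> Y) \<cdot>
                (\<Omega> (dual D X \<odot> X) (dual D Y) \<otimes> \<iota> Y))),
     unt = i \<I> \<cdot> dual_unit D,
     cml = (THE d. d \<in> Hom D A (A \<odot> A) \<and> (\<forall>X \<in> Obj D.
              d \<cdot> i X = (i X \<otimes> i X) \<cdot> (\<iota> (dual D X) \<otimes> coev D X \<otimes> \<iota> X))),
     cnt = (THE e. e \<in> Hom D A \<I> \<and> (\<forall>X \<in> Obj D. e \<cdot> i X = ev D X)) \<rparr>"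

end


section \<open>The left center\<close>

context
  fixes D :: "('o, 'a, 'z) moncat_scheme" (structure)
begin

text \<open>
  The families \<open>c\<close> are required to be extensional, so that equality of objects of the center
  is equality of the components indexed by the objects of D.
\<close>

definition is_half_braiding :: "'o \<Rightarrow> ('o \<Rightarrow> 'a) \<Rightarrow> bool" where
  "is_half_braiding V c \<longleftrightarrow> V \<in> Obj D \<and> c \<in> extensional (Obj D) \<and>
     (\<forall>X \<in> Obj D. c X \<in> Hom D (V \<odot> X) (X \<odot> V) \<and> is_iso D (c X)) \<and>
     (\<forall>X \<in> Obj D. \<forall>Y \<in> Obj D. \<forall>f \<in> Hom D X Y. c Y \<cdot> (\<iota> V \<otimes> f) = (f \<otimes> \<iota> V) \<cdot> c X) \<and>
     (\<forall>X \<in> Obj D. \<forall>Y \<in> Obj D. c (X \<odot> Y) = (\<iota> X \<otimes> c Y) \<cdot> (c X \<otimes> \<iota> Y))"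

definition center_tens :: "'o \<times> ('o \<Rightarrow> 'a) \<Rightarrow> 'o \<times> ('o \<Rightarrow> 'a) \<Rightarrow> 'o \<times> ('o \<Rightarrow> 'a)" where
  "center_tens = (\<lambda>(V, c) (W, c'). (V \<odot> W, \<lambda>X \<in> Obj D. (c X \<otimes> \<iota> W) \<cdot> (\<iota> V \<otimes> c' X)))"

definition left_center ::
    "('o \<times> ('o \<Rightarrow> 'a), ('o \<times> ('o \<Rightarrow> 'a)) \<times> 'a \<times> ('o \<times> ('o \<Rightarrow> 'a))) moncat" where
  "left_center = \<lparr>
     Obj = {(V, c). is_half_braiding V c},
     Arr = {((V, c), f, (W, c')). is_half_braiding V c \<and> is_half_braiding W c' \<and> f \<in> Hom D V W \<and>
              (\<forall>X \<in> Obj D. (\<iota> X \<otimes> f) \<cdot> c X = c' X \<cdot> (f \<otimes> \<iota> X))},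
     Dom = (\<lambda>(V, f, W). V),
     Cod = (\<lambda>(V, f, W). W),
     Id = (\<lambda>V. (V, \<iota> (fst V), V)),
     Comp = (\<lambda>(V', g, W') (V, f, W). (V, g \<cdot> f, W')),
     TensO = center_tens,
     Tens = (\<lambda>(V, f, W) (V', g, W'). (center_tens V V', f \<otimes> g, center_tens W W')),
     UnitO = (\<I>, \<lambda>X \<in> Obj D. \<iota> X) \<rparr>"

end

end

theory Submission
  imports Defs
begin

text \<open>
  Write \<open>\<D>\<close> for the category of \<open>H\<close>-modules, \<open>\<Omega>\<close> for its braiding and \<open>A\<close> for the coend. By duality, a family
  \<open>c\<^sub>X : V \<otimes> X \<rightarrow> X \<otimes> V\<close> is the same as the family
  \<open>(ev\<^sub>X \<otimes> V) (X\<^sup>* \<otimes> c\<^sub>X) (\<Omega> \<otimes> X) : V \<otimes> X\<^sup>* \<otimes> X \<rightarrow> V\<close>; naturality of the one is dinaturality of the other,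
  so natural families correspond to morphisms \<open>\<alpha> : V \<otimes> A \<rightarrow> V\<close> with \<open>\<alpha> (V \<otimes> i\<^sub>X)\<close> the given composite. The structure of
  \<open>A\<close> is made such that the hexagon for \<open>c\<close> becomes associativity of \<open>\<alpha>\<close>, \<open>c\<^sub>I = V\<close> becomes unitality, and the
  tensor product of half-braidings becomes the diagonal action through the comultiplication. Invertibility
  of \<open>c\<close> is automatic in a rigid category. This needs \<open>\<D>\<close> to be braided and rigid; a right dual of a
  module is given by the antipode, and the braiding turns it into a left dual.

  A module over an algebra \<open>B\<close> of \<open>\<D>\<close> is an object with an \<open>H\<close>-action \<open>\<nu>\<close> and an \<open>H\<close>-linear \<open>B\<close>-action \<open>\<alpha>\<close>, and
  \<open>\<beta> = \<alpha> (\<nu> \<otimes> B)\<close> turns such pairs into modules over the bosonization. Both correspondences are bijective on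
  objects and arrows and preserve the tensor products strictly, so the monoidal structure of the right-hand
  side is transported from the center, and the bosonization need not be shown to be a Hopf algebra.
\<close>

subsection \<open>Diagrammatic rewriting\<close>

text \<open>Written with \<cdot> and \<otimes>, the equations needed here drown in reassociation and
  interchange. They are therefore checked by evaluation: both sides are read as lists of boxes, the
  simplifier runs a certificate on one of them, and soundness of the moves is proved once. The
  universal property of the coend concerns morphisms out of A alone, while an action lives on V
  \<otimes> A and its axioms on V \<otimes> A \<otimes> A. Rigidity closes this gap, since tensoring
  with an object that has duals preserves coends. Chosen duals are not compatible with tensor
  products on the nose, so the canonical morphism \<open>dual_tens\<close> is carried along with its
  own naturality. That H lies in the symmetric center enters through \<open>central_rule\<close>: in
  the linearity of \<Omega> and in one of its hexagons a strand of H lies on the wrong side of a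
  module, and a double crossing has to be trivial. The invertibility of \<Omega> is obtained from
  duals of modules. Its unit law must come before that, and rests on (\<epsilon> \<otimes> H) R
  being the unit.\<close>

text \<open>
  A string diagram is a list of boxes applied from first to last, each with the number of strands to its
  left; objects are represented by words. A list of moves is a certificate for an equation: \<open>SR p\<close> and \<open>SL p\<close>
  interchange the disjoint boxes at positions \<open>p\<close> and \<open>p + 1\<close> (with \<open>SR\<close> for a second box lying to the right of the
  first one), \<open>Rw k p n\<close> and \<open>Bw k p n\<close> apply the \<open>k\<close>-th rule forwards and backwards at position \<open>p\<close> with \<open>n\<close> strands
  to its left. A move that does not apply leaves the diagram unchanged.
\<close>

type_synonym ('o, 'a) box = "'o list \<times> 'a \<times> 'o list"
type_synonym ('o, 'a) diagram = "(nat \<times> ('o, 'a) box) list"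
type_synonym ('o, 'a) rule = "'o list \<times> ('o, 'a) diagram \<times> ('o, 'a) diagram"

datatype move = SR nat | SL nat | Rw nat nat nat | Bw nat nat nat

definition shift :: "nat \<Rightarrow> ('o, 'a) diagram \<Rightarrow> ('o, 'a) diagram" where
  "shift k = map (\<lambda>(n, g). (k + n, g))"

lemma shift_simps [simp]:
  "shift k [] = []" "shift k ((n, g) # ds) = (k + n, g) # shift k ds"
  by (auto simp: shift_def)

lemma shift_append [simp]: "shift k (ds @ ds') = shift k ds @ shift k ds'"
  by (simp add: shift_def)

lemma shift_0 [simp]: "shift 0 ds = ds"
  by (induction ds) auto

text \<open>The offset of the later box is counted after the earlier one has turned
  \<open>xs\<close> into \<open>ys\<close>, so it is recomputed when the two change places. The
  guard keeps the truncated subtraction exact and leaves overlapping boxes alone.\<close>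

fun slide_right :: "nat \<Rightarrow> ('o, 'a) diagram \<Rightarrow> ('o, 'a) diagram" where
  "slide_right (Suc p) (s # ds) = s # slide_right p ds"
| "slide_right 0 ((n, xs, f, ys) # (k, us, g, vs) # ds) =
    (if n + length ys \<le> k then (k - length ys + length xs, us, g, vs) # (n, xs, f, ys) # ds
     else (n, xs, f, ys) # (k, us, g, vs) # ds)"
| "slide_right p ds = ds"

lemma slide_right_numeral [simp]:
  "slide_right (numeral p) (s # ds) = s # slide_right (pred_numeral p) ds"
  by (simp add: numeral_eq_Suc)

text \<open>Here the later box lies to the left and keeps its offset; it is the earlier box whose
  offset changes, by the difference of the lengths of \<open>us\<close> and
  \<open>vs\<close>.\<close>

fun slide_left :: "nat \<Rightarrow> ('o, 'a) diagram \<Rightarrow> ('o, 'a) diagram" where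
  "slide_left (Suc p) (s # ds) = s # slide_left p ds"
| "slide_left 0 ((n, xs, f, ys) # (k, us, g, vs) # ds) =
    (if k + length us \<le> n then (k, us, g, vs) # (n - length us + length vs, xs, f, ys) # ds
     else (n, xs, f, ys) # (k, us, g, vs) # ds)"
| "slide_left p ds = ds"

lemma slide_left_numeral [simp]:
  "slide_left (numeral p) (s # ds) = s # slide_left (pred_numeral p) ds"
  by (simp add: numeral_eq_Suc)

text \<open>The current word is carried along because a side of a rule may be the empty diagram,
  which matches everywhere: only the comparison with \<open>w\<close> ensures that the rule meets
  strands of the right type. For an empty \<open>w\<close> even this is vacuous, and
  \<open>n \<le> length u\<close> excludes positions beyond the last strand.\<close>

fun replace ::
  "'o list \<Rightarrow> ('o, 'a) diagram \<Rightarrow> ('o, 'a) diagram \<Rightarrow> nat \<Rightarrow> nat \<Rightarrow> 'o list \<Rightarrow> ('o, 'a) diagram \<Rightarrow> ('o, 'a) diagram"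
where
  "replace w l r n (Suc p) u ((k, xs, f, ys) # ds) =
     (k, xs, f, ys) # replace w l r n p (take k u @ ys @ drop (k + length xs) u) ds"
| "replace w l r n (Suc p) u [] = []"
| "replace w l r n 0 u ds =
     (if n \<le> length u \<and> take (length w) (drop n u) = w \<and> take (length l) ds = shift n l
      then shift n r @ drop (length l) ds else ds)"

lemma replace_numeral [simp]:
  "replace w l r n (numeral p) u ((k, xs, f, ys) # ds) =
     (k, xs, f, ys) # replace w l r n (pred_numeral p) (take k u @ ys @ drop (k + length xs) u) ds"
  by (simp add: numeral_eq_Suc)

fun apply_move :: "('o, 'a) rule list \<Rightarrow> 'o list \<Rightarrow> move \<Rightarrow> ('o, 'a) diagram \<Rightarrow> ('o, 'a) diagram" where
  "apply_move rs w (SR p) ds = slide_right p ds"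
| "apply_move rs w (SL p) ds = slide_left p ds"
| "apply_move rs w (Rw k p n) ds =
     (if k < length rs then case rs ! k of (v, l, r) \<Rightarrow> replace v l r n p w ds else ds)"
| "apply_move rs w (Bw k p n) ds =
     (if k < length rs then case rs ! k of (v, l, r) \<Rightarrow> replace v r l n p w ds else ds)"

fun run :: "('o, 'a) rule list \<Rightarrow> 'o list \<Rightarrow> move list \<Rightarrow> ('o, 'a) diagram \<Rightarrow> ('o, 'a) diagram" where
  "run rs w [] ds = ds"
| "run rs w (m # ms) ds = run rs w ms (apply_move rs w m ds)"

lemma append_split: "xs @ ys = us @ vs \<Longrightarrow> length xs \<le> length us \<Longrightarrow> \<exists>m. us = xs @ m \<and> ys = m @ vs"
  by (induction xs arbitrary: us) (auto simp: Cons_eq_append_conv)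

context category
begin

lemma HomD: "f \<in> Hom C X Y \<Longrightarrow> f \<in> Arr C" "f \<in> Hom C X Y \<Longrightarrow> Dom C f = X"
  "f \<in> Hom C X Y \<Longrightarrow> Cod C f = Y" "f \<in> Hom C X Y \<Longrightarrow> X \<in> Obj C" "f \<in> Hom C X Y \<Longrightarrow> Y \<in> Obj C"
  using dom_obj cod_obj by (auto simp: Hom_def)

end

context strict_monoidal_category
begin

text \<open>The separate clause for a single letter avoids a trailing unit object, so short words
  simplify to the products that occur in statements, with no use of the unit laws.\<close>

fun ob :: "'o list \<Rightarrow> 'o" where
  "ob [] = \<I>"
| "ob [x] = x"
| "ob (x # y # zs) = x \<odot> ob (y # zs)"

lemma ob_obj [intro]: "set xs \<subseteq> Obj C \<Longrightarrow> ob xs \<in> Obj C"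
  by (induction xs rule: ob.induct) (auto intro: unit_obj tens_obj)

lemma ob_Cons: "x \<in> Obj C \<Longrightarrow> set xs \<subseteq> Obj C \<Longrightarrow> ob (x # xs) = x \<odot> ob xs"
  by (cases xs) (auto simp: unit_obj_right)

lemma ob_append: "set xs \<subseteq> Obj C \<Longrightarrow> set ys \<subseteq> Obj C \<Longrightarrow> ob (xs @ ys) = ob xs \<odot> ob ys"
proof (induction xs)
  case Nil
  then show ?case by (simp add: unit_obj_left ob_obj)
next
  case (Cons x xs)
  then show ?case by (simp add: ob_Cons assoc_obj ob_obj)
qed

definition is_box :: "('o, 'a) box \<Rightarrow> bool" where
  "is_box = (\<lambda>(xs, f, ys). set xs \<subseteq> Obj C \<and> set ys \<subseteq> Obj C \<and> f \<in> Hom C (ob xs) (ob ys))"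

fun eval :: "'o list \<Rightarrow> ('o, 'a) diagram \<Rightarrow> 'a" where
  "eval w [] = \<iota> (ob w)"
| "eval w ((n, xs, f, ys) # ds) = eval (take n w @ ys @ drop (n + length xs) w) ds \<cdot>
     (\<iota> (ob (take n w)) \<otimes> f \<otimes> \<iota> (ob (drop (n + length xs) w)))"

text \<open>The typing judgement for \<open>eval\<close>, which as a total function also accepts
  meaningless lists. Rule induction yields the strands beside a box as explicit words instead of
  \<open>take\<close> and \<open>drop\<close> terms.\<close>

inductive diag :: "'o list \<Rightarrow> ('o, 'a) diagram \<Rightarrow> 'o list \<Rightarrow> bool" where
  dNil: "set w \<subseteq> Obj C \<Longrightarrow> diag w [] w"
| dCons: "diag (u @ ys @ v) ds z \<Longrightarrow> is_box (xs, f, ys) \<Longrightarrow> set u \<subseteq> Obj C \<Longrightarrow> set v \<subseteq> Obj C \<Longrightarrow>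
    n = length u \<Longrightarrow> diag (u @ xs @ v) ((n, xs, f, ys) # ds) z"

lemma whisker_hom:
  assumes "f \<in> Hom C (ob xs) (ob ys)" "set u \<subseteq> Obj C" "set v \<subseteq> Obj C" "set xs \<subseteq> Obj C" "set ys \<subseteq> Obj C"
  shows "\<iota> (ob u) \<otimes> f \<otimes> \<iota> (ob v) \<in> Hom C (ob (u @ xs @ v)) (ob (u @ ys @ v))"
  using assms by (simp add: ob_append) (intro tens_hom id_hom ob_obj)

lemma diag_objs: "diag w ds z \<Longrightarrow> set w \<subseteq> Obj C \<and> set z \<subseteq> Obj C"
  by (induction rule: diag.induct) (auto simp: is_box_def)

lemma eval_hom: "diag w ds z \<Longrightarrow> eval w ds \<in> Hom C (ob w) (ob z)"
proof (induction rule: diag.induct)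
  case (dNil w)
  then show ?case by (auto intro: id_hom)
next
  case (dCons u ys v ds z xs f n)
  then show ?case by (auto simp: is_box_def intro!: comp_hom whisker_hom)
qed

lemma eval_append:
  "diag w ds v \<Longrightarrow> diag v ds' z \<Longrightarrow> diag w (ds @ ds') z \<and> eval w (ds @ ds') = eval v ds' \<cdot> eval w ds"
proof (induction rule: diag.induct)
  case (dNil w)
  then show ?case using eval_hom[OF dNil.prems] by (auto simp: comp_id_right)
next
  case (dCons u ys v ds z' xs f n)
  let ?g = "\<iota> (ob u) \<otimes> f \<otimes> \<iota> (ob v)"
  have g: "?g \<in> Hom C (ob (u @ xs @ v)) (ob (u @ ys @ v))"
    using dCons by (auto simp: is_box_def intro!: whisker_hom)
  show ?case
    using dCons comp_assoc[OF g eval_hom[OF dCons.hyps(1)] eval_hom[OF dCons.prems]]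
    by (auto intro: diag.dCons)
qed

lemma diag_appendD: "diag w (ds @ ds') z \<Longrightarrow> \<exists>v. diag w ds v \<and> diag v ds' z"
proof (induction ds arbitrary: w)
  case Nil
  then have "set w \<subseteq> Obj C" using diag_objs by auto
  then show ?case using Nil diag.dNil[of w] by auto
next
  case (Cons s ds)
  from Cons.prems show ?case
  proof (cases rule: diag.cases)
    case (dCons u ys v ds'' xs f n)
    then obtain v' where "diag (u @ ys @ v) ds v'" "diag v' ds' z" using Cons.IH[of "u @ ys @ v"] by auto
    then show ?thesis using dCons by (auto intro: diag.dCons)
  qed simp
qed

text \<open>Idle strands on both sides commute with evaluation, box by box, by the interchange law.
  This is what makes a rule applicable in the middle of a larger diagram.\<close>

lemma whisker:
  "diag w ds z \<Longrightarrow> set u \<subseteq> Obj C \<Longrightarrow> set v \<subseteq> Obj C \<Longrightarrow>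
    diag (u @ w @ v) (shift (length u) ds) (u @ z @ v) \<and>
    eval (u @ w @ v) (shift (length u) ds) = \<iota> (ob u) \<otimes> eval w ds \<otimes> \<iota> (ob v)"
proof (induction arbitrary: u v rule: diag.induct)
  case (dNil w)
  then have "diag (u @ w @ v) [] (u @ w @ v)" by (intro diag.dNil) auto
  then show ?case using dNil by (auto simp: ob_append tens_id ob_obj tens_obj)
next
  case (dCons u' ys v' ds z xs f n)
  have b: "set xs \<subseteq> Obj C" "set ys \<subseteq> Obj C" "f \<in> Hom C (ob xs) (ob ys)"
    using dCons by (auto simp: is_box_def)
  let ?u = "\<iota> (ob u)" and ?v = "\<iota> (ob v)"
  have arr: "?u \<in> Hom C (ob u) (ob u)" "?v \<in> Hom C (ob v) (ob v)"
    "\<iota> (ob u') \<in> Hom C (ob u') (ob u')" "\<iota> (ob v') \<in> Hom C (ob v') (ob v')"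
    using dCons by (auto intro: id_hom)
  note g = whisker_hom[OF b(3) dCons.hyps(3,4) b(1,2)]
  have IH: "diag ((u @ u') @ ys @ (v' @ v)) (shift (length u) ds) (u @ z @ v)"
    "eval ((u @ u') @ ys @ (v' @ v)) (shift (length u) ds) = ?u \<otimes> eval (u' @ ys @ v') ds \<otimes> ?v"
    using dCons.IH[of u v] dCons.prems by auto
  have e: "eval (u @ (u' @ xs @ v') @ v) (shift (length u) ((n, xs, f, ys) # ds)) =
    (?u \<otimes> eval (u' @ ys @ v') ds \<otimes> ?v) \<cdot> (\<iota> (ob (u @ u')) \<otimes> f \<otimes> \<iota> (ob (v' @ v)))"
    using IH(2) dCons.hyps(5) by simp
  also have "\<iota> (ob (u @ u')) \<otimes> f \<otimes> \<iota> (ob (v' @ v)) = ?u \<otimes> (\<iota> (ob u') \<otimes> f \<otimes> \<iota> (ob v')) \<otimes> ?v"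
    using dCons.hyps(3,4) dCons.prems b tens_hom
    apply (simp add: ob_append tens_id[symmetric] ob_obj)
    apply (subst assoc_arr, (rule HomD arr b tens_hom)+)+
    apply simp
    done
  also have "(?u \<otimes> eval (u' @ ys @ v') ds \<otimes> ?v) \<cdot> (?u \<otimes> (\<iota> (ob u') \<otimes> f \<otimes> \<iota> (ob v')) \<otimes> ?v) =
     ?u \<otimes> (eval (u' @ ys @ v') ds \<cdot> (\<iota> (ob u') \<otimes> f \<otimes> \<iota> (ob v'))) \<otimes> ?v"
    using interchange[OF arr(1) arr(1) tens_hom[OF g arr(2)] tens_hom[OF eval_hom[OF dCons.hyps(1)] arr(2)]]
      interchange[OF g eval_hom[OF dCons.hyps(1)] arr(2) arr(2)]
      comp_id_left[OF arr(1)] comp_id_left[OF arr(2)] by simp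
  finally have "eval (u @ (u' @ xs @ v') @ v) (shift (length u) ((n, xs, f, ys) # ds)) =
    ?u \<otimes> eval (u' @ xs @ v') ((n, xs, f, ys) # ds) \<otimes> ?v"
    using dCons.hyps(5) by simp
  moreover have "diag ((u @ u') @ xs @ (v' @ v)) ((length u + n, xs, f, ys) # shift (length u) ds) (u @ z @ v)"
    by (rule diag.dCons[OF IH(1)]) (use dCons in auto)
  ultimately show ?case by simp
qed

lemma slide:
  assumes f: "is_box (xs, f, ys)" and g: "is_box (us, g, vs)"
    and objs: "set u \<subseteq> Obj C" "set m \<subseteq> Obj C" "set v \<subseteq> Obj C"
    and ds: "diag (u @ ys @ m @ vs @ v) ds z"
  defines "w \<equiv> u @ xs @ m @ us @ v"
    and "l \<equiv> (length u, xs, f, ys) # (length u + length ys + length m, us, g, vs) # ds"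
    and "r \<equiv> (length u + length xs + length m, us, g, vs) # (length u, xs, f, ys) # ds"
  shows "diag w l z" "diag w r z" "eval w l = eval w r"
proof -
  have "diag ((u @ ys @ m) @ us @ v) ((length u + length ys + length m, us, g, vs) # ds) z"
    using ds by (intro diag.dCons[OF _ g]) (use objs f in \<open>auto simp: is_box_def\<close>)
  then show "diag w l z"
    unfolding w_def l_def by (intro diag.dCons[OF _ f]) (use objs g in \<open>auto simp: is_box_def\<close>)
  have "diag (u @ xs @ (m @ vs @ v)) ((length u, xs, f, ys) # ds) z"
    using ds by (intro diag.dCons[OF _ f]) (use objs g in \<open>auto simp: is_box_def\<close>)
  then have "diag ((u @ xs @ m) @ us @ v) r z"
    unfolding r_def by (intro diag.dCons[OF _ g]) (use objs f in \<open>auto simp: is_box_def\<close>)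
  then show "diag w r z" by (simp add: w_def)
  have F: "set xs \<subseteq> Obj C" "set ys \<subseteq> Obj C" "f \<in> Hom C (ob xs) (ob ys)"
    and G: "set us \<subseteq> Obj C" "set vs \<subseteq> Obj C" "g \<in> Hom C (ob us) (ob vs)"
    using f g by (auto simp: is_box_def)
  let ?g = "\<iota> (ob m) \<otimes> g \<otimes> \<iota> (ob v)"
  have g': "?g \<in> Hom C (ob (m @ us @ v)) (ob (m @ vs @ v))"
    by (rule whisker_hom) (use G objs in auto)
  have id: "\<iota> (ob u) \<in> Hom C (ob u) (ob u)" "\<iota> (ob m) \<in> Hom C (ob m) (ob m)"
    "\<iota> (ob v) \<in> Hom C (ob v) (ob v)" "\<iota> (ob xs) \<in> Hom C (ob xs) (ob xs)"
    "\<iota> (ob ys) \<in> Hom C (ob ys) (ob ys)"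
    "\<iota> (ob (m @ us @ v)) \<in> Hom C (ob (m @ us @ v)) (ob (m @ us @ v))"
    "\<iota> (ob (m @ vs @ v)) \<in> Hom C (ob (m @ vs @ v)) (ob (m @ vs @ v))"
    by (intro id_hom ob_obj; use objs F G in auto)+
  have slide_g: "\<iota> (ob (u @ as @ m)) \<otimes> g \<otimes> \<iota> (ob v) = \<iota> (ob u) \<otimes> \<iota> (ob as) \<otimes> ?g"
    if "set as \<subseteq> Obj C" for as
  proof -
    have as: "\<iota> (ob as) \<in> Hom C (ob as) (ob as)" using that by (intro id_hom ob_obj)
    note h = HomD(1)[OF id(1)] HomD(1)[OF id(2)] HomD(1)[OF as] HomD(1)[OF tens_hom[OF as id(2)]]
      HomD(1)[OF tens_hom[OF G(3) id(3)]]
    have "\<iota> (ob (u @ as @ m)) = \<iota> (ob u) \<otimes> \<iota> (ob as) \<otimes> \<iota> (ob m)"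
      using that objs by (simp add: ob_append tens_id ob_obj tens_obj)
    then show ?thesis by (simp add: assoc_arr h)
  qed
  have id_tens: "\<iota> (ob u) \<cdot> \<iota> (ob u) = \<iota> (ob u)" using id by (auto intro: comp_id_left)
  have side: "set (m @ us @ v) \<subseteq> Obj C" "set (m @ vs @ v) \<subseteq> Obj C"
    "set (u @ xs @ m) \<subseteq> Obj C" "set (u @ ys @ m) \<subseteq> Obj C"
    using objs F G by auto
  note fl = whisker_hom[OF F(3) objs(1) side(1) F(1,2)] and fr = whisker_hom[OF F(3) objs(1) side(2) F(1,2)]
    and gl = whisker_hom[OF G(3) side(4) objs(3) G(1,2), simplified append_assoc]
    and gr = whisker_hom[OF G(3) side(3) objs(3) G(1,2), simplified append_assoc]
  have "eval w l = eval (u @ ys @ m @ vs @ v) ds \<cdot>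
      (\<iota> (ob (u @ ys @ m)) \<otimes> g \<otimes> \<iota> (ob v)) \<cdot> (\<iota> (ob u) \<otimes> f \<otimes> \<iota> (ob (m @ us @ v)))"
    unfolding w_def l_def
    using comp_assoc[OF fl gl eval_hom[OF ds]] by simp
  \<comment> \<open>Both orders of application are compared with the morphism in which
    \<open>f\<close> and \<open>g\<close> stand side by side.\<close>
  also have "(\<iota> (ob (u @ ys @ m)) \<otimes> g \<otimes> \<iota> (ob v)) \<cdot> (\<iota> (ob u) \<otimes> f \<otimes> \<iota> (ob (m @ us @ v))) =
     \<iota> (ob u) \<otimes> f \<otimes> ?g"
    using interchange[OF id(1) id(1) tens_hom[OF F(3) id(6)] tens_hom[OF id(5) g']]
      interchange[OF F(3) id(5) id(6) g'] comp_id_left[OF F(3)] comp_id_right[OF g'] id_tens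
    by (simp add: slide_g[OF F(2)])
  also have "\<dots> = (\<iota> (ob u) \<otimes> f \<otimes> \<iota> (ob (m @ vs @ v))) \<cdot> (\<iota> (ob (u @ xs @ m)) \<otimes> g \<otimes> \<iota> (ob v))"
    using interchange[OF id(1) id(1) tens_hom[OF id(4) g'] tens_hom[OF F(3) id(7)]]
      interchange[OF id(4) F(3) g' id(7)] comp_id_right[OF F(3)] comp_id_left[OF g'] id_tens
    by (simp add: slide_g[OF F(1)])
  also have "eval (u @ ys @ m @ vs @ v) ds \<cdot> \<dots> = eval w r"
    unfolding w_def r_def
    using comp_assoc[OF gr fr eval_hom[OF ds]] by simp
  finally show "eval w l = eval w r" .
qed

lemma diag_ConsE:
  assumes "diag w ((n, xs, f, ys) # ds) z"
  obtains u v where "w = u @ xs @ v" "diag (u @ ys @ v) ds z" "is_box (xs, f, ys)"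
    "set u \<subseteq> Obj C" "set v \<subseteq> Obj C" "n = length u"
  using assms by (cases rule: diag.cases) auto

lemma slide_right_sound:
  "diag w ds z \<Longrightarrow> diag w (slide_right p ds) z \<and> eval w (slide_right p ds) = eval w ds"
proof (induction p ds arbitrary: w rule: slide_right.induct)
  case (1 p s ds)
  obtain n xs f ys where s: "s = (n, xs, f, ys)" by (cases s) auto
  from 1 show ?case unfolding s by (auto elim!: diag_ConsE intro!: diag.dCons)
next
  case (2 n xs f ys k us g vs ds)
  from 2 obtain u v where 1: "w = u @ xs @ v" "diag (u @ ys @ v) ((k, us, g, vs) # ds) z"
    "is_box (xs, f, ys)" "set u \<subseteq> Obj C" "set v \<subseteq> Obj C" "n = length u"
    by (rule diag_ConsE)
  from 1(2) obtain u' v' where 2: "u @ ys @ v = u' @ us @ v'" "diag (u' @ vs @ v') ds z"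
    "is_box (us, g, vs)" "set u' \<subseteq> Obj C" "set v' \<subseteq> Obj C" "k = length u'"
    by (elim diag_ConsE)
  show ?case
  proof (cases "n + length ys \<le> k")
    case True
    then obtain m where m: "u' = (u @ ys) @ m" "v = m @ us @ v'"
      using append_split[of "u @ ys" v u' "us @ v'"] 1(6) 2(1,6) by auto
    then have "set m \<subseteq> Obj C" using 2(4) by auto
    moreover have "diag (u @ ys @ m @ vs @ v') ds z" using 2(2) m(1) by simp
    moreover have "k = length u + length ys + length m" "w = u @ xs @ m @ us @ v'" using 1(1) 2(6) m by auto
    moreover from this(1) True have "slide_right 0 ((n, xs, f, ys) # (k, us, g, vs) # ds) =
        (length u + length xs + length m, us, g, vs) # (length u, xs, f, ys) # ds"
      using 1(6) by simp
    ultimately show ?thesis using slide(2,3)[OF 1(3) 2(3) 1(4) _ 2(5)] 1(6) by (simp only:)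
  qed (use \<open>diag w ((n, xs, f, ys) # (k, us, g, vs) # ds) z\<close> in auto)
qed auto

lemma slide_left_sound:
  "diag w ds z \<Longrightarrow> diag w (slide_left p ds) z \<and> eval w (slide_left p ds) = eval w ds"
proof (induction p ds arbitrary: w rule: slide_left.induct)
  case (1 p s ds)
  obtain n xs f ys where s: "s = (n, xs, f, ys)" by (cases s) auto
  from 1 show ?case unfolding s by (auto elim!: diag_ConsE intro!: diag.dCons)
next
  case (2 n xs f ys k us g vs ds)
  from 2 obtain u v where 1: "w = u @ xs @ v" "diag (u @ ys @ v) ((k, us, g, vs) # ds) z"
    "is_box (xs, f, ys)" "set u \<subseteq> Obj C" "set v \<subseteq> Obj C" "n = length u"
    by (rule diag_ConsE)
  from 1(2) obtain u' v' where 2: "u @ ys @ v = u' @ us @ v'" "diag (u' @ vs @ v') ds z"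
    "is_box (us, g, vs)" "set u' \<subseteq> Obj C" "set v' \<subseteq> Obj C" "k = length u'"
    by (elim diag_ConsE)
  show ?case
  proof (cases "k + length us \<le> n")
    case True
    then obtain m where m: "u = (u' @ us) @ m" "v' = m @ ys @ v"
      using append_split[of "u' @ us" v' u "ys @ v"] 1(6) 2(1,6) by auto
    then have "set m \<subseteq> Obj C" using 1(4) by auto
    moreover have "diag (u' @ vs @ m @ ys @ v) ds z" using 2(1,2) m by simp
    moreover have "n = length u' + length us + length m" "w = u' @ us @ m @ xs @ v" using 1(1,6) m by auto
    moreover from this(1) True have "slide_left 0 ((n, xs, f, ys) # (k, us, g, vs) # ds) =
        (length u', us, g, vs) # (length u' + length vs + length m, xs, f, ys) # ds"
      using 2(6) by simp
    ultimately show ?thesis using slide(1,3)[OF 2(3) 1(3) 2(4) _ 1(5)] 2(6) by (simp only:)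
  qed (use \<open>diag w ((n, xs, f, ys) # (k, us, g, vs) # ds) z\<close> in auto)
qed auto

text \<open>Identifies the word reached after the matched part of a diagram with the target of the
  rule, so that the rest of the diagram can be attached to the other side of the rule.\<close>

lemma diag_tgt_unique: "diag w ds z \<Longrightarrow> diag w ds z' \<Longrightarrow> z = z'"
proof (induction arbitrary: z' rule: diag.induct)
  case (dNil w)
  from dNil(2) show ?case by (cases rule: diag.cases) auto
next
  case (dCons u ys v ds z xs f n)
  from dCons(7) obtain a b where "u @ xs @ v = a @ xs @ b" "diag (a @ ys @ b) ds z'" "n = length a"
    by (elim diag_ConsE) auto
  with dCons.IH show ?case using \<open>n = length u\<close> by simp
qed

definition good :: "('o, 'a) rule \<Rightarrow> bool" where
  "good = (\<lambda>(w, l, r). \<exists>z. diag w l z \<and> diag w r z \<and> eval w l = eval w r)"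

lemma good_sym: "good (w, l, r) \<Longrightarrow> good (w, r, l)"
  by (auto simp: good_def)

lemma replace_sound:
  "good (w, l, r) \<Longrightarrow> diag u ds z \<Longrightarrow>
    diag u (replace w l r n p u ds) z \<and> eval u (replace w l r n p u ds) = eval u ds"
proof (induction w l r n p u ds rule: replace.induct)
  case (1 w l r n p u k xs f ys ds)
  from 1(3) obtain a b where "u = a @ xs @ b" "diag (a @ ys @ b) ds z" "is_box (xs, f, ys)"
    "set a \<subseteq> Obj C" "set b \<subseteq> Obj C" "k = length a" by (elim diag_ConsE)
  with 1(1)[OF 1(2)] show ?case by (auto intro!: diag.dCons)
next
  case (3 w l r n u ds)
  show ?case
  proof (cases "n \<le> length u \<and> take (length w) (drop n u) = w \<and> take (length l) ds = shift n l")
    case True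
    \<comment> \<open>These are the idle strands to the left and to the right of the match.\<close>
    define a b where "a = take n u" and "b = drop (length w) (drop n u)"
    have u: "u = a @ w @ b" and n: "n = length a"
      using True append_take_drop_id[of "length w" "drop n u"] append_take_drop_id[of n u]
      by (auto simp: a_def b_def simp del: append_take_drop_id)
    then have ab: "set a \<subseteq> Obj C" "set b \<subseteq> Obj C" using diag_objs[OF 3(2)] by auto
    define ds' where "ds' = drop (length l) ds"
    have ds: "ds = shift n l @ ds'"
      using True append_take_drop_id[of "length l" ds] by (simp add: ds'_def)
    from 3(1) obtain y where y: "diag w l y" "diag w r y" "eval w l = eval w r"
      by (auto simp: good_def)
    note wl = whisker[OF y(1) ab] and wr = whisker[OF y(2) ab]
    from 3(2) obtain x where x: "diag u (shift n l) x" "diag x ds' z"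
      unfolding ds using diag_appendD by blast
    have "x = a @ y @ b"
      using x(1) wl u n by (metis diag_tgt_unique)
    with x wl wr y(3) u n eval_append[of u "shift n l" x ds' z] eval_append[of u "shift n r" x ds' z]
    show ?thesis using True by (simp add: ds'_def[symmetric]) (simp add: ds)
  qed (use 3 in auto)
qed auto

lemma run_sound:
  "list_all good rs \<Longrightarrow> diag w ds z \<Longrightarrow> diag w (run rs w ms ds) z \<and> eval w (run rs w ms ds) = eval w ds"
proof (induction ms arbitrary: ds)
  case (Cons m ms)
  have "diag w (apply_move rs w m ds) z \<and> eval w (apply_move rs w m ds) = eval w ds"
    using Cons.prems slide_right_sound slide_left_sound replace_sound good_sym
    by (cases m) (auto split: prod.splits simp: list_all_length)
  with Cons show ?case by simp
qed simp

definition repr :: "'a \<Rightarrow> 'o list \<Rightarrow> ('o, 'a) diagram \<Rightarrow> 'o list \<Rightarrow> bool" where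
  "repr e w ds z \<longleftrightarrow> diag w ds z \<and> eval w ds = e"

text \<open>The first two premises compute the diagrams by following the structure of the two
  expressions; the last one is settled by evaluating \<open>run\<close>. Only the diagram of
  \<open>e\<close> is rewritten, hence certificates use rules in both directions.\<close>

theorem run_eq:
  assumes "repr e w ds z" "repr e' w' ds' z'" "w = w'" "list_all good rs" "run rs w ms ds = ds'"
  shows "e = e'"
  using assms run_sound by (metis repr_def)

lemma repr_box: "is_box (xs, f, ys) \<Longrightarrow> repr f xs [(0, xs, f, ys)] ys"
proof -
  assume b: "is_box (xs, f, ys)"
  then have o: "set xs \<subseteq> Obj C" "set ys \<subseteq> Obj C" "f \<in> Hom C (ob xs) (ob ys)" by (auto simp: is_box_def)
  then have "f \<in> Arr C" by (auto dest: HomD)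
  moreover have "diag ([] @ xs @ []) [(0, xs, f, ys)] ys"
    using o by (intro diag.dCons[OF _ b]) (auto intro: diag.dNil)
  ultimately show ?thesis using comp_id_left[OF o(3)] by (simp add: repr_def unit_arr_left unit_arr_right)
qed

lemma repr_id: "set w \<subseteq> Obj C \<Longrightarrow> X = ob w \<Longrightarrow> repr (\<iota> X) w [] w"
  by (auto simp: repr_def intro: diag.dNil)

lemma repr_comp: "repr g v ds' z \<Longrightarrow> repr f w ds v' \<Longrightarrow> v' = v \<Longrightarrow> repr (g \<cdot> f) w (ds @ ds') z"
  using eval_append by (auto simp: repr_def)

lemma repr_tens:
  assumes "repr f w ds z" "repr g w' ds' z'"
  shows "repr (f \<otimes> g) (w @ w') (ds @ shift (length z) ds') (z @ z')"
proof -
  have f: "diag w ds z" "eval w ds = f" and g: "diag w' ds' z'" "eval w' ds' = g"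
    using assms by (auto simp: repr_def)
  have o: "set w \<subseteq> Obj C" "set z \<subseteq> Obj C" "set w' \<subseteq> Obj C" "set z' \<subseteq> Obj C"
    using diag_objs[OF f(1)] diag_objs[OF g(1)] by auto
  have F: "f \<in> Hom C (ob w) (ob z)" and G: "g \<in> Hom C (ob w') (ob z')"
    using eval_hom[OF f(1)] eval_hom[OF g(1)] f g by auto
  have "diag (w @ w') ds (z @ w')" "eval (w @ w') ds = f \<otimes> \<iota> (ob w')"
    using whisker[OF f(1), of "[]" w'] o f F HomD tens_hom[OF F id_hom[of "ob w'"]]
    by (auto simp: unit_arr_left ob_obj)
  moreover have "diag (z @ w') (shift (length z) ds') (z @ z')"
    "eval (z @ w') (shift (length z) ds') = \<iota> (ob z) \<otimes> g"
    using whisker[OF g(1), of z "[]"] o g G HomD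
    by (auto simp: unit_arr_right)
  ultimately have "diag (w @ w') (ds @ shift (length z) ds') (z @ z')"
    "eval (w @ w') (ds @ shift (length z) ds') = (\<iota> (ob z) \<otimes> g) \<cdot> (f \<otimes> \<iota> (ob w'))"
    using eval_append by auto
  then show ?thesis
    using interchange[OF F id_hom id_hom G] comp_id_left[OF F] comp_id_right[OF G] o
    by (simp add: repr_def ob_obj)
qed

text \<open>Separates the computation of a diagram, which leaves appends and shifts behind, from its
  comparison with the diagram that is stated.\<close>

lemma repr_cong: "repr e w ds z \<Longrightarrow> w = w' \<Longrightarrow> ds = ds' \<Longrightarrow> z = z' \<Longrightarrow> repr e w' ds' z'"
  by simp

end

named_theorems reprs

context strict_monoidal_category
begin

lemma good_Nil: "list_all good []" by simp
lemma good_Cons: "good r \<Longrightarrow> list_all good rs \<Longrightarrow> list_all good (r # rs)" by simp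

lemma goodI:
  assumes "e = e'" "repr e w\<^sub>1 l' z" "repr e' w\<^sub>2 r' z'" "w\<^sub>1 = w" "l' = l" "w\<^sub>2 = w" "r' = r" "z = z'"
  shows "good (w, l, r)"
  using assms by (auto simp: good_def repr_def)

lemma repr_id1: "X \<in> Obj C \<Longrightarrow> repr (\<iota> X) [X] [] [X]"
  by (rule repr_id) auto

lemma repr_idI: "repr (\<iota> \<I>) [] [] []"
  by (rule repr_id) auto

lemma repr_id2: "X \<in> Obj C \<Longrightarrow> Y \<in> Obj C \<Longrightarrow> repr (\<iota> (X \<odot> Y)) [X, Y] [] [X, Y]"
  by (rule repr_id) auto

lemmas [reprs] = repr_comp repr_tens repr_id2 repr_id1

lemma left_dual_boxes:
  assumes "is_left_dual C (ob w) Y e d" "set w \<subseteq> Obj C"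
  shows "Y \<in> Obj C" "is_box (Y # w, e, [])" "is_box ([], d, w @ [Y])"
  using assms by (auto simp: is_left_dual_def is_box_def ob_Cons ob_append)

text \<open>The object that has the dual is given by a word: the empty word covers a dual of the
  unit object, two letters cover a dual of X \<otimes> Y with X and Y drawn as separate
  strands.\<close>

lemma snake_rules:
  assumes dual: "is_left_dual C (ob w) Y e d" and w: "set w \<subseteq> Obj C"
  shows "good (w, [(0, [], d, w @ [Y]), (length w, Y # w, e, [])], [])" (is ?A)
    and "good ([Y], [(1, [], d, w @ [Y]), (0, Y # w, e, [])], [])" (is ?B)
proof -
  note box = left_dual_boxes[OF dual w]
  have eq: "(\<iota> (ob w) \<otimes> e) \<cdot> (d \<otimes> \<iota> (ob w)) = \<iota> (ob w)" "(e \<otimes> \<iota> Y) \<cdot> (\<iota> Y \<otimes> d) = \<iota> Y"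
    using dual by (auto simp: is_left_dual_def)
  note r = repr_comp repr_tens repr_id1[OF box(1)] repr_id[OF w refl] repr_box[OF box(2)] repr_box[OF box(3)]
  show ?A by (rule goodI[OF eq(1)]) (rule r repr_box | simp)+
  show ?B by (rule goodI[OF eq(2)]) (rule r repr_box | simp)+
qed

end

subsection \<open>Diagrams with crossings\<close>

context braided_monoidal_category
begin

lemma idem_iso_id:
  assumes "f \<in> Hom C X X" "is_iso C f" "f \<cdot> f = f"
  shows "f = \<iota> X"
proof -
  obtain g where g: "g \<in> Hom C X X" "g \<cdot> f = \<iota> X"
    using assms by (auto simp: is_iso_def Hom_def)
  have "f = (g \<cdot> f) \<cdot> f" using assms(1) g(2) by (simp add: comp_id_left)
  also have "\<dots> = g \<cdot> (f \<cdot> f)" by (rule comp_assoc[OF assms(1,1) g(1)])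
  finally show ?thesis using assms(3) g(2) by simp
qed

text \<open>The axioms of a braiding do not mention the unit object. The hexagon with two unit
  objects makes this morphism idempotent, and an invertible idempotent is an identity.\<close>

lemma braid_unit_left: "X \<in> Obj C \<Longrightarrow> \<Phi> \<I> X = \<iota> X"
  using hexagon_left[of \<I> \<I> X] braid_hom[of \<I> X] unit_obj
  by (intro idem_iso_id braid_iso)
    (auto simp: unit_obj_left unit_obj_right unit_arr_left unit_arr_right dest: HomD(1))

lemma braid_unit_right: "X \<in> Obj C \<Longrightarrow> \<Phi> X \<I> = \<iota> X"
  using hexagon_right[of X \<I> \<I>] braid_hom[of X \<I>] unit_obj
  by (intro idem_iso_id braid_iso)
    (auto simp: unit_obj_left unit_obj_right unit_arr_left unit_arr_right dest: HomD(1))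

abbreviation crossing :: "'o \<Rightarrow> 'o \<Rightarrow> ('o, 'a) box" where
  "crossing X Y \<equiv> ([X, Y], \<Phi> X Y, [Y, X])"

lemma crossing_box: "X \<in> Obj C \<Longrightarrow> Y \<in> Obj C \<Longrightarrow> is_box (crossing X Y)"
  using braid_hom by (auto simp: is_box_def)

fun cross_left :: "'o list \<Rightarrow> 'o \<Rightarrow> ('o, 'a) diagram" where
  "cross_left [] Y = []"
| "cross_left (X # xs) Y = shift 1 (cross_left xs Y) @ [(0, crossing X Y)]"

fun cross_right :: "'o \<Rightarrow> 'o list \<Rightarrow> ('o, 'a) diagram" where
  "cross_right X [] = []"
| "cross_right X (Y # ys) = (0, crossing X Y) # shift 1 (cross_right X ys)"

lemma repr_cross_left:
  "set xs \<subseteq> Obj C \<Longrightarrow> Y \<in> Obj C \<Longrightarrow> repr (\<Phi> (ob xs) Y) (xs @ [Y]) (cross_left xs Y) (Y # xs)"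
proof (induction xs)
  case Nil
  then show ?case by (simp add: braid_unit_left repr_id1)
next
  case (Cons X xs)
  then have o: "X \<in> Obj C" "ob xs \<in> Obj C" by auto
  have "repr ((\<Phi> X Y \<otimes> \<iota> (ob xs)) \<cdot> (\<iota> X \<otimes> \<Phi> (ob xs) Y)) (X # xs @ [Y])
    (shift 1 (cross_left xs Y) @ [(0, crossing X Y)]) (Y # X # xs)"
    by (rule repr_cong, rule repr_comp[OF repr_tens[OF repr_box[OF crossing_box] repr_id]
        repr_tens[OF repr_id1 Cons.IH]]) (use Cons.prems in auto)
  then show ?case using Cons o by (simp add: hexagon_left ob_Cons)
qed

lemma repr_cross_right:
  "set ys \<subseteq> Obj C \<Longrightarrow> X \<in> Obj C \<Longrightarrow> repr (\<Phi> X (ob ys)) (X # ys) (cross_right X ys) (ys @ [X])"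
proof (induction ys)
  case Nil
  then show ?case by (simp add: braid_unit_right repr_id1)
next
  case (Cons Y ys)
  then have o: "Y \<in> Obj C" "ob ys \<in> Obj C" by auto
  have "repr ((\<iota> Y \<otimes> \<Phi> X (ob ys)) \<cdot> (\<Phi> X Y \<otimes> \<iota> (ob ys))) (X # Y # ys)
    ((0, crossing X Y) # shift 1 (cross_right X ys)) (Y # ys @ [X])"
    by (rule repr_cong, rule repr_comp[OF repr_tens[OF repr_id1 Cons.IH]
        repr_tens[OF repr_box[OF crossing_box] repr_id]]) (use Cons.prems in auto)
  then show ?case using Cons o by (simp add: hexagon_right ob_Cons)
qed

text \<open>For a box that is itself a crossing, this and \<open>natural_right\<close> give the
  Yang-Baxter relation; for an evaluation or a coevaluation they pull a cap or a cup across a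
  strand.\<close>

lemma natural_left:
  assumes b: "is_box (xs, f, ys)" and Y: "Y \<in> Obj C"
  shows "good (xs @ [Y], (0, xs, f, ys) # cross_left ys Y, cross_left xs Y @ [(1, xs, f, ys)])"
proof (rule goodI)
  have o: "set xs \<subseteq> Obj C" "set ys \<subseteq> Obj C" "f \<in> Hom C (ob xs) (ob ys)"
    using b by (auto simp: is_box_def)
  then show "\<Phi> (ob ys) Y \<cdot> (f \<otimes> \<iota> Y) = (\<iota> Y \<otimes> f) \<cdot> \<Phi> (ob xs) Y"
    using Y by (auto intro: braid_natural id_hom)
  show "repr (\<Phi> (ob ys) Y \<cdot> (f \<otimes> \<iota> Y)) (xs @ [Y]) ((0, xs, f, ys) # cross_left ys Y) (Y # ys)"
    by (rule repr_cong, rule repr_comp[OF repr_cross_left repr_tens[OF repr_box[OF b] repr_id1]])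
      (use o Y in auto)
  show "repr ((\<iota> Y \<otimes> f) \<cdot> \<Phi> (ob xs) Y) (xs @ [Y]) (cross_left xs Y @ [(1, xs, f, ys)]) (Y # ys)"
    by (rule repr_cong, rule repr_comp[OF repr_tens[OF repr_id1 repr_box[OF b]] repr_cross_left])
      (use o Y in auto)
qed auto

lemma natural_right:
  assumes b: "is_box (xs, f, ys)" and X: "X \<in> Obj C"
  shows "good (X # xs, (1, xs, f, ys) # cross_right X ys, cross_right X xs @ [(0, xs, f, ys)])"
proof (rule goodI)
  have o: "set xs \<subseteq> Obj C" "set ys \<subseteq> Obj C" "f \<in> Hom C (ob xs) (ob ys)"
    using b by (auto simp: is_box_def)
  then show "\<Phi> X (ob ys) \<cdot> (\<iota> X \<otimes> f) = (f \<otimes> \<iota> X) \<cdot> \<Phi> X (ob xs)"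
    using X by (auto intro: braid_natural id_hom)
  show "repr (\<Phi> X (ob ys) \<cdot> (\<iota> X \<otimes> f)) (X # xs) ((1, xs, f, ys) # cross_right X ys) (ys @ [X])"
    by (rule repr_cong, rule repr_comp[OF repr_cross_right repr_tens[OF repr_id1 repr_box[OF b]]])
      (use o X in auto)
  show "repr ((f \<otimes> \<iota> X) \<cdot> \<Phi> X (ob xs)) (X # xs) (cross_right X xs @ [(0, xs, f, ys)]) (ys @ [X])"
    by (rule repr_cong, rule repr_comp[OF repr_tens[OF repr_box[OF b] repr_id1] repr_cross_right])
      (use o X in auto)
qed auto

lemma repr_braid: "X \<in> Obj C \<Longrightarrow> Y \<in> Obj C \<Longrightarrow> repr (\<Phi> X Y) [X, Y] [(0, crossing X Y)] [Y, X]"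
  by (intro repr_box crossing_box)

lemma repr_braid21: "X \<in> Obj C \<Longrightarrow> Y \<in> Obj C \<Longrightarrow> Z \<in> Obj C \<Longrightarrow>
  repr (\<Phi> (X \<odot> Y) Z) [X, Y, Z] [(1, crossing Y Z), (0, crossing X Z)] [Z, X, Y]"
  using repr_cross_left[of "[X, Y]" Z] by simp

lemma repr_braid12: "X \<in> Obj C \<Longrightarrow> Y \<in> Obj C \<Longrightarrow> Z \<in> Obj C \<Longrightarrow>
  repr (\<Phi> X (Y \<odot> Z)) [X, Y, Z] [(0, crossing X Y), (1, crossing X Z)] [Y, Z, X]"
  using repr_cross_right[of "[Y, Z]" X] by simp

lemmas [reprs] = repr_braid21 repr_braid12 repr_braid

end

context strict_monoidal_category
begin

text \<open>Reading off source and target of a diagram replaces the typing derivations for long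
  composites.\<close>

lemma repr_hom: "repr e w ds z \<Longrightarrow> e \<in> Hom C (ob w) (ob z)"
  using eval_hom by (auto simp: repr_def)

lemma repr_is_box: "repr e w ds z \<Longrightarrow> is_box (w, e, z)"
  unfolding repr_def is_box_def using eval_hom[of w ds z] diag_objs[of w ds z] by auto

end

subsection \<open>Coends with additional strands\<close>

locale coend = strict_monoidal_category C
  for C :: "('o, 'a, 'z) moncat_scheme" (structure) +
  fixes A :: 'o and i :: "'o \<Rightarrow> 'a"
  assumes rigid: "rigid C" and coend: "is_aut_coend C A i"
begin

lemma is_dual: "X \<in> Obj C \<Longrightarrow> is_left_dual C X (dual C X) (ev C X) (coev C X)"
proof -
  assume "X \<in> Obj C"
  then obtain Y e d where "is_left_dual C X Y e d" using rigid by (auto simp: rigid_def)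
  then have "\<exists>T. (\<lambda>(Y, e, d). is_left_dual C X Y e d) T" by auto
  then have "(\<lambda>(Y, e, d). is_left_dual C X Y e d) (dual_triple C X)"
    unfolding dual_triple_def by (rule someI_ex)
  then show ?thesis by (simp add: dual_def ev_def coev_def case_prod_beta)
qed

lemma dual_obj [simp]: "X \<in> Obj C \<Longrightarrow> dual C X \<in> Obj C"
  using is_dual by (auto simp: is_left_dual_def)

lemma A_obj [simp]: "A \<in> Obj C"
  using coend by (auto simp: is_aut_coend_def dinatural_def)

lemma i_hom: "X \<in> Obj C \<Longrightarrow> i X \<in> Hom C (dual C X \<odot> X) A"
  using coend by (auto simp: is_aut_coend_def dinatural_def)

lemma i_box: "X \<in> Obj C \<Longrightarrow> is_box ([dual C X, X], i X, [A])"
  using i_hom by (auto simp: is_box_def)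

lemma dual_arr_hom: "f \<in> Hom C X Y \<Longrightarrow> dual_arr C f \<in> Hom C (dual C Y) (dual C X)"
  and dual_arr_rule: "f \<in> Hom C X Y \<Longrightarrow> good ([dual C Y], [(0, [dual C Y], dual_arr C f, [dual C X])],
    [(1, [], coev C X, [X, dual C X]), (1, [X], f, [Y]), (0, [dual C Y, Y], ev C Y, [])])"
proof -
  assume f: "f \<in> Hom C X Y"
  then have [simp]: "X \<in> Obj C" "Y \<in> Obj C" and d: "Dom C f = X" "Cod C f = Y" by (auto dest: HomD)
  note bX = left_dual_boxes[of "[X]", simplified, OF is_dual]
  note bY = left_dual_boxes[of "[Y]", simplified, OF is_dual]
  have bf: "is_box ([X], f, [Y])" using f by (auto simp: is_box_def)
  note [reprs] = bX(3) bY(2) bf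
  have r: "repr (dual_arr C f) [dual C Y]
    [(1, [], coev C X, [X, dual C X]), (1, [X], f, [Y]), (0, [dual C Y, Y], ev C Y, [])] [dual C X]"
    unfolding dual_arr_def d Let_def
    by (rule repr_cong) (rule reprs repr_box | simp)+
  then show h: "dual_arr C f \<in> Hom C (dual C Y) (dual C X)"
    using repr_hom by fastforce
  then have "is_box ([dual C Y], dual_arr C f, [dual C X])" by (auto simp: is_box_def)
  from goodI[OF refl repr_box[OF this] r] show "good ([dual C Y], [(0, [dual C Y], dual_arr C f, [dual C X])],
    [(1, [], coev C X, [X, dual C X]), (1, [X], f, [Y]), (0, [dual C Y, Y], ev C Y, [])])" by simp
qed

definition dinat_family :: "'o \<Rightarrow> 'o \<Rightarrow> 'o \<Rightarrow> ('o \<Rightarrow> 'a) \<Rightarrow> bool" where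
  "dinat_family V Z W s \<longleftrightarrow> (\<forall>X \<in> Obj C. s X \<in> Hom C (V \<odot> dual C X \<odot> X \<odot> Z) W) \<and>
     (\<forall>X \<in> Obj C. \<forall>Y \<in> Obj C. \<forall>f \<in> Hom C X Y.
        s X \<cdot> (\<iota> V \<otimes> dual_arr C f \<otimes> \<iota> X \<otimes> \<iota> Z) = s Y \<cdot> (\<iota> V \<otimes> \<iota> (dual C Y) \<otimes> f \<otimes> \<iota> Z))"

text \<open>Additional strands are bent to the target by means of duals.\<close>

lemma coend_whiskered:
  assumes V: "V \<in> Obj C" and Z: "Z \<in> Obj C" and W: "W \<in> Obj C" and s: "dinat_family V Z W s"
  shows "\<exists>!a. a \<in> Hom C (V \<odot> A \<odot> Z) W \<and> (\<forall>X \<in> Obj C. a \<cdot> (\<iota> V \<otimes> i X \<otimes> \<iota> Z) = s X)"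
proof -
  \<comment> \<open>\<open>P\<close> is chosen such that V is its left dual: a bent strand V becomes
    \<open>P\<close> on the left of the target, while Z becomes its own left dual \<open>Q\<close>
    on the right.\<close>
  obtain P e d where P: "P \<in> Obj C" "is_left_dual C P V e d"
    using rigid V unfolding rigid_def by blast
  obtain Q e' d' where Q: "is_left_dual C Z Q e' d'"
    using rigid Z unfolding rigid_def by blast
  note bP = left_dual_boxes[of "[P]", simplified, OF P(2,1)]
  note sv = snake_rules[of "[P]", simplified, OF P(2,1)]
  note bQ = left_dual_boxes[of "[Z]", simplified, OF Q Z]
  note sz = snake_rules[of "[Z]", simplified, OF Q Z]
  note [simp] = V Z W P(1) bQ(1)
  note [reprs] = bP(2) bP(3) bQ(2) bQ(3)
  have sb: "is_box ([V, dual C X, X, Z], s X, [W])" if "X \<in> Obj C" for X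
    using s that by (auto simp: dinat_family_def is_box_def)
  define j where "j X = (\<iota> P \<otimes> s X \<otimes> \<iota> Q) \<cdot> (d \<otimes> \<iota> (dual C X) \<otimes> \<iota> X \<otimes> d')" for X
  have j: "repr (j X) [dual C X, X] [(0, [], d, [P, V]), (4, [], d', [Z, Q]), (1, [V, dual C X, X, Z], s X, [W])] [P, W, Q]"
    if [simp]: "X \<in> Obj C" for X
    unfolding j_def by (rule repr_cong) (rule reprs sb[OF that] repr_box | simp)+
  have "dinatural C (P \<odot> W \<odot> Q) j"
    unfolding dinatural_def
  proof (intro conjI ballI)
    show "P \<odot> W \<odot> Q \<in> Obj C" by (intro tens_obj) auto
    fix X assume [simp]: "X \<in> Obj C"
    show "j X \<in> Hom C (dual C X \<odot> X) (P \<odot> W \<odot> Q)"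
      using repr_hom[OF j[of X]] by simp
    fix Y f assume [simp]: "Y \<in> Obj C" and f: "f \<in> Hom C X Y"
    have fb: "is_box ([X], f, [Y])" "is_box ([dual C Y], dual_arr C f, [dual C X])"
      using f dual_arr_hom[OF f] by (auto simp: is_box_def)
    note [reprs] = sb fb(1) fb(2)
    have "s X \<cdot> (\<iota> V \<otimes> dual_arr C f \<otimes> \<iota> X \<otimes> \<iota> Z) = s Y \<cdot> (\<iota> V \<otimes> \<iota> (dual C Y) \<otimes> f \<otimes> \<iota> Z)"
      using s f by (auto simp: dinat_family_def)
    then have nat: "good ([V, dual C Y, X, Z],
      [(1, [dual C Y], dual_arr C f, [dual C X]), (0, [V, dual C X, X, Z], s X, [W])],
      [(2, [X], f, [Y]), (0, [V, dual C Y, Y, Z], s Y, [W])])"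
      by (rule goodI) (rule reprs repr_box | simp)+
    show "j X \<cdot> (dual_arr C f \<otimes> \<iota> X) = j Y \<cdot> (\<iota> (dual C Y) \<otimes> f)"
      unfolding j_def
      by (rule run_eq[OF _ _ _ good_Cons[OF nat good_Nil],
        where ms = "[SL 0, SR 1, Rw 0 2 1, SL 1, SR 0]"])
        (rule reprs repr_box | simp)+
  qed
  then have ex1: "\<exists>!g. g \<in> Hom C A (P \<odot> W \<odot> Q) \<and> (\<forall>X \<in> Obj C. g \<cdot> i X = j X)"
    using coend by (auto simp: is_aut_coend_def)
  then obtain g where g: "g \<in> Hom C A (P \<odot> W \<odot> Q)" "\<And>X. X \<in> Obj C \<Longrightarrow> g \<cdot> i X = j X" by blast
  have gb: "is_box ([A], g, [P, W, Q])" using g by (auto simp: is_box_def)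
  \<comment> \<open>The bent strands of the factorization \<open>g\<close> are straightened by the
    two evaluations.\<close>
  define a where "a = (e \<otimes> \<iota> W \<otimes> e') \<cdot> (\<iota> V \<otimes> g \<otimes> \<iota> Z)"
  have a: "repr a [V, A, Z] [(1, [A], g, [P, W, Q]), (0, [V, P], e, []), (1, [Q, Z], e', [])] [W]"
    unfolding a_def by (rule repr_cong) (rule reprs gb repr_box | simp)+
  show ?thesis
  proof (intro ex1I[of _ a] conjI ballI)
    show "a \<in> Hom C (V \<odot> A \<odot> Z) W" using repr_hom[OF a] by simp
    fix X assume X [simp]: "X \<in> Obj C"
    note [reprs] = sb i_box gb
    have g: "good ([dual C X, X], [(0, [dual C X, X], i X, [A]), (0, [A], g, [P, W, Q])],
      [(0, [], d, [P, V]), (4, [], d', [Z, Q]), (1, [V, dual C X, X, Z], s X, [W])])"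
      by (rule goodI[OF g(2)[OF X] _ j[OF X]]) (rule reprs repr_box | simp)+
    show "a \<cdot> (\<iota> V \<otimes> i X \<otimes> \<iota> Z) = s X"
      unfolding a_def
      by (rule run_eq[OF _ _ _ good_Cons[OF g good_Cons[OF sv(2) good_Cons[OF sz(1) good_Nil]]],
        where ms = "[Rw 0 0 1, SL 2, SR 0, SR 3, SR 2, SR 1, Rw 1 2 0, Rw 2 0 3]"])
        (rule reprs repr_box | simp)+
  next
    fix b assume b: "b \<in> Hom C (V \<odot> A \<odot> Z) W \<and> (\<forall>X \<in> Obj C. b \<cdot> (\<iota> V \<otimes> i X \<otimes> \<iota> Z) = s X)"
    then have bb: "is_box ([V, A, Z], b, [W])" by (auto simp: is_box_def)
    note [reprs] = bb i_box sb
    \<comment> \<open>Conversely, bending the strands of \<open>b\<close> gives a factorization of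
      \<open>j\<close>, which the universal property identifies with \<open>g\<close>.\<close>
    define g' where "g' = (\<iota> P \<otimes> b \<otimes> \<iota> Q) \<cdot> (d \<otimes> \<iota> A \<otimes> d')"
    have g': "repr g' [A] [(0, [], d, [P, V]), (3, [], d', [Z, Q]), (1, [V, A, Z], b, [W])] [P, W, Q]"
      unfolding g'_def by (rule repr_cong) (rule reprs repr_box | simp)+
    have "g' \<in> Hom C A (P \<odot> W \<odot> Q)" using repr_hom[OF g'] by simp
    moreover have "g' \<cdot> i X = j X" if [simp]: "X \<in> Obj C" for X
    proof -
      have "b \<cdot> (\<iota> V \<otimes> i X \<otimes> \<iota> Z) = s X" using b by simp
      then have a: "good ([V, dual C X, X, Z], [(1, [dual C X, X], i X, [A]), (0, [V, A, Z], b, [W])],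
        [(0, [V, dual C X, X, Z], s X, [W])])"
        by (rule goodI) (rule reprs repr_box | simp)+
      show ?thesis
        unfolding g'_def j_def
        by (rule run_eq[OF _ _ _ good_Cons[OF a good_Nil],
          where ms = "[SL 0, SR 1, Rw 0 2 1]"])
          (rule reprs repr_box | simp)+
    qed
    ultimately have "g' = g" using g ex1 by blast
    then have ga: "a = (e \<otimes> \<iota> W \<otimes> e') \<cdot> (\<iota> V \<otimes> g' \<otimes> \<iota> Z)" by (simp add: a_def)
    show "b = a"
      unfolding ga g'_def
      apply (rule sym)
        by (rule run_eq[OF _ _ _ good_Cons[OF sv(2) good_Cons[OF sz(1) good_Nil]],
          where ms = "[SL 2, SR 0, SR 3, SR 2, SR 1, Rw 0 2 0, Rw 1 0 2]"])
          (rule reprs repr_box | simp)+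
  qed
qed

end

section \<open>Invertibility of half-braidings from duals\<close>

context strict_monoidal_category
begin

text \<open>The inverse is the component at \<open>Y\<close> bent around by \<open>e\<close> and
  \<open>d\<close>. Naturality against \<open>e\<close> and \<open>d\<close>, the hexagon and the
  unit condition show that the components at X and Y cancel along an evaluation or a coevaluation; a
  zigzag identity does the rest. No braiding is involved, so the lemma serves for half-braidings as
  well as for the invertibility of \<Omega>.\<close>

lemma half_braiding_iso:
  assumes V: "V \<in> Obj C"
    and hom: "\<And>X. X \<in> Obj C \<Longrightarrow> c X \<in> Hom C (V \<odot> X) (X \<odot> V)"
    and nat: "\<And>X Y f. f \<in> Hom C X Y \<Longrightarrow> c Y \<cdot> (\<iota> V \<otimes> f) = (f \<otimes> \<iota> V) \<cdot> c X"
    and hex: "\<And>X Y. X \<in> Obj C \<Longrightarrow> Y \<in> Obj C \<Longrightarrow> c (X \<odot> Y) = (\<iota> X \<otimes> c Y) \<cdot> (c X \<otimes> \<iota> Y)"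
    and unit: "c \<I> = \<iota> V"
    and X: "X \<in> Obj C" and Y: "Y \<in> Obj C" and dual: "is_left_dual C Y X e d"
  shows "is_iso C (c X)"
proof -
  note b = left_dual_boxes[of "[Y]", simplified, OF dual Y]
  note s = snake_rules[of "[Y]", simplified, OF dual Y]
  have cb: "is_box ([V, X], c X, [X, V])" "is_box ([V, Y], c Y, [Y, V])"
    using hom V X Y by (auto simp: is_box_def)
  note [simp] = V X Y
  note [reprs] = b(2) b(3) cb(1) cb(2)
  have "e \<in> Hom C (X \<odot> Y) \<I>" "d \<in> Hom C \<I> (Y \<odot> X)"
    using dual by (auto simp: is_left_dual_def)
  from nat[OF this(1)] nat[OF this(2)]
  have eq: "\<iota> V \<cdot> (\<iota> V \<otimes> e) = (e \<otimes> \<iota> V) \<cdot> (\<iota> X \<otimes> c Y) \<cdot> (c X \<otimes> \<iota> Y)"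
    "((\<iota> Y \<otimes> c X) \<cdot> (c Y \<otimes> \<iota> X)) \<cdot> (\<iota> V \<otimes> d) = (d \<otimes> \<iota> V) \<cdot> \<iota> V"
    by (simp_all add: hex unit)
  have r1: "good ([V, X, Y], [(0, [V, X], c X, [X, V]), (1, [V, Y], c Y, [Y, V]), (0, [X, Y], e, [])],
    [(1, [X, Y], e, [])])"
    by (rule goodI[OF eq(1)[symmetric]]) (rule reprs repr_box | simp)+
  have r2: "good ([V], [(1, [], d, [Y, X]), (0, [V, Y], c Y, [Y, V]), (1, [V, X], c X, [X, V])],
    [(0, [], d, [Y, X])])"
    by (rule goodI[OF eq(2)]) (rule reprs repr_box | simp)+
  define k where "k = (e \<otimes> \<iota> V \<otimes> \<iota> X) \<cdot> (\<iota> X \<otimes> c Y \<otimes> \<iota> X) \<cdot> (\<iota> X \<otimes> \<iota> V \<otimes> d)"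
  have k: "repr k [X, V] [(2, [], d, [Y, X]), (1, [V, Y], c Y, [Y, V]), (0, [X, Y], e, [])] [V, X]"
    unfolding k_def by (rule repr_cong) (rule reprs repr_box | simp)+
  have "k \<cdot> c X = \<iota> (V \<odot> X)" unfolding k_def
    by (rule run_eq[OF _ _ _ good_Cons[OF r1 good_Cons[OF s(2) good_Nil]],
      where ms = "[SR 0, Rw 0 1 0, Rw 1 0 1]"])
      (rule reprs repr_box | simp)+
  moreover have "c X \<cdot> k = \<iota> (X \<odot> V)" unfolding k_def
    by (rule run_eq[OF _ _ _ good_Cons[OF r2 good_Cons[OF s(2) good_Nil]],
      where ms = "[SR 2, Rw 0 0 1, Rw 1 0 0]"])
      (rule reprs repr_box | simp)+
  ultimately show ?thesis
    using repr_hom[OF k] hom[OF X] by (auto simp: is_iso_def Hom_def intro!: bexI[of _ k])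
qed

end

section \<open>Inverse crossings\<close>

context braided_monoidal_category
begin

definition inv_braid :: "'o \<Rightarrow> 'o \<Rightarrow> 'a" where
  "inv_braid X Y = (SOME g. g \<in> Hom C (Y \<odot> X) (X \<odot> Y) \<and>
     g \<cdot> \<Phi> X Y = \<iota> (X \<odot> Y) \<and> \<Phi> X Y \<cdot> g = \<iota> (Y \<odot> X))"

lemma inv_braid:
  assumes "X \<in> Obj C" "Y \<in> Obj C"
  shows "inv_braid X Y \<in> Hom C (Y \<odot> X) (X \<odot> Y)" "inv_braid X Y \<cdot> \<Phi> X Y = \<iota> (X \<odot> Y)"
    "\<Phi> X Y \<cdot> inv_braid X Y = \<iota> (Y \<odot> X)"
proof -
  have "\<exists>g. g \<in> Hom C (Y \<odot> X) (X \<odot> Y) \<and> g \<cdot> \<Phi> X Y = \<iota> (X \<odot> Y) \<and> \<Phi> X Y \<cdot> g = \<iota> (Y \<odot> X)"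
    using braid_iso[OF assms] HomD[OF braid_hom[OF assms]] by (auto simp: is_iso_def)
  from someI_ex[OF this] show "inv_braid X Y \<in> Hom C (Y \<odot> X) (X \<odot> Y)" "inv_braid X Y \<cdot> \<Phi> X Y = \<iota> (X \<odot> Y)"
    "\<Phi> X Y \<cdot> inv_braid X Y = \<iota> (Y \<odot> X)" by (auto simp: inv_braid_def)
qed

abbreviation uncrossing :: "'o \<Rightarrow> 'o \<Rightarrow> ('o, 'a) box" where
  "uncrossing X Y \<equiv> ([Y, X], inv_braid X Y, [X, Y])"

lemma uncrossing_box: "X \<in> Obj C \<Longrightarrow> Y \<in> Obj C \<Longrightarrow> is_box (uncrossing X Y)"
  using inv_braid by (auto simp: is_box_def)

lemma repr_unbraid: "X \<in> Obj C \<Longrightarrow> Y \<in> Obj C \<Longrightarrow> repr (inv_braid X Y) [Y, X] [(0, uncrossing X Y)] [X, Y]"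
  by (intro repr_box uncrossing_box)

lemmas [reprs] = repr_unbraid

lemma uncross_rule:
  assumes XY [simp]: "X \<in> Obj C" "Y \<in> Obj C"
  shows "good ([X, Y], [(0, crossing X Y), (0, uncrossing X Y)], [])"
    "good ([Y, X], [(0, uncrossing X Y), (0, crossing X Y)], [])"
  subgoal by (rule goodI[OF inv_braid(2)[OF XY]]) (rule reprs repr_box | simp)+
  subgoal by (rule goodI[OF inv_braid(3)[OF XY]]) (rule reprs repr_box | simp)+
  done

end

subsection \<open>Half-braidings and morphisms out of the coend\<close>

locale braided_coend = braided_monoidal_category C \<Phi> + coend C A i
  for C :: "('o, 'a, 'z) moncat_scheme" (structure) and \<Phi> and A i
begin

abbreviation ev_box :: "'o \<Rightarrow> ('o, 'a) box" where "ev_box X \<equiv> ([dual C X, X], ev C X, [])"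
abbreviation coev_box :: "'o \<Rightarrow> ('o, 'a) box" where "coev_box X \<equiv> ([], coev C X, [X, dual C X])"

lemma dual_boxes:
  assumes "X \<in> Obj C"
  shows "is_box (ev_box X)" "is_box (coev_box X)"
  using left_dual_boxes[of "[X]", simplified, OF is_dual] assms by auto

lemma snake:
  assumes "X \<in> Obj C"
  shows "good ([X], [(0, coev_box X), (1, ev_box X)], [])"
    "good ([dual C X], [(1, coev_box X), (0, ev_box X)], [])"
  using snake_rules[of "[X]", simplified, OF is_dual] assms by auto

lemma dual_arr_setup:
  assumes f: "f \<in> Hom C X Y"
  shows "X \<in> Obj C" "Y \<in> Obj C" "is_box ([X], f, [Y])" "is_box ([dual C Y], dual_arr C f, [dual C X])"
  using f dual_arr_hom[OF f] by (auto simp: is_box_def dest: HomD)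

lemma dual_arr_ev_eq:
  assumes f: "f \<in> Hom C X Y"
  shows "ev C X \<cdot> (dual_arr C f \<otimes> \<iota> X) = ev C Y \<cdot> (\<iota> (dual C Y) \<otimes> f)"
proof -
  note d = dual_arr_setup[OF f]
  note [simp] = d(1,2) and [reprs] = d(3) d(4) dual_boxes[OF d(1)]
    dual_boxes[OF d(2)]
  note sX = snake[OF d(1)]
  show ?thesis
    by (rule run_eq[OF _ _ _ good_Cons[OF dual_arr_rule[OF f] good_Cons[OF sX(1) good_Nil]],
      where ms = "[Rw 0 0 0, SR 2, SR 1, Rw 1 0 1]"])
      (rule reprs repr_box | simp)+
qed

lemma dual_arr_ev:
  assumes f: "f \<in> Hom C X Y"
  shows "good ([dual C Y, X], [(0, [dual C Y], dual_arr C f, [dual C X]), (0, ev_box X)],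
    [(1, [X], f, [Y]), (0, ev_box Y)])"
proof -
  note d = dual_arr_setup[OF f]
  note [simp] = d(1,2) and [reprs] = d(3) d(4) dual_boxes[OF d(1)]
    dual_boxes[OF d(2)]
  show ?thesis by (rule goodI[OF dual_arr_ev_eq[OF f]]) (rule reprs repr_box | simp)+
qed

lemma dual_arr_coev:
  assumes f: "f \<in> Hom C X Y"
  shows "good ([], [(0, coev_box X), (0, [X], f, [Y])],
    [(0, coev_box Y), (1, [dual C Y], dual_arr C f, [dual C X])])"
proof -
  note d = dual_arr_setup[OF f]
  note [simp] = d(1,2) and [reprs] = d(3) d(4) dual_boxes[OF d(1)]
    dual_boxes[OF d(2)]
  note sY = snake[OF d(2)]
  have "(f \<otimes> \<iota> (dual C X)) \<cdot> coev C X = (\<iota> Y \<otimes> dual_arr C f) \<cdot> coev C Y"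
    by (rule run_eq[OF _ _ _ good_Cons[OF sY(1) good_Cons[OF dual_arr_rule[OF f] good_Nil]],
      where ms = "[Bw 0 2 0, SL 1, SL 0, Bw 1 1 1]"])
      (rule reprs repr_box | simp)+
  then show ?thesis by (rule goodI) (rule reprs repr_box | simp)+
qed

text \<open>Source \<open>V \<otimes> U\<close> and target \<open>X \<otimes> W\<close> are
  independent. Dinaturality is proved through morphisms with f on one side only, where U and X
  differ, and arrows of the center compare two objects V and W.\<close>

definition transpose :: "'o \<Rightarrow> 'o \<Rightarrow> 'o \<Rightarrow> 'o \<Rightarrow> 'a \<Rightarrow> 'a" where
  "transpose U V W X c = (ev C X \<otimes> \<iota> W) \<cdot> (\<iota> (dual C X) \<otimes> c) \<cdot> (\<Phi> V (dual C X) \<otimes> \<iota> U)"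

lemma transpose_repr:
  assumes "is_box ([V, U], c, [X, W])"
  shows "repr (transpose U V W X c) [V, dual C X, U]
    [(0, crossing V (dual C X)), (1, [V, U], c, [X, W]), (0, ev_box X)] [W]"
proof -
  have [simp]: "V \<in> Obj C" "U \<in> Obj C" "X \<in> Obj C" "W \<in> Obj C" using assms by (auto simp: is_box_def)
  show ?thesis unfolding transpose_def
    by (rule repr_cong) (rule reprs assms dual_boxes(1) repr_box | simp)+
qed

text \<open>The transposition is undone by a coevaluation of X followed by an inverse crossing.
  Inserting a zigzag and a pair of opposite crossings in front of \<open>c\<close> exposes the
  transposed morphism, in which \<open>c\<close> is exchanged for \<open>c'\<close>.\<close>

lemma transpose_inj:
  assumes c: "is_box ([V, U], c, [X, W])" and c': "is_box ([V, U], c', [X, W])"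
    and eq: "transpose U V W X c = transpose U V W X c'"
  shows "c = c'"
proof -
  have V [simp]: "V \<in> Obj C" and [simp]: "U \<in> Obj C" and X [simp]: "X \<in> Obj C" "W \<in> Obj C"
    using c by (auto simp: is_box_def)
  note K = dual_obj[OF X(1)] and s = snake[OF X(1)]
  note [reprs] = c c' dual_boxes[OF X(1)]
  have eq: "good ([V, dual C X, U],
     [(0, crossing V (dual C X)), (1, [V, U], c, [X, W]), (0, ev_box X)],
     [(0, crossing V (dual C X)), (1, [V, U], c', [X, W]), (0, ev_box X)])"
    by (rule goodI[OF eq transpose_repr[OF c] transpose_repr[OF c']]) auto
  show ?thesis
    by (rule run_eq[OF _ _ _ good_Cons[OF s(1) good_Cons[OF uncross_rule(2)[OF V K] good_Cons[OF eq
        good_Nil]]],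
      where ms = "[Bw 0 1 0, SL 0, Bw 1 1 1, Rw 2 2 1, Rw 1 1 1, SR 0, Rw 0 1 0]"])
      (rule reprs repr_box | simp)+
qed

lemma transpose_surj:
  assumes t: "is_box ([V, dual C X, U], t, [W])" and X: "X \<in> Obj C"
  shows "\<exists>c. is_box ([V, U], c, [X, W]) \<and> transpose U V W X c = t"
proof -
  have V [simp]: "V \<in> Obj C" and [simp]: "U \<in> Obj C" "W \<in> Obj C" "X \<in> Obj C"
    using t X by (auto simp: is_box_def)
  note K = dual_obj[OF X(1)] and s = snake[OF X(1)]
  note [reprs] = t dual_boxes[OF X(1)]
  define c where "c = (\<iota> X \<otimes> t) \<cdot> (\<iota> X \<otimes> inv_braid V (dual C X) \<otimes> \<iota> U) \<cdot> (coev C X \<otimes> \<iota> V \<otimes> \<iota> U)"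
  have "repr c [V, U] [(0, coev_box X), (1, uncrossing V (dual C X)), (1, [V, dual C X, U], t, [W])] [X, W]"
    unfolding c_def by (rule repr_cong) (rule reprs repr_box | simp)+
  moreover have "transpose U V W X c = t"
    unfolding transpose_def c_def
    by (rule run_eq[OF _ _ _ good_Cons[OF s(2) good_Cons[OF uncross_rule(1)[OF V K] good_Nil]],
      where ms = "[SL 3, SL 2, Rw 0 1 0, Rw 1 0 0]"])
      (rule reprs repr_box | simp)+
  ultimately show ?thesis using repr_is_box by blast
qed

text \<open>Together with \<open>transpose_pre\<close> this turns naturality of a family into
  dinaturality of the transposed one. Here the dual of f has to be moved across V, by naturality of
  the braiding.\<close>

lemma transpose_post:
  assumes c: "is_box ([V, X], c, [X, W])" and f: "f \<in> Hom C X Y"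
  shows "transpose X V W Y ((f \<otimes> \<iota> W) \<cdot> c) =
    transpose X V W X c \<cdot> (\<iota> V \<otimes> dual_arr C f \<otimes> \<iota> X)"
proof -
  have V [simp]: "V \<in> Obj C" and X [simp]: "X \<in> Obj C" and Y [simp]: "Y \<in> Obj C" and [simp]: "W \<in> Obj C"
    using c f by (auto simp: is_box_def dest: HomD)
  have fb: "is_box ([X], f, [Y])" and f': "is_box ([dual C Y], dual_arr C f, [dual C X])"
    using f dual_arr_hom[OF f] by (auto simp: is_box_def)
  note [reprs] = c fb f' dual_boxes[OF X(1)]
    dual_boxes[OF Y(1)]
  note fd = dual_arr_ev[OF f]
  show ?thesis unfolding transpose_def
    by (rule run_eq[OF _ _ _ good_Cons[OF fd good_Cons[OF natural_right[OF f' V] good_Nil]],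
      where ms = "[Bw 0 2 0, SL 1, Bw 1 0 0]"])
      (rule reprs repr_box | simp)+
qed

lemma transpose_pre:
  assumes c: "is_box ([V, Y], c, [Y, W])" and f: "f \<in> Hom C X Y"
  shows "transpose X V W Y (c \<cdot> (\<iota> V \<otimes> f)) =
    transpose Y V W Y c \<cdot> (\<iota> V \<otimes> \<iota> (dual C Y) \<otimes> f)"
proof -
  have V [simp]: "V \<in> Obj C" and X [simp]: "X \<in> Obj C" and Y [simp]: "Y \<in> Obj C" and [simp]: "W \<in> Obj C"
    using c f by (auto simp: is_box_def dest: HomD)
  have fb: "is_box ([X], f, [Y])"
    using f by (auto simp: is_box_def)
  note [reprs] = c fb dual_boxes[OF Y(1)]
  show ?thesis unfolding transpose_def
    by (rule run_eq[OF _ _ _ good_Nil,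
      where ms = "[SR 0]"])
      (rule reprs repr_box | simp)+
qed

text \<open>The order of the crossings is the one in which the multiplication of the coend brings \<open>Y\<^sup>*\<close> past \<open>X\<^sup>* \<otimes> X\<close>.\<close>

definition transpose2 :: "'o \<Rightarrow> 'o \<Rightarrow> 'o \<Rightarrow> 'o \<Rightarrow> 'a \<Rightarrow> 'a" where
  "transpose2 V W X Y c = (ev C Y \<otimes> \<iota> W) \<cdot> (\<iota> (dual C Y) \<otimes> ev C X \<otimes> \<iota> Y \<otimes> \<iota> W) \<cdot>
    (\<iota> (dual C Y) \<otimes> \<iota> (dual C X) \<otimes> c) \<cdot> (\<Phi> V (dual C Y \<odot> dual C X) \<otimes> \<iota> X \<otimes> \<iota> Y) \<cdot>
    (\<iota> V \<otimes> \<Phi> (dual C X \<odot> X) (dual C Y) \<otimes> \<iota> Y)"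

lemma transpose2_repr:
  assumes "is_box ([V, X, Y], c, [X, Y, W])"
  shows "repr (transpose2 V W X Y c) [V, dual C X, X, dual C Y, Y]
    [(2, crossing X (dual C Y)), (1, crossing (dual C X) (dual C Y)), (0, crossing V (dual C Y)),
     (1, crossing V (dual C X)), (2, [V, X, Y], c, [X, Y, W]), (1, ev_box X), (0, ev_box Y)] [W]"
proof -
  have [simp]: "V \<in> Obj C" "X \<in> Obj C" "Y \<in> Obj C" "W \<in> Obj C" using assms by (auto simp: is_box_def)
  show ?thesis unfolding transpose2_def
    by (rule repr_cong) (rule reprs assms dual_boxes(1)
      repr_box | simp)+
qed

text \<open>As for one strand, with four crossings to be cancelled by their inverses. This
  injectivity is what recovers the hexagon from the associativity of an action.\<close>

lemma transpose2_inj: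
  assumes c: "is_box ([V, X, Y], c, [X, Y, W])" and c': "is_box ([V, X, Y], c', [X, Y, W])"
    and eq: "transpose2 V W X Y c = transpose2 V W X Y c'"
  shows "c = c'"
proof -
  have V [simp]: "V \<in> Obj C" and X [simp]: "X \<in> Obj C" and Y [simp]: "Y \<in> Obj C" and [simp]: "W \<in> Obj C"
    using c by (auto simp: is_box_def)
  note KX = dual_obj[OF X] and KY = dual_obj[OF Y] and sX = snake[OF X] and sY = snake[OF Y]
  note [reprs] = c c' dual_boxes[OF X] dual_boxes[OF Y]
  note eq = goodI[OF eq transpose2_repr[OF c] transpose2_repr[OF c'] refl refl refl refl refl]
  show ?thesis
    by (rule run_eq[OF _ _ _ good_Cons[OF sX(1) good_Cons[OF sY(1) good_Cons[OF uncross_rule(2)[OF V KX]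
        good_Cons[OF uncross_rule(2)[OF V KY] good_Cons[OF uncross_rule(2)[OF KX KY] good_Cons[OF
        uncross_rule(2)[OF X KY] good_Cons[OF eq good_Nil]]]]]]],
      where ms = "[Bw 0 1 0, SL 0, Bw 1 3 1, SL 2, SL 1, Bw 2 2 3, Bw 3 3 2, Bw 4 4 3, Bw 5 5 4, Rw 6 6
        2, Rw 5 5 4, Rw 4 4 3, Rw 3 3 2, Rw 2 2 3, SR 1, SR 2, Rw 1 3 1, SR 0, Rw 0 1 0]"])
      (rule reprs repr_box | simp)+
qed

text \<open>On the left the dual of Y crosses V only after X has been evaluated. Pulling it back
  over the evaluation, the box \<open>c\<close> and the crossing of V with the dual of X makes it
  pass both strands belonging to X: this is the origin of the braiding in the multiplication of the
  coend.\<close>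

lemma transpose_mult:
  assumes cX: "is_box ([V, X], c, [X, V])" and cY: "is_box ([V, Y], c', [Y, V])"
  shows "transpose Y V V Y c' \<cdot> (transpose X V V X c \<otimes> \<iota> (dual C Y) \<otimes> \<iota> Y) =
    transpose2 V V X Y ((\<iota> X \<otimes> c') \<cdot> (c \<otimes> \<iota> Y))"
proof -
  have V [simp]: "V \<in> Obj C" and X [simp]: "X \<in> Obj C" and Y [simp]: "Y \<in> Obj C"
    using cX cY by (auto simp: is_box_def)
  note KX = dual_obj[OF X] and KY = dual_obj[OF Y] and evX = dual_boxes(1)[OF X]
  note [reprs] = cX cY dual_boxes[OF X] dual_boxes[OF Y]
  show ?thesis unfolding transpose_def transpose2_def
    by (rule run_eq[OF _ _ _ good_Cons[OF natural_left[OF evX KY] good_Cons[OF natural_left[OF cX KY]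
        good_Cons[OF natural_left[OF crossing_box[OF V KX] KY] good_Nil]]],
      where ms = "[SR 2, SR 3, Rw 0 4 0, SL 3, SL 4, SL 5, Rw 1 1 1, SL 3, SR 0, Rw 2 1 0, SR 5]"])
      (rule reprs repr_box | simp)+
qed

end

section \<open>Uniqueness on the coend, and the correspondence of families with actions\<close>

context braided_coend
begin

abbreviation i_bx :: "'o \<Rightarrow> ('o, 'a) box" where "i_bx X \<equiv> ([dual C X, X], i X, [A])"

lemma i_dinat: "f \<in> Hom C X Y \<Longrightarrow> i X \<cdot> (dual_arr C f \<otimes> \<iota> X) = i Y \<cdot> (\<iota> (dual C Y) \<otimes> f)"
  using coend HomD(4,5)[of f X Y] by (auto simp: is_aut_coend_def dinatural_def)

lemma i_dinat_rule:
  assumes f: "f \<in> Hom C X Y"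
  shows "good ([dual C Y, X], [(0, [dual C Y], dual_arr C f, [dual C X]), (0, i_bx X)],
    [(1, [X], f, [Y]), (0, i_bx Y)])"
proof -
  note s = dual_arr_setup[OF f]
  note [simp] = s(1,2) and [reprs] = s(3,4) i_box[OF s(1)] i_box[OF s(2)]
  show ?thesis by (rule goodI[OF i_dinat[OF f]]) (rule reprs repr_box | simp)+
qed

text \<open>The family obtained from \<open>a\<close> is dinatural because \<open>i\<close> is, so
  \<open>a\<close> and \<open>b\<close> are two factorizations of one dinatural family.\<close>

lemma coend_whiskered_unique:
  assumes [simp]: "V \<in> Obj C" "Z \<in> Obj C" "W \<in> Obj C"
    and a: "a \<in> Hom C (V \<odot> A \<odot> Z) W" and b: "b \<in> Hom C (V \<odot> A \<odot> Z) W"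
    and eq: "\<And>X. X \<in> Obj C \<Longrightarrow> a \<cdot> (\<iota> V \<otimes> i X \<otimes> \<iota> Z) = b \<cdot> (\<iota> V \<otimes> i X \<otimes> \<iota> Z)"
  shows "a = b"
proof -
  have ab: "is_box ([V, A, Z], a, [W])" using a by (auto simp: is_box_def)
  have "dinat_family V Z W (\<lambda>X. a \<cdot> (\<iota> V \<otimes> i X \<otimes> \<iota> Z))"
    unfolding dinat_family_def
  proof (intro conjI ballI)
    fix X assume X [simp]: "X \<in> Obj C"
    have "repr (a \<cdot> (\<iota> V \<otimes> i X \<otimes> \<iota> Z)) [V, dual C X, X, Z] [(1, i_bx X), (0, [V, A, Z], a, [W])] [W]"
      by (rule repr_cong) (rule reprs ab i_box repr_box | simp)+
    from repr_hom[OF this] show "a \<cdot> (\<iota> V \<otimes> i X \<otimes> \<iota> Z) \<in> Hom C (V \<odot> dual C X \<odot> X \<odot> Z) W" by simp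
    fix Y f assume f: "f \<in> Hom C X Y"
    note s = dual_arr_setup[OF f]
    note [simp] = s(1,2) and [reprs] = s(3,4) ab i_box
    note i = i_dinat_rule[OF f]
    show "(a \<cdot> (\<iota> V \<otimes> i X \<otimes> \<iota> Z)) \<cdot> (\<iota> V \<otimes> dual_arr C f \<otimes> \<iota> X \<otimes> \<iota> Z) =
      (a \<cdot> (\<iota> V \<otimes> i Y \<otimes> \<iota> Z)) \<cdot> (\<iota> V \<otimes> \<iota> (dual C Y) \<otimes> f \<otimes> \<iota> Z)"
      by (rule run_eq[OF _ _ _ good_Cons[OF i good_Nil],
        where ms = "[Rw 0 0 1]"])
        (rule reprs repr_box | simp)+
  qed
  from coend_whiskered[OF assms(1-3) this] obtain g where
    "\<forall>y. y \<in> Hom C (V \<odot> A \<odot> Z) W \<and> (\<forall>X \<in> Obj C. y \<cdot> (\<iota> V \<otimes> i X \<otimes> \<iota> Z) = a \<cdot> (\<iota> V \<otimes> i X \<otimes> \<iota> Z)) \<longrightarrow> y = g"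
    by (elim ex1E) (rule that)
  then have "a = g" "b = g" using a b eq by auto
  then show ?thesis by simp
qed

lemma coend_left:
  assumes [simp]: "V \<in> Obj C" "W \<in> Obj C"
    and s: "\<And>X. X \<in> Obj C \<Longrightarrow> s X \<in> Hom C (V \<odot> dual C X \<odot> X) W"
    and dinat: "\<And>X Y f. f \<in> Hom C X Y \<Longrightarrow>
      s X \<cdot> (\<iota> V \<otimes> dual_arr C f \<otimes> \<iota> X) = s Y \<cdot> (\<iota> V \<otimes> \<iota> (dual C Y) \<otimes> f)"
  shows "\<exists>a. a \<in> Hom C (V \<odot> A) W \<and> (\<forall>X \<in> Obj C. a \<cdot> (\<iota> V \<otimes> i X) = s X)"
proof -
  have "dinat_family V \<I> W s"
    unfolding dinat_family_def using s dinat
    by (auto simp: unit_obj unit_obj_right unit_arr_right HomD(1)[OF id_hom] dest: HomD)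
  from coend_whiskered[OF assms(1) unit_obj assms(2) this] show ?thesis
    by (auto simp: unit_obj_right unit_arr_right HomD(1)[OF i_hom])
qed

lemma coend_right:
  assumes [simp]: "Z \<in> Obj C" "W \<in> Obj C"
    and s: "\<And>X. X \<in> Obj C \<Longrightarrow> s X \<in> Hom C (dual C X \<odot> X \<odot> Z) W"
    and dinat: "\<And>X Y f. f \<in> Hom C X Y \<Longrightarrow>
      s X \<cdot> (dual_arr C f \<otimes> \<iota> X \<otimes> \<iota> Z) = s Y \<cdot> (\<iota> (dual C Y) \<otimes> f \<otimes> \<iota> Z)"
  shows "\<exists>a. a \<in> Hom C (A \<odot> Z) W \<and> (\<forall>X \<in> Obj C. a \<cdot> (i X \<otimes> \<iota> Z) = s X)"
proof -
  have arr: "i X \<otimes> \<iota> Z \<in> Arr C" if "X \<in> Obj C" for X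
    using HomD(1)[OF tens_hom[OF i_hom[OF that] id_hom[OF assms(1)]]] .
  have "dinat_family \<I> Z W s"
    unfolding dinat_family_def
  proof (intro conjI ballI)
    fix X assume [simp]: "X \<in> Obj C"
    show "s X \<in> Hom C (\<I> \<odot> dual C X \<odot> X \<odot> Z) W" using s[of X] by (simp add: unit_obj_left tens_obj)
    fix Y f assume f: "f \<in> Hom C X Y"
    then have [simp]: "Y \<in> Obj C" by (auto dest: HomD)
    have "dual_arr C f \<otimes> \<iota> X \<otimes> \<iota> Z \<in> Arr C" "\<iota> (dual C Y) \<otimes> f \<otimes> \<iota> Z \<in> Arr C"
      using tens_hom[OF dual_arr_hom[OF f] tens_hom[OF id_hom id_hom], of X Z, THEN HomD(1)]
        tens_hom[OF id_hom tens_hom[OF f id_hom], of "dual C Y" Z, THEN HomD(1)] by simp_all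
    then show "s X \<cdot> (\<iota> \<I> \<otimes> dual_arr C f \<otimes> \<iota> X \<otimes> \<iota> Z) = s Y \<cdot> (\<iota> \<I> \<otimes> \<iota> (dual C Y) \<otimes> f \<otimes> \<iota> Z)"
      using dinat[OF f] by (simp add: unit_arr_left)
  qed
  from coend_whiskered[OF unit_obj assms(1,2) this] arr show ?thesis
    by (auto simp: unit_obj_left tens_obj unit_arr_left)
qed

lemma coend_left_unique:
  assumes [simp]: "V \<in> Obj C" "W \<in> Obj C"
    and "a \<in> Hom C (V \<odot> A) W" "b \<in> Hom C (V \<odot> A) W"
    and "\<And>X. X \<in> Obj C \<Longrightarrow> a \<cdot> (\<iota> V \<otimes> i X) = b \<cdot> (\<iota> V \<otimes> i X)"
  shows "a = b"
  by (rule coend_whiskered_unique[of V \<I> W])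
    (use assms in \<open>auto simp: unit_obj unit_obj_right unit_arr_right HomD(1)[OF i_hom]\<close>)

lemma coend_right_unique:
  assumes [simp]: "Z \<in> Obj C" "W \<in> Obj C"
    and a: "a \<in> Hom C (A \<odot> Z) W" "b \<in> Hom C (A \<odot> Z) W"
    and eq: "\<And>X. X \<in> Obj C \<Longrightarrow> a \<cdot> (i X \<otimes> \<iota> Z) = b \<cdot> (i X \<otimes> \<iota> Z)"
  shows "a = b"
proof (rule coend_whiskered_unique[of \<I> Z W])
  fix X assume "X \<in> Obj C"
  then show "a \<cdot> (\<iota> \<I> \<otimes> i X \<otimes> \<iota> Z) = b \<cdot> (\<iota> \<I> \<otimes> i X \<otimes> \<iota> Z)"
    using eq[of X] HomD(1)[OF tens_hom[OF i_hom id_hom], of X Z] by (simp add: unit_arr_left)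
qed (use a in \<open>auto simp: unit_obj unit_obj_left tens_obj\<close>)

lemma coend_unique:
  assumes "W \<in> Obj C" "a \<in> Hom C A W" "b \<in> Hom C A W"
    and "\<And>X. X \<in> Obj C \<Longrightarrow> a \<cdot> i X = b \<cdot> i X"
  shows "a = b"
  by (rule coend_left_unique[of \<I> W])
    (use assms in \<open>auto simp: unit_obj unit_obj_left unit_arr_left HomD(1)[OF i_hom]\<close>)

text \<open>The two copies of A are tested one after the other: on \<open>i X\<close> with A as a
  strand on the right, then on \<open>i Y\<close> with the product of V, the dual of X and X as the
  object on the left.\<close>

lemma coend_unique2:
  assumes [simp]: "V \<in> Obj C" "W \<in> Obj C"
    and a: "a \<in> Hom C (V \<odot> A \<odot> A) W" and b: "b \<in> Hom C (V \<odot> A \<odot> A) W"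
    and eq: "\<And>X Y. X \<in> Obj C \<Longrightarrow> Y \<in> Obj C \<Longrightarrow> a \<cdot> (\<iota> V \<otimes> i X \<otimes> i Y) = b \<cdot> (\<iota> V \<otimes> i X \<otimes> i Y)"
  shows "a = b"
proof (rule coend_whiskered_unique[of V A W])
  fix X assume X [simp]: "X \<in> Obj C"
  have split: "c \<cdot> (\<iota> V \<otimes> i X \<otimes> i Y) = (c \<cdot> (\<iota> V \<otimes> i X \<otimes> \<iota> A)) \<cdot> (\<iota> (V \<odot> dual C X \<odot> X) \<otimes> i Y)"
    and hom: "c \<cdot> (\<iota> V \<otimes> i X \<otimes> \<iota> A) \<in> Hom C ((V \<odot> dual C X \<odot> X) \<odot> A) W"
    if c: "c \<in> Hom C (V \<odot> A \<odot> A) W" and [simp]: "Y \<in> Obj C" for c Y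
  proof -
    have cb: "is_box ([V, A, A], c, [W])" using c by (auto simp: is_box_def)
    have id3: "repr (\<iota> (V \<odot> dual C X \<odot> X)) [V, dual C X, X] [] [V, dual C X, X]"
      by (rule repr_id) auto
    note r = id3 reprs cb i_box
    show "c \<cdot> (\<iota> V \<otimes> i X \<otimes> i Y) = (c \<cdot> (\<iota> V \<otimes> i X \<otimes> \<iota> A)) \<cdot> (\<iota> (V \<odot> dual C X \<odot> X) \<otimes> i Y)"
      by (rule run_eq[OF _ _ _ good_Nil, where ms = "[SR 0]"]) (rule r repr_box | simp)+
    have "repr (c \<cdot> (\<iota> V \<otimes> i X \<otimes> \<iota> A)) [V, dual C X, X, A] [(1, i_bx X), (0, [V, A, A], c, [W])] [W]"
      by (rule repr_cong) (rule r repr_box | simp)+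
    from repr_hom[OF this] show "c \<cdot> (\<iota> V \<otimes> i X \<otimes> \<iota> A) \<in> Hom C ((V \<odot> dual C X \<odot> X) \<odot> A) W"
      by (simp add: assoc_obj tens_obj)
  qed
  show "a \<cdot> (\<iota> V \<otimes> i X \<otimes> \<iota> A) = b \<cdot> (\<iota> V \<otimes> i X \<otimes> \<iota> A)"
    by (rule coend_left_unique[of "V \<odot> dual C X \<odot> X" W])
      (use hom[OF a unit_obj] hom[OF b unit_obj] eq split a b in \<open>auto intro!: tens_obj simp flip: split\<close>)
qed (use a b in auto)

text \<open>A relation rather than a function, since existence and uniqueness are needed in both
  directions. It leaves the family \<open>c\<close> free outside \<open>Obj C\<close>, which is why
  extensionality has to be restored when objects of the center are formed.\<close>

definition corresponds :: "'o \<Rightarrow> 'a \<Rightarrow> ('o \<Rightarrow> 'a) \<Rightarrow> bool" where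
  "corresponds V a c \<longleftrightarrow> a \<in> Hom C (V \<odot> A) V \<and>
    (\<forall>X \<in> Obj C. c X \<in> Hom C (V \<odot> X) (X \<odot> V) \<and> a \<cdot> (\<iota> V \<otimes> i X) = transpose X V V X (c X))"

lemma correspondsD:
  assumes "corresponds V a c"
  shows "a \<in> Hom C (V \<odot> A) V" "V \<in> Obj C" "is_box ([V, A], a, [V])"
    and "X \<in> Obj C \<Longrightarrow> is_box ([V, X], c X, [X, V])"
    and "X \<in> Obj C \<Longrightarrow> a \<cdot> (\<iota> V \<otimes> i X) = transpose X V V X (c X)"
    and "X \<in> Obj C \<Longrightarrow> good ([V, dual C X, X], [(1, i_bx X), (0, [V, A], a, [V])],
      [(0, crossing V (dual C X)), (1, [V, X], c X, [X, V]), (0, ev_box X)])"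
proof -
  show V [simp]: "V \<in> Obj C" and a: "a \<in> Hom C (V \<odot> A) V"
    using assms by (auto simp: corresponds_def dest: HomD)
  then show ab: "is_box ([V, A], a, [V])" by (simp add: is_box_def)
  show cb: "is_box ([V, X], c X, [X, V])" if "X \<in> Obj C"
    using assms that by (auto simp: corresponds_def is_box_def)
  show eq: "a \<cdot> (\<iota> V \<otimes> i X) = transpose X V V X (c X)" if "X \<in> Obj C"
    using assms that by (auto simp: corresponds_def)
  show "good ([V, dual C X, X], [(1, i_bx X), (0, [V, A], a, [V])],
      [(0, crossing V (dual C X)), (1, [V, X], c X, [X, V]), (0, ev_box X)])" if X [simp]: "X \<in> Obj C"
    by (rule goodI[OF eq[OF X] _ transpose_repr[OF cb[OF X]]])
      (rule reprs ab i_box repr_box | simp)+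
qed

lemma corresponds_exists:
  assumes V [simp]: "V \<in> Obj C"
    and c: "\<And>X. X \<in> Obj C \<Longrightarrow> c X \<in> Hom C (V \<odot> X) (X \<odot> V)"
    and nat: "\<And>X Y f. f \<in> Hom C X Y \<Longrightarrow> c Y \<cdot> (\<iota> V \<otimes> f) = (f \<otimes> \<iota> V) \<cdot> c X"
  shows "\<exists>a. corresponds V a c"
proof -
  have cb: "is_box ([V, X], c X, [X, V])" if "X \<in> Obj C" for X using c that by (auto simp: is_box_def)
  have "\<exists>a. a \<in> Hom C (V \<odot> A) V \<and> (\<forall>X \<in> Obj C. a \<cdot> (\<iota> V \<otimes> i X) = transpose X V V X (c X))"
  proof (rule coend_left[OF V V])
    fix X assume [simp]: "X \<in> Obj C"
    show "transpose X V V X (c X) \<in> Hom C (V \<odot> dual C X \<odot> X) V"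
      using repr_hom[OF transpose_repr[OF cb]] by simp
  next
    fix X Y f assume f: "f \<in> Hom C X Y"
    note [simp] = dual_arr_setup(1,2)[OF f]
    show "transpose X V V X (c X) \<cdot> (\<iota> V \<otimes> dual_arr C f \<otimes> \<iota> X) =
      transpose Y V V Y (c Y) \<cdot> (\<iota> V \<otimes> \<iota> (dual C Y) \<otimes> f)"
      using transpose_post[OF cb f] transpose_pre[OF cb f] nat[OF f] by simp
  qed
  then show ?thesis using c by (auto simp: corresponds_def)
qed

text \<open>The components are found separately, by surjectivity of the transposition; that they fit
  together is the content of \<open>corresponds_natural\<close>.\<close>

lemma corresponds_exists':
  assumes a: "a \<in> Hom C (V \<odot> A) V" and V [simp]: "V \<in> Obj C"
  shows "\<exists>c. corresponds V a c"
proof -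
  have ab: "is_box ([V, A], a, [V])" using a by (simp add: is_box_def)
  have "\<exists>c. is_box ([V, X], c, [X, V]) \<and> transpose X V V X c = a \<cdot> (\<iota> V \<otimes> i X)" if [simp]: "X \<in> Obj C" for X
  proof -
    have "repr (a \<cdot> (\<iota> V \<otimes> i X)) [V, dual C X, X] [(1, i_bx X), (0, [V, A], a, [V])] [V]"
      by (rule repr_cong) (rule reprs ab i_box repr_box | simp)+
    from transpose_surj[OF repr_is_box[OF this]] show ?thesis by simp
  qed
  then obtain c where "\<And>X. X \<in> Obj C \<Longrightarrow> is_box ([V, X], c X, [X, V]) \<and>
    transpose X V V X (c X) = a \<cdot> (\<iota> V \<otimes> i X)" by metis
  then have "corresponds V a c" using a by (auto simp: corresponds_def is_box_def)
  then show ?thesis by blast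
qed

lemma corresponds_unique: "corresponds V a c \<Longrightarrow> corresponds V b c \<Longrightarrow> a = b"
  by (rule coend_left_unique[of V V]) (auto simp: corresponds_def dest: HomD)

lemma corresponds_unique':
  assumes "corresponds V a c" "corresponds V a c'" "X \<in> Obj C"
  shows "c X = c' X"
  using transpose_inj[OF correspondsD(4)[OF assms(1,3)] correspondsD(4)[OF assms(2,3)]]
    correspondsD(5)[OF assms(1,3)] correspondsD(5)[OF assms(2,3)] by simp

text \<open>The dinaturality of \<open>i\<close> is carried over by the transposition, which is
  injective.\<close>

lemma corresponds_natural:
  assumes corr: "corresponds V a c" and f: "f \<in> Hom C X Y"
  shows "c Y \<cdot> (\<iota> V \<otimes> f) = (f \<otimes> \<iota> V) \<cdot> c X"
proof -
  note s = dual_arr_setup[OF f] and V = correspondsD(2)[OF corr]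
  note cX = correspondsD(4)[OF corr s(1)] and cY = correspondsD(4)[OF corr s(2)]
  note [simp] = V s(1,2)
  note [reprs] = s(3,4) i_box correspondsD(3)[OF corr]
    cX cY
  note i = i_dinat_rule[OF f]
  have "transpose X V V Y (c Y \<cdot> (\<iota> V \<otimes> f)) = (a \<cdot> (\<iota> V \<otimes> i Y)) \<cdot> (\<iota> V \<otimes> \<iota> (dual C Y) \<otimes> f)"
    using transpose_pre[OF cY f] correspondsD(5)[OF corr s(2)] by simp
  also have "\<dots> = (a \<cdot> (\<iota> V \<otimes> i X)) \<cdot> (\<iota> V \<otimes> dual_arr C f \<otimes> \<iota> X)"
    apply (rule sym)
    by (rule run_eq[OF _ _ _ good_Cons[OF i good_Nil],
      where ms = "[Rw 0 0 1]"])
      (rule reprs repr_box | simp)+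
  also have "\<dots> = transpose X V V Y ((f \<otimes> \<iota> V) \<cdot> c X)"
    using transpose_post[OF cX f] correspondsD(5)[OF corr s(1)] by simp
  finally have eq: "transpose X V V Y (c Y \<cdot> (\<iota> V \<otimes> f)) = transpose X V V Y ((f \<otimes> \<iota> V) \<cdot> c X)" .
  have "repr (c Y \<cdot> (\<iota> V \<otimes> f)) [V, X] [(1, [X], f, [Y]), (0, [V, Y], c Y, [Y, V])] [Y, V]"
    "repr ((f \<otimes> \<iota> V) \<cdot> c X) [V, X] [(0, [V, X], c X, [X, V]), (0, [X], f, [Y])] [Y, V]"
    by (rule repr_cong, (rule reprs repr_box | simp)+)+
  from this[THEN repr_is_box] eq show ?thesis by (rule transpose_inj)
qed

text \<open>The chosen dual of the unit object may differ from the unit object. Its coevaluation,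
  which is \<open>dual_unit\<close>, is pulled across V and cancels against its evaluation by a
  zigzag identity in which the strand of the unit object has disappeared.\<close>

lemma corresponds_unit:
  assumes corr: "corresponds V a c"
  shows "a \<cdot> (\<iota> V \<otimes> (i \<I> \<cdot> dual_unit C)) = c \<I>"
proof -
  note V [simp] = correspondsD(2)[OF corr]
  note b = left_dual_boxes[of "[]", simplified, OF is_dual[OF unit_obj]]
  note sI = snake_rules(1)[of "[]", simplified, OF is_dual[OF unit_obj]]
  have coI: "is_box ([], coev C \<I>, [dual C \<I>])" and ib: "is_box ([dual C \<I>], i \<I>, [A])"
    and cI: "is_box ([V], c \<I>, [V])"
    using b i_hom[OF unit_obj] correspondsD(4)[OF corr unit_obj]
    by (auto simp: is_box_def unit_obj unit_obj_left unit_obj_right)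
  note [simp] = dual_obj[OF unit_obj]
  note [reprs] = coI ib cI correspondsD(3)[OF corr]
    b(2)
  have "a \<cdot> (\<iota> V \<otimes> i \<I>) = (ev C \<I> \<otimes> \<iota> V) \<cdot> (\<iota> (dual C \<I>) \<otimes> c \<I>) \<cdot> \<Phi> V (dual C \<I>)"
    using correspondsD(5)[OF corr unit_obj] braid_hom[of V "dual C \<I>"]
    by (auto simp: transpose_def unit_arr_right dest: HomD)
  then have r: "good ([V, dual C \<I>], [(1, [dual C \<I>], i \<I>, [A]), (0, [V, A], a, [V])],
    [(0, crossing V (dual C \<I>)), (1, [V], c \<I>, [V]), (0, [dual C \<I>], ev C \<I>, [])])"
    by (rule goodI) (rule reprs repr_box | simp)+
  show ?thesis unfolding dual_unit_def
    by (rule run_eq[OF _ _ _ good_Cons[OF r good_Cons[OF natural_right[OF coI V] good_Cons[OF sI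
        good_Nil]]],
      where ms = "[Rw 0 1 0, SL 2, Rw 1 0 0, SR 1, SR 0, Rw 2 1 0]"])
      (rule reprs repr_box | simp)+
qed

end

subsection \<open>The bialgebra structure of the coend\<close>

context braided_coend
begin

abbreviation dt_box :: "'o \<Rightarrow> 'o \<Rightarrow> ('o, 'a) box" where
  "dt_box X Y \<equiv> ([dual C Y, dual C X], dual_tens C X Y, [dual C (X \<odot> Y)])"
abbreviation ev2_box :: "'o \<Rightarrow> 'o \<Rightarrow> ('o, 'a) box" where
  "ev2_box X Y \<equiv> ([dual C (X \<odot> Y), X, Y], ev C (X \<odot> Y), [])"
abbreviation coev2_box :: "'o \<Rightarrow> 'o \<Rightarrow> ('o, 'a) box" where
  "coev2_box X Y \<equiv> ([], coev C (X \<odot> Y), [X, Y, dual C (X \<odot> Y)])"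
abbreviation i2_box :: "'o \<Rightarrow> 'o \<Rightarrow> ('o, 'a) box" where
  "i2_box X Y \<equiv> ([dual C (X \<odot> Y), X, Y], i (X \<odot> Y), [A])"

lemma dual2_boxes:
  assumes "X \<in> Obj C" "Y \<in> Obj C"
  shows "X \<odot> Y \<in> Obj C" "dual C (X \<odot> Y) \<in> Obj C" "is_box (ev2_box X Y)" "is_box (coev2_box X Y)" "is_box (i2_box X Y)"
    "good ([X, Y], [(0, coev2_box X Y), (2, ev2_box X Y)], [])"
    "good ([dual C (X \<odot> Y)], [(1, coev2_box X Y), (0, ev2_box X Y)], [])"
proof -
  show XY: "X \<odot> Y \<in> Obj C" using assms by (intro tens_obj)
  then show "dual C (X \<odot> Y) \<in> Obj C" by simp
  from XY have d: "is_left_dual C (ob [X, Y]) (dual C (X \<odot> Y)) (ev C (X \<odot> Y)) (coev C (X \<odot> Y))"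
    using is_dual by simp
  from left_dual_boxes[OF d] assms show "is_box (ev2_box X Y)" "is_box (coev2_box X Y)" by auto
  from snake_rules[OF d] assms show "good ([X, Y], [(0, coev2_box X Y), (2, ev2_box X Y)], [])"
    "good ([dual C (X \<odot> Y)], [(1, coev2_box X Y), (0, ev2_box X Y)], [])"
    by (simp_all add: numeral_2_eq_2)
  show "is_box (i2_box X Y)"
    using i_hom[OF XY] assms XY by (auto simp: is_box_def)
qed

lemma dual_tens_repr:
  assumes X [simp]: "X \<in> Obj C" and Y [simp]: "Y \<in> Obj C"
  shows "repr (dual_tens C X Y) [dual C Y, dual C X] [(2, coev2_box X Y), (1, ev_box X), (0, ev_box Y)] [dual C (X \<odot> Y)]"
proof -
  note d = dual2_boxes[OF X Y]
  note [simp] = d(1,2)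
  have id: "repr (\<iota> (dual C (X \<odot> Y))) [dual C (X \<odot> Y)] [] [dual C (X \<odot> Y)]" by (rule repr_id1) simp
  show ?thesis
    unfolding dual_tens_def
    by (rule repr_cong) (rule reprs d(3) d(4) dual_boxes[OF X]
      dual_boxes[OF Y] repr_box | simp)+
qed

lemma dual_tens_box: "X \<in> Obj C \<Longrightarrow> Y \<in> Obj C \<Longrightarrow> is_box (dt_box X Y)"
  by (rule repr_is_box[OF dual_tens_repr])

lemma dual_tens_rule:
  assumes "X \<in> Obj C" "Y \<in> Obj C"
  shows "good ([dual C Y, dual C X], [(0, dt_box X Y)], [(2, coev2_box X Y), (1, ev_box X), (0, ev_box Y)])"
  by (rule goodI[OF refl repr_box[OF dual_tens_box[OF assms]] dual_tens_repr[OF assms]]) auto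

text \<open>This equation characterises the canonical morphism \<open>dual_tens\<close>: evaluation
  on X \<otimes> Y becomes two nested evaluations.\<close>

lemma dual_tens_ev:
  assumes X [simp]: "X \<in> Obj C" and Y [simp]: "Y \<in> Obj C"
  shows "good ([dual C Y, dual C X, X, Y], [(0, dt_box X Y), (0, ev2_box X Y)], [(1, ev_box X), (0, ev_box Y)])"
proof -
  note d = dual2_boxes[OF X Y]
  note [simp] = d(1,2)
  note dt = dual_tens_rule[OF X Y] and sP = d(6,7)
  note [reprs] = d(3) d(4) dual_boxes[OF X]
      dual_boxes[OF Y] dual_tens_box[OF X Y]
  have "ev C (X \<odot> Y) \<cdot> (dual_tens C X Y \<otimes> \<iota> X \<otimes> \<iota> Y) = ev C Y \<cdot> (\<iota> (dual C Y) \<otimes> ev C X \<otimes> \<iota> Y)"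
    by (rule run_eq[OF _ _ _ good_Cons[OF dt good_Cons[OF sP(1) good_Nil]],
      where ms = "[Rw 0 0 0, SR 2, SR 1, Rw 1 0 2]"])
      (rule reprs repr_box | simp)+
  then show ?thesis by (rule goodI) (rule reprs repr_box | simp)+
qed

text \<open>Morphisms into the dual of X \<otimes> Y are compared by inserting a zigzag, which turns
  them into pairings with X \<otimes> Y; there \<open>dual_tens_ev\<close> and the defining property
  of the dual of f apply. The last two claims are what dinaturality of the multiplication in X
  requires.\<close>

lemma dual_tens_natural_left:
  assumes f: "f \<in> Hom C X X'" and Y [simp]: "Y \<in> Obj C"
  defines "fY \<equiv> ([dual C (X' \<odot> Y)], dual_arr C (f \<otimes> \<iota> Y), [dual C (X \<odot> Y)])"
  shows "is_box fY"
    and "good ([dual C (X' \<odot> Y), X, Y], [(0, fY), (0, i2_box X Y)], [(1, [X], f, [X']), (0, i2_box X' Y)])"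
    and "good ([dual C Y, dual C X'], [(1, [dual C X'], dual_arr C f, [dual C X]), (0, dt_box X Y)],
      [(0, dt_box X' Y), (0, fY)])"
proof -
  note s = dual_arr_setup[OF f]
  have fY: "f \<otimes> \<iota> Y \<in> Hom C (X \<odot> Y) (X' \<odot> Y)" using f by (intro tens_hom id_hom) auto
  note t = dual_arr_setup[OF fY]
  show "is_box fY" unfolding fY_def by (rule t(4))
  note d = dual2_boxes[OF s(1) Y] and d' = dual2_boxes[OF s(2) Y]
  note [simp] = s(1,2) d(1,2) d'(1,2)
  note [reprs] = s(3,4) t(4) d(3-5) d'(3-5)
    dual_tens_box[OF s(1) Y] dual_tens_box[OF s(2) Y]
  note id1 = repr_id1[OF d(2)] repr_id1[OF d'(2)]
  have "ev C (X \<odot> Y) \<cdot> (dual_arr C (f \<otimes> \<iota> Y) \<otimes> \<iota> X \<otimes> \<iota> Y) =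
    ev C (X' \<odot> Y) \<cdot> (\<iota> (dual C (X' \<odot> Y)) \<otimes> f \<otimes> \<iota> Y)"
    using dual_arr_ev_eq[OF fY] by (simp add: tens_id)
  then have fYd: "good ([dual C (X' \<odot> Y), X, Y], [(0, fY), (0, ev2_box X Y)], [(1, [X], f, [X']), (0, ev2_box X' Y)])"
    unfolding fY_def by (rule goodI) (rule id1 reprs repr_box | simp)+
  have "i (X \<odot> Y) \<cdot> (dual_arr C (f \<otimes> \<iota> Y) \<otimes> \<iota> X \<otimes> \<iota> Y) =
    i (X' \<odot> Y) \<cdot> (\<iota> (dual C (X' \<odot> Y)) \<otimes> f \<otimes> \<iota> Y)"
    using i_dinat[OF fY] by (simp add: tens_id)
  then show "good ([dual C (X' \<odot> Y), X, Y], [(0, fY), (0, i2_box X Y)], [(1, [X], f, [X']), (0, i2_box X' Y)])"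
    unfolding fY_def by (rule goodI) (rule id1 reprs repr_box | simp)+
  note fd = dual_arr_ev[OF f] and dtev = dual_tens_ev[OF s(1) Y] and dtev2 = dual_tens_ev[OF s(2) Y] and sP = d(6,7)
  note fYd = fYd[unfolded fY_def]
  have "dual_tens C X Y \<cdot> (\<iota> (dual C Y) \<otimes> dual_arr C f) = dual_arr C (f \<otimes> \<iota> Y) \<cdot> dual_tens C X' Y"
    by (rule run_eq[OF _ _ _ good_Cons[OF sP(2) good_Cons[OF dtev good_Cons[OF fd good_Cons[OF dtev2
        good_Cons[OF fYd good_Nil]]]]],
      where ms = "[Bw 0 2 0, SR 1, Rw 1 2 0, SR 0, Rw 2 1 1, Bw 3 2 0, SL 1, SL 0, Bw 4 2 0, SL 1, Rw 0
        2 0]"])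
      (rule reprs repr_box | simp)+
  then show "good ([dual C Y, dual C X'], [(1, [dual C X'], dual_arr C f, [dual C X]), (0, dt_box X Y)],
      [(0, dt_box X' Y), (0, fY)])"
    unfolding fY_def by (rule goodI) (rule reprs repr_box | simp)+
qed

lemma dual_tens_natural_right:
  assumes f: "f \<in> Hom C Y Y'" and X [simp]: "X \<in> Obj C"
  defines "Xf \<equiv> ([dual C (X \<odot> Y')], dual_arr C (\<iota> X \<otimes> f), [dual C (X \<odot> Y)])"
  shows "is_box Xf"
    and "good ([dual C (X \<odot> Y'), X, Y], [(0, Xf), (0, i2_box X Y)], [(2, [Y], f, [Y']), (0, i2_box X Y')])"
    and "good ([dual C Y', dual C X], [(0, [dual C Y'], dual_arr C f, [dual C Y]), (0, dt_box X Y)],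
      [(0, dt_box X Y'), (0, Xf)])"
proof -
  note s = dual_arr_setup[OF f]
  have Xf: "\<iota> X \<otimes> f \<in> Hom C (X \<odot> Y) (X \<odot> Y')" using f by (intro tens_hom id_hom) auto
  note t = dual_arr_setup[OF Xf]
  show "is_box Xf" unfolding Xf_def by (rule t(4))
  note d = dual2_boxes[OF X s(1)] and d' = dual2_boxes[OF X s(2)]
  note [simp] = s(1,2) d(1,2) d'(1,2)
  note [reprs] = s(3,4) t(4) d(3-5) d'(3-5)
    dual_tens_box[OF X s(1)] dual_tens_box[OF X s(2)]
  have "ev C (X \<odot> Y) \<cdot> (dual_arr C (\<iota> X \<otimes> f) \<otimes> \<iota> X \<otimes> \<iota> Y) =
    ev C (X \<odot> Y') \<cdot> (\<iota> (dual C (X \<odot> Y')) \<otimes> \<iota> X \<otimes> f)"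
    using dual_arr_ev_eq[OF Xf] by (simp add: tens_id)
  then have fYd: "good ([dual C (X \<odot> Y'), X, Y], [(0, Xf), (0, ev2_box X Y)], [(2, [Y], f, [Y']), (0, ev2_box X Y')])"
    unfolding Xf_def by (rule goodI) (rule reprs repr_box | simp)+
  have "i (X \<odot> Y) \<cdot> (dual_arr C (\<iota> X \<otimes> f) \<otimes> \<iota> X \<otimes> \<iota> Y) =
    i (X \<odot> Y') \<cdot> (\<iota> (dual C (X \<odot> Y')) \<otimes> \<iota> X \<otimes> f)"
    using i_dinat[OF Xf] by (simp add: tens_id)
  then show "good ([dual C (X \<odot> Y'), X, Y], [(0, Xf), (0, i2_box X Y)], [(2, [Y], f, [Y']), (0, i2_box X Y')])"
    unfolding Xf_def by (rule goodI) (rule reprs repr_box | simp)+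
  note fd = dual_arr_ev[OF f] and dtev = dual_tens_ev[OF X s(1)] and dtev2 = dual_tens_ev[OF X s(2)] and sP = d(6,7)
  note fYd = fYd[unfolded Xf_def]
  have "dual_tens C X Y \<cdot> (dual_arr C f \<otimes> \<iota> (dual C X)) = dual_arr C (\<iota> X \<otimes> f) \<cdot> dual_tens C X Y'"
    by (rule run_eq[OF _ _ _ good_Cons[OF sP(2) good_Cons[OF dtev good_Cons[OF fd good_Cons[OF dtev2
        good_Cons[OF fYd good_Nil]]]]],
      where ms = "[Bw 0 2 0, SR 1, Rw 1 2 0, SR 0, SR 1, Rw 2 2 0, SR 1, Bw 3 2 0, SL 1, SL 0, Bw 4 2 0,
        SL 1, Rw 0 2 0]"])
      (rule reprs repr_box | simp)+
  then show "good ([dual C Y', dual C X], [(0, [dual C Y'], dual_arr C f, [dual C Y]), (0, dt_box X Y)],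
      [(0, dt_box X Y'), (0, Xf)])"
    unfolding Xf_def by (rule goodI) (rule reprs repr_box | simp)+
qed

section \<open>Existence of the structure morphisms of the coend\<close>

definition mult_family :: "'o \<Rightarrow> 'o \<Rightarrow> 'a" where
  "mult_family X Y = i (X \<odot> Y) \<cdot> (dual_tens C X Y \<otimes> \<iota> X \<otimes> \<iota> Y) \<cdot> (\<Phi> (dual C X \<odot> X) (dual C Y) \<otimes> \<iota> Y)"

lemma mult_family_repr:
  assumes X [simp]: "X \<in> Obj C" and Y [simp]: "Y \<in> Obj C"
  shows "repr (mult_family X Y) [dual C X, X, dual C Y, Y]
    [(1, crossing X (dual C Y)), (0, crossing (dual C X) (dual C Y)), (0, dt_box X Y), (0, i2_box X Y)] [A]"
  unfolding mult_family_def
  by (rule repr_cong) (rule reprs dual2_boxes(5)[OF X Y] dual_tens_box[OF X Y]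
    repr_box | simp)+

lemma mult_family_hom:
  "X \<in> Obj C \<Longrightarrow> Y \<in> Obj C \<Longrightarrow> mult_family X Y \<in> Hom C (dual C X \<odot> X \<odot> dual C Y \<odot> Y) A"
  using repr_hom[OF mult_family_repr] by simp

text \<open>The dual of Y crosses both strands belonging to X, so f and its dual are moved by
  naturality of these crossings; in between, \<open>dual_tens\<close> is natural and
  \<open>i\<close> is dinatural.\<close>

lemma mult_family_dinat_left:
  assumes f: "f \<in> Hom C X X'" and Y [simp]: "Y \<in> Obj C"
  shows "mult_family X Y \<cdot> (dual_arr C f \<otimes> \<iota> X \<otimes> \<iota> (dual C Y) \<otimes> \<iota> Y) =
    mult_family X' Y \<cdot> (\<iota> (dual C X') \<otimes> f \<otimes> \<iota> (dual C Y) \<otimes> \<iota> Y)"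
proof -
  note s = dual_arr_setup[OF f]
  note [simp] = s(1,2)
  note KY = dual_obj[OF Y]
  note n = dual_tens_natural_left[OF f Y]
  note i = n(2) and dtn = n(3)
  note [reprs] = s(3,4) dual2_boxes(5)[OF s(1) Y] dual2_boxes(5)[OF s(2) Y]
    dual_tens_box[OF s(1) Y] dual_tens_box[OF s(2) Y]
  show ?thesis unfolding mult_family_def
    by (rule run_eq[OF _ _ _ good_Cons[OF natural_left[OF s(4) KY] good_Cons[OF dtn good_Cons[OF i
        good_Cons[OF natural_left[OF s(3) KY] good_Nil]]]],
      where ms = "[SR 0, Rw 0 1 0, Rw 1 2 0, Rw 2 3 0, SR 2, SR 1, Bw 3 0 1]"])
      (rule reprs repr_box | simp)+
qed

lemma mult_family_dinat_right:
  assumes f: "f \<in> Hom C Y Y'" and X [simp]: "X \<in> Obj C"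
  shows "mult_family X Y \<cdot> (\<iota> (dual C X) \<otimes> \<iota> X \<otimes> dual_arr C f \<otimes> \<iota> Y) =
    mult_family X Y' \<cdot> (\<iota> (dual C X) \<otimes> \<iota> X \<otimes> \<iota> (dual C Y') \<otimes> f)"
proof -
  note s = dual_arr_setup[OF f]
  note [simp] = s(1,2)
  note KX = dual_obj[OF X]
  note n = dual_tens_natural_right[OF f X]
  note i = n(2) and dtn = n(3)
  note [reprs] = s(3,4) dual2_boxes(5)[OF X s(1)] dual2_boxes(5)[OF X s(2)]
    dual_tens_box[OF X s(1)] dual_tens_box[OF X s(2)]
  show ?thesis unfolding mult_family_def
    by (rule run_eq[OF _ _ _ good_Cons[OF natural_right[OF s(4) X] good_Cons[OF natural_right[OF s(4)
        KX] good_Cons[OF dtn good_Cons[OF i good_Nil]]]],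
      where ms = "[Rw 0 0 1, Rw 1 1 0, Rw 2 2 0, Rw 3 3 0, SR 2, SR 1, SR 0]"])
      (rule reprs repr_box | simp)+
qed

text \<open>Factorization in one variable at a time. For each Y the universal property with strands
  on the right gives a morphism \<open>m Y\<close>. These again form a dinatural family, as is
  verified after composing with every \<open>i X\<close>, and the universal property with a strand
  on the left applies to it.\<close>

lemma mult_exists:
  "\<exists>m. m \<in> Hom C (A \<odot> A) A \<and> (\<forall>X \<in> Obj C. \<forall>Y \<in> Obj C. m \<cdot> (i X \<otimes> i Y) = mult_family X Y)"
proof -
  have obj: "dual C Y \<odot> Y \<in> Obj C" if "Y \<in> Obj C" for Y using that by (intro tens_obj) auto
  have "\<exists>m. m \<in> Hom C (A \<odot> dual C Y \<odot> Y) A \<and> (\<forall>X \<in> Obj C. m \<cdot> (i X \<otimes> \<iota> (dual C Y \<odot> Y)) = mult_family X Y)"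
    if Y [simp]: "Y \<in> Obj C" for Y
    by (rule coend_right) (use obj mult_family_hom mult_family_dinat_left in \<open>auto simp flip: tens_id\<close>)
  then obtain m where m: "\<And>Y. Y \<in> Obj C \<Longrightarrow> m Y \<in> Hom C (A \<odot> dual C Y \<odot> Y) A"
    "\<And>X Y. X \<in> Obj C \<Longrightarrow> Y \<in> Obj C \<Longrightarrow> m Y \<cdot> (i X \<otimes> \<iota> (dual C Y \<odot> Y)) = mult_family X Y"
    by metis
  have "\<exists>a. a \<in> Hom C (A \<odot> A) A \<and> (\<forall>Y \<in> Obj C. a \<cdot> (\<iota> A \<otimes> i Y) = m Y)"
  proof (rule coend_left)
    fix Y Y' f assume f: "f \<in> Hom C Y Y'"
    note s = dual_arr_setup[OF f]
    note [simp] = s(1,2)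
    have mb: "is_box ([A, dual C Y, Y], m Y, [A])" "is_box ([A, dual C Y', Y'], m Y', [A])"
      using m(1) by (auto simp: is_box_def)
    note r = reprs s(3,4) mb i_box
    show "m Y \<cdot> (\<iota> A \<otimes> dual_arr C f \<otimes> \<iota> Y) = m Y' \<cdot> (\<iota> A \<otimes> \<iota> (dual C Y') \<otimes> f)"
    proof (rule coend_right_unique)
      have "repr (m Y \<cdot> (\<iota> A \<otimes> dual_arr C f \<otimes> \<iota> Y)) [A, dual C Y', Y]
        [(1, [dual C Y'], dual_arr C f, [dual C Y]), (0, [A, dual C Y, Y], m Y, [A])] [A]"
        "repr (m Y' \<cdot> (\<iota> A \<otimes> \<iota> (dual C Y') \<otimes> f)) [A, dual C Y', Y]
        [(2, [Y], f, [Y']), (0, [A, dual C Y', Y'], m Y', [A])] [A]"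
        by (rule repr_cong, (rule r repr_box | simp)+)+
      from this[THEN repr_hom]
      show "m Y \<cdot> (\<iota> A \<otimes> dual_arr C f \<otimes> \<iota> Y) \<in> Hom C (A \<odot> dual C Y' \<odot> Y) A"
        "m Y' \<cdot> (\<iota> A \<otimes> \<iota> (dual C Y') \<otimes> f) \<in> Hom C (A \<odot> dual C Y' \<odot> Y) A" by auto
    next
      fix X assume X [simp]: "X \<in> Obj C"
      have "(m Y \<cdot> (\<iota> A \<otimes> dual_arr C f \<otimes> \<iota> Y)) \<cdot> (i X \<otimes> \<iota> (dual C Y' \<odot> Y)) =
        (m Y \<cdot> (i X \<otimes> \<iota> (dual C Y \<odot> Y))) \<cdot> (\<iota> (dual C X) \<otimes> \<iota> X \<otimes> dual_arr C f \<otimes> \<iota> Y)"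
        by (rule run_eq[OF _ _ _ good_Nil, where ms = "[SR 0]"]) (rule r repr_box | simp)+
      moreover have "(m Y' \<cdot> (\<iota> A \<otimes> \<iota> (dual C Y') \<otimes> f)) \<cdot> (i X \<otimes> \<iota> (dual C Y' \<odot> Y)) =
        (m Y' \<cdot> (i X \<otimes> \<iota> (dual C Y' \<odot> Y'))) \<cdot> (\<iota> (dual C X) \<otimes> \<iota> X \<otimes> \<iota> (dual C Y') \<otimes> f)"
        by (rule run_eq[OF _ _ _ good_Nil, where ms = "[SR 0]"]) (rule r repr_box | simp)+
      ultimately show "(m Y \<cdot> (\<iota> A \<otimes> dual_arr C f \<otimes> \<iota> Y)) \<cdot> (i X \<otimes> \<iota> (dual C Y' \<odot> Y)) =
        (m Y' \<cdot> (\<iota> A \<otimes> \<iota> (dual C Y') \<otimes> f)) \<cdot> (i X \<otimes> \<iota> (dual C Y' \<odot> Y))"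
        using mult_family_dinat_right[OF f X] m(2) by simp
    qed (auto intro: tens_obj)
  qed (use m(1) in auto)
  then obtain a where a: "a \<in> Hom C (A \<odot> A) A" "\<And>Y. Y \<in> Obj C \<Longrightarrow> a \<cdot> (\<iota> A \<otimes> i Y) = m Y" by blast
  then have ab: "is_box ([A, A], a, [A])" by (simp add: is_box_def)
  have "a \<cdot> (i X \<otimes> i Y) = mult_family X Y" if [simp]: "X \<in> Obj C" "Y \<in> Obj C" for X Y
  proof -
    note r = reprs ab i_box
    have "a \<cdot> (i X \<otimes> i Y) = (a \<cdot> (\<iota> A \<otimes> i Y)) \<cdot> (i X \<otimes> \<iota> (dual C Y \<odot> Y))"
      by (rule run_eq[OF _ _ _ good_Nil, where ms = "[]"]) (rule r repr_box | simp)+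
    then show ?thesis using a(2) m(2) by simp
  qed
  with a(1) show ?thesis by blast
qed

text \<open>For dinaturality, f passes through the first \<open>i\<close>, is turned into its dual
  by the coevaluation and then passes through the second \<open>i\<close>.\<close>

lemma comult_exists:
  "\<exists>d. d \<in> Hom C A (A \<odot> A) \<and> (\<forall>X \<in> Obj C. d \<cdot> i X = (i X \<otimes> i X) \<cdot> (\<iota> (dual C X) \<otimes> coev C X \<otimes> \<iota> X))"
proof -
  have "dinatural C (A \<odot> A) (\<lambda>X. (i X \<otimes> i X) \<cdot> (\<iota> (dual C X) \<otimes> coev C X \<otimes> \<iota> X))"
    unfolding dinatural_def
  proof (intro conjI ballI)
    show "A \<odot> A \<in> Obj C" by (intro tens_obj) auto
    fix X assume X [simp]: "X \<in> Obj C"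
    have "repr ((i X \<otimes> i X) \<cdot> (\<iota> (dual C X) \<otimes> coev C X \<otimes> \<iota> X)) [dual C X, X]
      [(1, coev_box X), (0, i_bx X), (1, i_bx X)] [A, A]"
      by (rule repr_cong) (rule reprs dual_boxes[OF X] i_box repr_box | simp)+
    from repr_hom[OF this]
    show "(i X \<otimes> i X) \<cdot> (\<iota> (dual C X) \<otimes> coev C X \<otimes> \<iota> X) \<in> Hom C (dual C X \<odot> X) (A \<odot> A)" by simp
    fix Y f assume f: "f \<in> Hom C X Y"
    note s = dual_arr_setup[OF f]
    note [simp] = s(2) and i = i_dinat_rule[OF f] and co = dual_arr_coev[OF f]
    note [reprs] = s(3,4) i_box dual_boxes[OF X]
      dual_boxes[OF s(2)]
    show "((i X \<otimes> i X) \<cdot> (\<iota> (dual C X) \<otimes> coev C X \<otimes> \<iota> X)) \<cdot> (dual_arr C f \<otimes> \<iota> X) =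
      ((i Y \<otimes> i Y) \<cdot> (\<iota> (dual C Y) \<otimes> coev C Y \<otimes> \<iota> Y)) \<cdot> (\<iota> (dual C Y) \<otimes> f)"
      by (rule run_eq[OF _ _ _ good_Cons[OF i good_Cons[OF co good_Nil]],
        where ms = "[SR 0, SR 2, SR 1, Rw 0 2 0, SL 1, SL 2, Rw 1 0 1, SL 1, Rw 0 2 1, SR 1, SR 0]"])
        (rule reprs repr_box | simp)+
  qed
  then show ?thesis using coend unfolding is_aut_coend_def by blast
qed

lemma counit_exists: "\<exists>e. e \<in> Hom C A \<I> \<and> (\<forall>X \<in> Obj C. e \<cdot> i X = ev C X)"
proof -
  have "dinatural C \<I> (ev C)"
    unfolding dinatural_def
    using is_dual dual_arr_ev_eq by (auto simp: unit_obj is_left_dual_def)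
  then show ?thesis using coend unfolding is_aut_coend_def by blast
qed

abbreviation B :: "('o, 'a) bialg" where "B \<equiv> aut_bialg C \<Phi> A i"

lemma carr_B [simp]: "carr B = A" by (simp add: aut_bialg_def)

text \<open>The structure morphisms are definite descriptions, so existence and uniqueness have to
  be established before any equation about them is available.\<close>

lemma mlt_B: "mlt B \<in> Hom C (A \<odot> A) A"
    "X \<in> Obj C \<Longrightarrow> Y \<in> Obj C \<Longrightarrow> mlt B \<cdot> (i X \<otimes> i Y) = mult_family X Y"
proof -
  let ?P = "\<lambda>m. m \<in> Hom C (A \<odot> A) A \<and> (\<forall>X \<in> Obj C. \<forall>Y \<in> Obj C. m \<cdot> (i X \<otimes> i Y) = mult_family X Y)"
  have "\<exists>!m. ?P m"
  proof (rule ex_ex1I[OF mult_exists])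
    fix m m' assume m: "?P m" "?P m'"
    have arr: "i X \<otimes> i Y \<in> Arr C" if "X \<in> Obj C" "Y \<in> Obj C" for X Y
      using HomD(1)[OF tens_hom[OF i_hom i_hom]] that by simp
    show "m = m'"
      by (rule coend_unique2[of \<I> A])
        (use m arr in \<open>auto simp: unit_obj unit_obj_left tens_obj unit_arr_left\<close>)
  qed
  from theI'[OF this] have "?P (mlt B)"
    by (simp add: aut_bialg_def mult_family_def)
  then show "mlt B \<in> Hom C (A \<odot> A) A"
    "X \<in> Obj C \<Longrightarrow> Y \<in> Obj C \<Longrightarrow> mlt B \<cdot> (i X \<otimes> i Y) = mult_family X Y" by blast+
qed

lemma cml_B: "cml B \<in> Hom C A (A \<odot> A)"
    "X \<in> Obj C \<Longrightarrow> cml B \<cdot> i X = (i X \<otimes> i X) \<cdot> (\<iota> (dual C X) \<otimes> coev C X \<otimes> \<iota> X)"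
proof -
  let ?P = "\<lambda>d. d \<in> Hom C A (A \<odot> A) \<and>
    (\<forall>X \<in> Obj C. d \<cdot> i X = (i X \<otimes> i X) \<cdot> (\<iota> (dual C X) \<otimes> coev C X \<otimes> \<iota> X))"
  have "\<exists>!d. ?P d"
    by (rule ex_ex1I[OF comult_exists], rule coend_unique[of "A \<odot> A"]) (auto intro: tens_obj)
  from theI'[OF this] have "?P (cml B)" by (simp add: aut_bialg_def)
  then show "cml B \<in> Hom C A (A \<odot> A)"
    "X \<in> Obj C \<Longrightarrow> cml B \<cdot> i X = (i X \<otimes> i X) \<cdot> (\<iota> (dual C X) \<otimes> coev C X \<otimes> \<iota> X)" by blast+
qed

lemma cnt_B: "cnt B \<in> Hom C A \<I>" "X \<in> Obj C \<Longrightarrow> cnt B \<cdot> i X = ev C X"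
proof -
  let ?P = "\<lambda>e. e \<in> Hom C A \<I> \<and> (\<forall>X \<in> Obj C. e \<cdot> i X = ev C X)"
  have "\<exists>!e. ?P e"
    by (rule ex_ex1I[OF counit_exists], rule coend_unique[of \<I>]) (auto intro: unit_obj)
  from theI'[OF this] have "?P (cnt B)" by (simp add: aut_bialg_def)
  then show "cnt B \<in> Hom C A \<I>" "X \<in> Obj C \<Longrightarrow> cnt B \<cdot> i X = ev C X" by blast+
qed

lemma mlt_box: "is_box ([A, A], mlt B, [A])" and cml_box: "is_box ([A], cml B, [A, A])"
  using mlt_B cml_B by (auto simp: is_box_def)

lemma mlt_rule:
  assumes X [simp]: "X \<in> Obj C" and Y [simp]: "Y \<in> Obj C"
  shows "good ([dual C X, X, dual C Y, Y], [(0, i_bx X), (1, i_bx Y), (0, [A, A], mlt B, [A])],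
    [(1, crossing X (dual C Y)), (0, crossing (dual C X) (dual C Y)), (0, dt_box X Y), (0, i2_box X Y)])"
  by (rule goodI[OF mlt_B(2)[OF X Y] _ mult_family_repr[OF X Y]])
    (rule reprs i_box mlt_box repr_box | simp)+

lemma cml_rule:
  assumes X [simp]: "X \<in> Obj C"
  shows "good ([dual C X, X], [(0, i_bx X), (0, [A], cml B, [A, A])],
    [(1, coev_box X), (0, i_bx X), (1, i_bx X)])"
  by (rule goodI[OF cml_B(2)[OF X]])
    (rule reprs i_box cml_box dual_boxes[OF X] repr_box | simp)+

text \<open>Tested on \<open>i X \<otimes> i Y\<close>, the two sides of the associativity of
  \<open>a\<close> become the transposes of the two sides of the hexagon for
  \<open>c\<close>.\<close>

lemma corresponds_mult:
  assumes corr: "corresponds V a c" and X [simp]: "X \<in> Obj C" and Y [simp]: "Y \<in> Obj C"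
  shows "(a \<cdot> (\<iota> V \<otimes> mlt B)) \<cdot> (\<iota> V \<otimes> i X \<otimes> i Y) = transpose2 V V X Y (c (X \<odot> Y))"
    and "(a \<cdot> (a \<otimes> \<iota> A)) \<cdot> (\<iota> V \<otimes> i X \<otimes> i Y) = transpose2 V V X Y ((\<iota> X \<otimes> c Y) \<cdot> (c X \<otimes> \<iota> Y))"
proof -
  note V [simp] = correspondsD(2)[OF corr]
  note d = dual2_boxes[OF X Y]
  note [simp] = d(1,2)
  have cb: "is_box ([V, X, Y], c (X \<odot> Y), [X, Y, V])"
    using correspondsD(4)[OF corr d(1)] by (simp add: is_box_def assoc_obj)
  note cX = correspondsD(4)[OF corr X] and cY = correspondsD(4)[OF corr Y]
  note dt = dual_tens_box[OF X Y]
  note [reprs] = correspondsD(3)[OF corr] cX cY cb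
    i_box d(3-5) dt mlt_box
    dual_boxes[OF X] dual_boxes[OF Y]
  \<comment> \<open>The component at the product is drawn with X and Y as separate strands, the form
    in which \<open>dual_tens_ev\<close> applies.\<close>
  have "a \<cdot> (\<iota> V \<otimes> i (X \<odot> Y)) = (ev C (X \<odot> Y) \<otimes> \<iota> V) \<cdot> (\<iota> (dual C (X \<odot> Y)) \<otimes> c (X \<odot> Y)) \<cdot>
     (\<Phi> V (dual C (X \<odot> Y)) \<otimes> \<iota> (X \<odot> Y))"
    using correspondsD(5)[OF corr d(1)] by (simp add: transpose_def)
  then have r: "good ([V, dual C (X \<odot> Y), X, Y], [(1, i2_box X Y), (0, [V, A], a, [V])],
    [(0, crossing V (dual C (X \<odot> Y))), (1, [V, X, Y], c (X \<odot> Y), [X, Y, V]), (0, ev2_box X Y)])"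
    by (rule goodI) (rule reprs repr_box | simp)+
  note m = mlt_rule[OF X Y] and dtev = dual_tens_ev[OF X Y]
  show "(a \<cdot> (\<iota> V \<otimes> mlt B)) \<cdot> (\<iota> V \<otimes> i X \<otimes> i Y) = transpose2 V V X Y (c (X \<odot> Y))"
    unfolding transpose2_def
    by (rule run_eq[OF _ _ _ good_Cons[OF m good_Cons[OF r good_Cons[OF natural_right[OF dt V]
        good_Cons[OF dtev good_Nil]]]],
      where ms = "[Rw 0 0 1, Rw 1 3 0, Rw 2 2 0, SR 4, Rw 3 5 0]"])
      (rule reprs repr_box | simp)+
  have "(a \<cdot> (a \<otimes> \<iota> A)) \<cdot> (\<iota> V \<otimes> i X \<otimes> i Y) =
     transpose Y V V Y (c Y) \<cdot> (transpose X V V X (c X) \<otimes> \<iota> (dual C Y) \<otimes> \<iota> Y)"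
    unfolding transpose_def
    by (rule run_eq[OF _ _ _ good_Cons[OF correspondsD(6)[OF corr Y] good_Cons[OF correspondsD(6)[OF
        corr X] good_Nil]],
      where ms = "[SL 1, Rw 0 2 0, Rw 1 0 0]"])
      (rule reprs repr_box | simp)+
  then show "(a \<cdot> (a \<otimes> \<iota> A)) \<cdot> (\<iota> V \<otimes> i X \<otimes> i Y) =
     transpose2 V V X Y ((\<iota> X \<otimes> c Y) \<cdot> (c X \<otimes> \<iota> Y))"
    using transpose_mult[OF cX cY] by simp
qed

text \<open>Composed with \<open>i X\<close>, the two sides of linearity over A are the transposes
  of the two sides of the condition at X. One direction follows from uniqueness for the coend, the
  other from injectivity of the transposition.\<close>

lemma corresponds_arr:
  assumes cV: "corresponds V a c" and cW: "corresponds W b c'" and f: "f \<in> Hom C V W"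
  shows "(\<forall>X \<in> Obj C. (\<iota> X \<otimes> f) \<cdot> c X = c' X \<cdot> (f \<otimes> \<iota> X)) \<longleftrightarrow> f \<cdot> a = b \<cdot> (f \<otimes> \<iota> A)"
proof -
  note V [simp] = correspondsD(2)[OF cV] and W [simp] = correspondsD(2)[OF cW]
  have fb: "is_box ([V], f, [W])" using f by (simp add: is_box_def)
  note r = reprs fb correspondsD(3)[OF cV] correspondsD(3)[OF cW]
  have hom: "f \<cdot> a \<in> Hom C (V \<odot> A) W" "b \<cdot> (f \<otimes> \<iota> A) \<in> Hom C (V \<odot> A) W"
    using correspondsD(1)[OF cV] correspondsD(1)[OF cW] f by (auto intro!: comp_hom tens_hom id_hom)
  have eqs: "(f \<cdot> a) \<cdot> (\<iota> V \<otimes> i X) = transpose X V W X ((\<iota> X \<otimes> f) \<cdot> c X)"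
    "(b \<cdot> (f \<otimes> \<iota> A)) \<cdot> (\<iota> V \<otimes> i X) = transpose X V W X (c' X \<cdot> (f \<otimes> \<iota> X))"
    "is_box ([V, X], (\<iota> X \<otimes> f) \<cdot> c X, [X, W])" "is_box ([V, X], c' X \<cdot> (f \<otimes> \<iota> X), [X, W])"
    if X [simp]: "X \<in> Obj C" for X
  proof -
    note [reprs] = fb correspondsD(3)[OF cV] correspondsD(3)[OF cW]
      correspondsD(4)[OF cV X] correspondsD(4)[OF cW X] i_box
      dual_boxes[OF X]
    show "(f \<cdot> a) \<cdot> (\<iota> V \<otimes> i X) = transpose X V W X ((\<iota> X \<otimes> f) \<cdot> c X)"
      unfolding transpose_def
      by (rule run_eq[OF _ _ _ good_Cons[OF correspondsD(6)[OF cV X] good_Nil],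
        where ms = "[Rw 0 0 0, SR 2]"])
        (rule reprs repr_box | simp)+
    show "(b \<cdot> (f \<otimes> \<iota> A)) \<cdot> (\<iota> V \<otimes> i X) = transpose X V W X (c' X \<cdot> (f \<otimes> \<iota> X))"
      unfolding transpose_def
      by (rule run_eq[OF _ _ _ good_Cons[OF correspondsD(6)[OF cW X] good_Cons[OF natural_left[OF fb
          dual_obj[OF X]] good_Nil]],
        where ms = "[SL 0, Rw 0 1 0, Rw 1 0 0]"])
        (rule reprs repr_box | simp)+
    have "repr ((\<iota> X \<otimes> f) \<cdot> c X) [V, X] [(0, [V, X], c X, [X, V]), (1, [V], f, [W])] [X, W]"
      "repr (c' X \<cdot> (f \<otimes> \<iota> X)) [V, X] [(0, [V], f, [W]), (0, [W, X], c' X, [X, W])] [X, W]"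
      by (rule repr_cong, (rule reprs repr_box | simp)+)+
    from this[THEN repr_is_box]
    show "is_box ([V, X], (\<iota> X \<otimes> f) \<cdot> c X, [X, W])" "is_box ([V, X], c' X \<cdot> (f \<otimes> \<iota> X), [X, W])" by auto
  qed
  show ?thesis
  proof
    assume "\<forall>X \<in> Obj C. (\<iota> X \<otimes> f) \<cdot> c X = c' X \<cdot> (f \<otimes> \<iota> X)"
    with eqs show "f \<cdot> a = b \<cdot> (f \<otimes> \<iota> A)" by (intro coend_left_unique[OF V W hom]) auto
  next
    assume eq: "f \<cdot> a = b \<cdot> (f \<otimes> \<iota> A)"
    show "\<forall>X \<in> Obj C. (\<iota> X \<otimes> f) \<cdot> c X = c' X \<cdot> (f \<otimes> \<iota> X)"
    proof
      fix X assume X: "X \<in> Obj C"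
      show "(\<iota> X \<otimes> f) \<cdot> c X = c' X \<cdot> (f \<otimes> \<iota> X)"
        by (rule transpose_inj[OF eqs(3)[OF X] eqs(4)[OF X]])
          (simp only: eqs(1)[OF X, symmetric] eqs(2)[OF X, symmetric] eq)
    qed
  qed
qed

text \<open>The comultiplication doubles \<open>i X\<close> and joins the copies by a coevaluation.
  The copy acting on V has to cross W; then the coevaluation meets the evaluation belonging to the
  action on W, and the zigzag connects the output of \<open>c' X\<close> with the input of
  \<open>c X\<close>.\<close>

lemma corresponds_tens:
  assumes cV: "corresponds V a c" and cW: "corresponds W b c'"
  shows "corresponds (V \<odot> W) ((a \<otimes> b) \<cdot> (\<iota> V \<otimes> \<Phi> W A \<otimes> \<iota> A) \<cdot> (\<iota> V \<otimes> \<iota> W \<otimes> cml B))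
    (\<lambda>X. (c X \<otimes> \<iota> W) \<cdot> (\<iota> V \<otimes> c' X))" (is "corresponds _ ?a ?c")
proof -
  note V [simp] = correspondsD(2)[OF cV] and W [simp] = correspondsD(2)[OF cW]
  have VW: "V \<odot> W \<in> Obj C" by (intro tens_obj) auto
  note r = reprs correspondsD(3)[OF cV] correspondsD(3)[OF cW] cml_box
  have "repr ?a [V, W, A] [(2, [A], cml B, [A, A]), (1, crossing W A), (0, [V, A], a, [V]), (1, [W, A], b, [W])] [V, W]"
    by (rule repr_cong) (rule r repr_box | simp)+
  from repr_hom[OF this] have "?a \<in> Hom C ((V \<odot> W) \<odot> A) (V \<odot> W)" by (simp add: assoc_obj)
  moreover have "?c X \<in> Hom C ((V \<odot> W) \<odot> X) (X \<odot> V \<odot> W)"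
    "?a \<cdot> (\<iota> (V \<odot> W) \<otimes> i X) = transpose X (V \<odot> W) (V \<odot> W) X (?c X)" if X [simp]: "X \<in> Obj C" for X
  proof -
    note [reprs] = correspondsD(3)[OF cV] correspondsD(3)[OF cW] cml_box
      correspondsD(4)[OF cV X] correspondsD(4)[OF cW X] i_box
      dual_boxes[OF X]
    have "repr (?c X) [V, W, X] [(1, [W, X], c' X, [X, W]), (0, [V, X], c X, [X, V])] [X, V, W]"
      by (rule repr_cong) (rule reprs repr_box | simp)+
    from repr_hom[OF this] show "?c X \<in> Hom C ((V \<odot> W) \<odot> X) (X \<odot> V \<odot> W)" by (simp add: assoc_obj)
    show "?a \<cdot> (\<iota> (V \<odot> W) \<otimes> i X) = transpose X (V \<odot> W) (V \<odot> W) X (?c X)"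
      unfolding transpose_def
      by (rule run_eq[OF _ _ _ good_Cons[OF cml_rule[OF X] good_Cons[OF correspondsD(6)[OF cW X]
          good_Cons[OF natural_right[OF i_box[OF X] W] good_Cons[OF natural_right[OF dual_boxes(2)[OF X]
          W] good_Cons[OF snake(1)[OF X] good_Cons[OF correspondsD(6)[OF cV X] good_Nil]]]]]],
        where ms = "[Rw 0 0 2, SL 2, SL 3, Rw 1 4 1, Rw 2 1 1, SL 0, SR 4, SR 3, Rw 3 1 2, SR 3, SR 2, SR
          1, SR 4, SR 3, Rw 4 2 2, Rw 5 2 0, SL 1]"])
        (rule reprs repr_box | simp)+
  qed
  ultimately show ?thesis by (auto simp: corresponds_def)
qed

lemma corresponds_unit_obj: "corresponds \<I> (cnt B) (\<lambda>X. \<iota> X)"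
proof -
  have "cnt B \<cdot> (\<iota> \<I> \<otimes> i X) = transpose X \<I> \<I> X (\<iota> X)" if X [simp]: "X \<in> Obj C" for X
  proof -
    have e: "ev C X \<in> Hom C (dual C X \<odot> X) \<I>" using is_dual[OF X] by (auto simp: is_left_dual_def)
    have id: "\<iota> (dual C X \<odot> X) \<in> Hom C (dual C X \<odot> X) (dual C X \<odot> X)" by (intro id_hom tens_obj) auto
    show ?thesis
      by (simp add: transpose_def cnt_B braid_unit_left unit_arr_left unit_arr_right tens_id
          HomD(1)[OF i_hom] HomD(1)[OF e] comp_id_right[OF e] comp_id_left[OF id])
  qed
  then show ?thesis
    using cnt_B(1) by (auto simp: corresponds_def unit_obj_left unit_obj_right intro: id_hom)
qed

text \<open>The unit laws later allow an action of the bosonization to be split into an action of H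
  and one of A. The unit object is drawn as no strand at all, so \<open>i\<close> at the unit object
  becomes a box with a single input.\<close>

lemma unt_B: "unt B \<in> Hom C \<I> A" "mlt B \<cdot> (unt B \<otimes> \<iota> A) = \<iota> A" "mlt B \<cdot> (\<iota> A \<otimes> unt B) = \<iota> A"
proof -
  note b = left_dual_boxes[of "[]", simplified, OF is_dual[OF unit_obj]]
  note sI = snake_rules(1)[of "[]", simplified, OF is_dual[OF unit_obj]]
  have coI: "is_box ([], coev C \<I>, [dual C \<I>])" and ib: "is_box ([dual C \<I>], i \<I>, [A])"
    using b i_hom[OF unit_obj] by (auto simp: is_box_def unit_obj unit_obj_left unit_obj_right)
  note [simp] = dual_obj[OF unit_obj]
  have unt: "unt B = i \<I> \<cdot> coev C \<I>" by (simp add: aut_bialg_def dual_unit_def)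
  have ub: "repr (unt B) [] [(0, [], coev C \<I>, [dual C \<I>]), (0, [dual C \<I>], i \<I>, [A])] [A]"
    unfolding unt by (rule repr_cong) (rule reprs coI ib repr_box | simp)+
  from repr_hom[OF this] show u: "unt B \<in> Hom C \<I> A" by simp
  have A: "\<iota> A \<in> Hom C A A" by (rule id_hom) simp
  have hom: "mlt B \<cdot> (unt B \<otimes> \<iota> A) \<in> Hom C A A" "mlt B \<cdot> (\<iota> A \<otimes> unt B) \<in> Hom C A A"
    using comp_hom[OF tens_hom[OF u A] mlt_B(1)] comp_hom[OF tens_hom[OF A u] mlt_B(1)]
    by (simp_all add: unit_obj_left unit_obj_right)
  have eqs: "(mlt B \<cdot> (unt B \<otimes> \<iota> A)) \<cdot> i X = i X" "(mlt B \<cdot> (\<iota> A \<otimes> unt B)) \<cdot> i X = i X"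
    if X [simp]: "X \<in> Obj C" for X
  proof -
    note KX = dual_obj[OF X] and sX = snake[OF X]
    have dtL: "is_box ([dual C X, dual C \<I>], dual_tens C \<I> X, [dual C X])"
      and dtR: "is_box ([dual C \<I>, dual C X], dual_tens C X \<I>, [dual C X])"
      using dual_tens_box[OF unit_obj X] dual_tens_box[OF X unit_obj] by (simp_all add: unit_obj_left unit_obj_right)
    note [reprs] = coI ib mlt_box i_box
      dual_boxes[OF X] dtL dtR b(2)
    have "mlt B \<cdot> (i \<I> \<otimes> i X) = i X \<cdot> (dual_tens C \<I> X \<otimes> \<iota> X) \<cdot> (\<Phi> (dual C \<I>) (dual C X) \<otimes> \<iota> X)"
      using mlt_B(2)[OF unit_obj X]
      by (simp add: mult_family_def unit_obj_left unit_obj_right unit_arr_left HomD(1)[OF id_hom])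
    then have mr: "good ([dual C \<I>, dual C X, X],
      [(0, [dual C \<I>], i \<I>, [A]), (1, i_bx X), (0, [A, A], mlt B, [A])],
      [(0, crossing (dual C \<I>) (dual C X)), (0, [dual C X, dual C \<I>], dual_tens C \<I> X, [dual C X]), (0, i_bx X)])"
      by (rule goodI) (rule reprs repr_box | simp)+
    have "dual_tens C \<I> X = ((ev C X \<cdot> (\<iota> (dual C X) \<otimes> ev C \<I> \<otimes> \<iota> X)) \<otimes> \<iota> (dual C X)) \<cdot>
      (\<iota> (dual C X) \<otimes> \<iota> (dual C \<I>) \<otimes> coev C X)"
      by (simp add: dual_tens_def unit_obj_left)
    then have dt: "good ([dual C X, dual C \<I>], [(0, [dual C X, dual C \<I>], dual_tens C \<I> X, [dual C X])],
      [(2, coev_box X), (1, [dual C \<I>], ev C \<I>, []), (0, ev_box X)])"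
      by (rule goodI) (rule reprs repr_box | simp)+
    show "(mlt B \<cdot> (unt B \<otimes> \<iota> A)) \<cdot> i X = i X"
      unfolding unt
      by (rule run_eq[OF _ _ _ good_Cons[OF mr good_Cons[OF dt good_Cons[OF sX(2) good_Cons[OF
          natural_left[OF coI KX] good_Cons[OF sI good_Nil]]]]],
        where ms = "[SL 0, SL 1, Rw 0 1 0, Rw 1 2 0, SL 2, Rw 2 3 0, Rw 3 0 0, Rw 4 0 1]"])
        (rule reprs repr_box | simp)+
    have "mlt B \<cdot> (i X \<otimes> i \<I>) = i X \<cdot> (dual_tens C X \<I> \<otimes> \<iota> X) \<cdot> \<Phi> (dual C X \<odot> X) (dual C \<I>)"
      using mlt_B(2)[OF X unit_obj] braid_hom[OF tens_obj[OF KX X] dual_obj[OF unit_obj]]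
      by (simp add: mult_family_def unit_obj_left unit_obj_right unit_arr_right HomD(1)[OF id_hom] HomD(1))
    then have mr: "good ([dual C X, X, dual C \<I>],
      [(0, i_bx X), (1, [dual C \<I>], i \<I>, [A]), (0, [A, A], mlt B, [A])],
      [(1, crossing X (dual C \<I>)), (0, crossing (dual C X) (dual C \<I>)),
       (0, [dual C \<I>, dual C X], dual_tens C X \<I>, [dual C X]), (0, i_bx X)])"
      by (rule goodI) (rule reprs repr_box | simp)+
    have evX: "ev C X \<in> Hom C (dual C X \<odot> X) \<I>" using is_dual[OF X] by (auto simp: is_left_dual_def)
    have "dual_tens C X \<I> = ((ev C \<I> \<cdot> (\<iota> (dual C \<I>) \<otimes> ev C X)) \<otimes> \<iota> (dual C X)) \<cdot>
      (\<iota> (dual C \<I>) \<otimes> \<iota> (dual C X) \<otimes> coev C X)"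
      by (simp add: dual_tens_def unit_obj_right unit_arr_right HomD(1)[OF evX])
    then have dt: "good ([dual C \<I>, dual C X], [(0, [dual C \<I>, dual C X], dual_tens C X \<I>, [dual C X])],
      [(2, coev_box X), (1, ev_box X), (0, [dual C \<I>], ev C \<I>, [])])"
      by (rule goodI) (rule reprs repr_box | simp)+
    show "(mlt B \<cdot> (\<iota> A \<otimes> unt B)) \<cdot> i X = i X"
      unfolding unt
      by (rule run_eq[OF _ _ _ good_Cons[OF mr good_Cons[OF natural_right[OF coI X] good_Cons[OF dt
          good_Cons[OF sX(2) good_Cons[OF natural_right[OF coI KX] good_Cons[OF sI good_Nil]]]]]],
        where ms = "[SR 0, Rw 0 1 0, Rw 1 0 1, Rw 2 2 0, SL 3, SL 2, Rw 3 3 0, Rw 4 0 0, SR 1, SR 0, Rw 5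
          1 0]"])
        (rule reprs repr_box | simp)+
  qed
  show "mlt B \<cdot> (unt B \<otimes> \<iota> A) = \<iota> A" "mlt B \<cdot> (\<iota> A \<otimes> unt B) = \<iota> A"
    by (rule coend_unique[of A], use hom A in simp_all, use eqs comp_id_left[OF i_hom] in simp)+
qed

end

subsection \<open>Categories of structured objects and strict isomorphisms\<close>

text \<open>Modules and objects of the center are both objects of a strict monoidal category with
  additional structure, and their arrows are arrows with a property \<open>P\<close>. The laws for
  arrows are inherited, so each instance only has to provide closure of \<open>P\<close> and the
  laws of \<open>T\<close> for structures.\<close>

locale structured_objects = strict_monoidal_category C
  for C :: "('o, 'a, 'z) moncat_scheme" (structure) +
  fixes S :: "'s set" and U :: "'s \<Rightarrow> 'o" and P :: "'s \<Rightarrow> 'a \<Rightarrow> 's \<Rightarrow> bool"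
    and T :: "'s \<Rightarrow> 's \<Rightarrow> 's" and E :: 's
  assumes U_obj: "X \<in> S \<Longrightarrow> U X \<in> Obj C"
    and P_id: "X \<in> S \<Longrightarrow> P X (\<iota> (U X)) X"
    and P_comp: "X \<in> S \<Longrightarrow> Y \<in> S \<Longrightarrow> Z \<in> S \<Longrightarrow> f \<in> Hom C (U X) (U Y) \<Longrightarrow> g \<in> Hom C (U Y) (U Z) \<Longrightarrow>
      P X f Y \<Longrightarrow> P Y g Z \<Longrightarrow> P X (g \<cdot> f) Z"
    and T_closed: "X \<in> S \<Longrightarrow> Y \<in> S \<Longrightarrow> T X Y \<in> S"
    and U_T: "X \<in> S \<Longrightarrow> Y \<in> S \<Longrightarrow> U (T X Y) = U X \<odot> U Y"
    and P_T: "X \<in> S \<Longrightarrow> Y \<in> S \<Longrightarrow> X' \<in> S \<Longrightarrow> Y' \<in> S \<Longrightarrow> f \<in> Hom C (U X) (U Y) \<Longrightarrow> g \<in> Hom C (U X') (U Y') \<Longrightarrow>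
      P X f Y \<Longrightarrow> P X' g Y' \<Longrightarrow> P (T X X') (f \<otimes> g) (T Y Y')"
    and T_assoc: "X \<in> S \<Longrightarrow> Y \<in> S \<Longrightarrow> Z \<in> S \<Longrightarrow> T (T X Y) Z = T X (T Y Z)"
    and E_closed: "E \<in> S" and U_E: "U E = \<I>"
    and T_E: "X \<in> S \<Longrightarrow> T E X = X" "X \<in> S \<Longrightarrow> T X E = X"
begin

definition structured :: "('s, 's \<times> 'a \<times> 's) moncat" where
  "structured = \<lparr>
     Obj = S,
     Arr = {(X, f, Y). X \<in> S \<and> Y \<in> S \<and> f \<in> Hom C (U X) (U Y) \<and> P X f Y},
     Dom = (\<lambda>(X, f, Y). X),
     Cod = (\<lambda>(X, f, Y). Y),
     Id = (\<lambda>X. (X, \<iota> (U X), X)),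
     Comp = (\<lambda>(Y, g, Z) (X, f, W). (X, g \<cdot> f, Z)),
     TensO = T,
     Tens = (\<lambda>(X, f, Y) (X', g, Y'). (T X X', f \<otimes> g, T Y Y')),
     UnitO = E \<rparr>"

lemma structured_hom: "F \<in> Hom structured X Y \<longleftrightarrow>
    (\<exists>f. F = (X, f, Y) \<and> X \<in> S \<and> Y \<in> S \<and> f \<in> Hom C (U X) (U Y) \<and> P X f Y)"
  by (auto simp: Hom_def structured_def)

lemma structured_arr: "F \<in> Arr structured \<longleftrightarrow>
    (\<exists>X f Y. F = (X, f, Y) \<and> X \<in> S \<and> Y \<in> S \<and> f \<in> Hom C (U X) (U Y) \<and> P X f Y)"
  by (auto simp: structured_def)

lemma structured_simps:
  "Obj structured = S" "\<I>\<^bsub>structured\<^esub> = E" "\<iota>\<^bsub>structured\<^esub> X = (X, \<iota> (U X), X)" "X \<odot>\<^bsub>structured\<^esub> Y = T X Y"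
  "(Y, g, Z) \<cdot>\<^bsub>structured\<^esub> (X, f, W) = (X, g \<cdot> f, Z)" "(X, f, Y) \<otimes>\<^bsub>structured\<^esub> (X', f', Y') = (T X X', f \<otimes> f', T Y Y')"
  by (simp_all add: structured_def)

theorem strict_monoidal_structured: "strict_monoidal_category structured"
  by unfold_locales
    (auto simp: structured_hom structured_arr structured_simps U_obj U_T U_E T_assoc T_E id_hom tens_id interchange
      comp_id_left comp_id_right comp_assoc assoc_arr unit_arr_left unit_arr_right HomD(1)
      intro: P_id P_comp P_T T_closed E_closed comp_hom tens_hom,
      auto simp: structured_def)

end

text \<open>\<open>B\<close> is a mere signature here: every condition beyond bijectivity is indexed
  by objects and arrows of \<open>A\<close>, so the laws of \<open>B\<close> can be derived from
  those of \<open>A\<close>.\<close>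

definition strict_iso ::
  "('o, 'a, 'y) moncat_scheme \<Rightarrow> ('p, 'b, 'z) moncat_scheme \<Rightarrow> ('o \<Rightarrow> 'p) \<Rightarrow> ('a \<Rightarrow> 'b) \<Rightarrow> bool" where
  "strict_iso A B Fo Fa \<longleftrightarrow> bij_betw Fo (Obj A) (Obj B) \<and> bij_betw Fa (Arr A) (Arr B) \<and>
     (\<forall>f \<in> Arr A. Dom B (Fa f) = Fo (Dom A f) \<and> Cod B (Fa f) = Fo (Cod A f)) \<and>
     (\<forall>X \<in> Obj A. Fa (\<iota>\<^bsub>A\<^esub> X) = \<iota>\<^bsub>B\<^esub> (Fo X)) \<and>
     (\<forall>f \<in> Arr A. \<forall>g \<in> Arr A. Dom A g = Cod A f \<longrightarrow> Fa (g \<cdot>\<^bsub>A\<^esub> f) = Fa g \<cdot>\<^bsub>B\<^esub> Fa f) \<and>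
     (\<forall>X \<in> Obj A. \<forall>Y \<in> Obj A. Fo (X \<odot>\<^bsub>A\<^esub> Y) = Fo X \<odot>\<^bsub>B\<^esub> Fo Y) \<and>
     (\<forall>f \<in> Arr A. \<forall>g \<in> Arr A. Fa (f \<otimes>\<^bsub>A\<^esub> g) = Fa f \<otimes>\<^bsub>B\<^esub> Fa g) \<and> Fo \<I>\<^bsub>A\<^esub> = \<I>\<^bsub>B\<^esub>"

lemma strict_iso_trans:
  assumes "strict_monoidal_category A" and F: "strict_iso A B Fo Fa" and G: "strict_iso B D Go Ga"
  shows "strict_iso A D (Go \<circ> Fo) (Ga \<circ> Fa)"
proof -
  interpret A: strict_monoidal_category A by fact
  have "Fo X \<in> Obj B" if "X \<in> Obj A" for X using F that by (auto simp: strict_iso_def bij_betw_def)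
  moreover have "Fa f \<in> Arr B" if "f \<in> Arr A" for f using F that by (auto simp: strict_iso_def bij_betw_def)
  ultimately show ?thesis
    using F G A.unit_obj unfolding strict_iso_def by (auto intro: bij_betw_trans)
qed

locale strict_isomorphism = A: strict_monoidal_category A
  for A :: "('o, 'a, 'y) moncat_scheme" and B :: "('p, 'b, 'z) moncat_scheme"
    and Fo :: "'o \<Rightarrow> 'p" and Fa :: "'a \<Rightarrow> 'b" +
  assumes iso: "strict_iso A B Fo Fa"
begin

lemma F_obj: "X \<in> Obj A \<Longrightarrow> Fo X \<in> Obj B" and F_arr: "f \<in> Arr A \<Longrightarrow> Fa f \<in> Arr B"
  and F_hom: "f \<in> Hom A X Y \<Longrightarrow> Fa f \<in> Hom B (Fo X) (Fo Y)"
  and F_id: "X \<in> Obj A \<Longrightarrow> \<iota>\<^bsub>B\<^esub> (Fo X) = Fa (\<iota>\<^bsub>A\<^esub> X)"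
  and F_comp: "f \<in> Hom A X Y \<Longrightarrow> g \<in> Hom A Y Z \<Longrightarrow> Fa g \<cdot>\<^bsub>B\<^esub> Fa f = Fa (g \<cdot>\<^bsub>A\<^esub> f)"
  and F_tensO: "X \<in> Obj A \<Longrightarrow> Y \<in> Obj A \<Longrightarrow> Fo X \<odot>\<^bsub>B\<^esub> Fo Y = Fo (X \<odot>\<^bsub>A\<^esub> Y)"
  and F_tens: "f \<in> Arr A \<Longrightarrow> g \<in> Arr A \<Longrightarrow> Fa f \<otimes>\<^bsub>B\<^esub> Fa g = Fa (f \<otimes>\<^bsub>A\<^esub> g)"
  and F_unit: "\<I>\<^bsub>B\<^esub> = Fo \<I>\<^bsub>A\<^esub>"
  using iso by (auto simp: strict_iso_def bij_betw_def Hom_def)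

lemma obj_cases: "Y \<in> Obj B \<Longrightarrow> (\<And>X. X \<in> Obj A \<Longrightarrow> Y = Fo X \<Longrightarrow> thesis) \<Longrightarrow> thesis"
  and arr_cases: "g \<in> Arr B \<Longrightarrow> (\<And>f. f \<in> Arr A \<Longrightarrow> g = Fa f \<Longrightarrow> thesis) \<Longrightarrow> thesis"
  using iso unfolding strict_iso_def bij_betw_def by blast+

lemma F_inj: "Fo X = Fo Y \<Longrightarrow> X \<in> Obj A \<Longrightarrow> Y \<in> Obj A \<Longrightarrow> X = Y"
  using iso by (auto simp: strict_iso_def bij_betw_def dest: inj_onD)

text \<open>Injectivity on objects ensures that an arrow between images comes from an arrow with the
  prescribed source and target; hence composable arrows have composable preimages.\<close>

lemma hom_cases:
  assumes g: "g \<in> Hom B (Fo X) (Fo Y)" and X: "X \<in> Obj A" and Y: "Y \<in> Obj A"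
  obtains f where "f \<in> Hom A X Y" "g = Fa f"
proof -
  from g obtain f where f: "f \<in> Arr A" "g = Fa f" by (auto simp: Hom_def elim: arr_cases)
  then have "Fo (Dom A f) = Fo X" "Fo (Cod A f) = Fo Y" using iso g by (auto simp: strict_iso_def Hom_def)
  then have "Dom A f = X" "Cod A f = Y"
    using F_inj A.dom_obj[OF f(1)] A.cod_obj[OF f(1)] X Y by simp_all
  with f that show thesis by (auto simp: Hom_def)
qed

lemma dom_cod: "g \<in> Arr B \<Longrightarrow> Dom B g \<in> Obj B \<and> Cod B g \<in> Obj B"
  using F_hom A.dom_obj A.cod_obj F_obj by (elim arr_cases) (force simp: Hom_def)

lemma hom_cases':
  assumes g: "g \<in> Hom B X Y"
  obtains X' Y' f where "f \<in> Hom A X' Y'" "g = Fa f" "X = Fo X'" "Y = Fo Y'" "X' \<in> Obj A" "Y' \<in> Obj A"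
proof -
  have "X \<in> Obj B" "Y \<in> Obj B" using g dom_cod by (auto simp: Hom_def)
  then obtain X' Y' where XY: "X' \<in> Obj A" "Y' \<in> Obj A" "X = Fo X'" "Y = Fo Y'" by (metis obj_cases)
  with g obtain f where "f \<in> Hom A X' Y'" "g = Fa f" by (metis hom_cases)
  with XY that show thesis by blast
qed

lemma category_image: "category B"
proof
  fix f g h X Y Z W
  show "f \<in> Arr B \<Longrightarrow> Dom B f \<in> Obj B" "f \<in> Arr B \<Longrightarrow> Cod B f \<in> Obj B" using dom_cod by auto
  show "X \<in> Obj B \<Longrightarrow> \<iota>\<^bsub>B\<^esub> X \<in> Hom B X X"
    by (elim obj_cases) (auto simp: F_id intro: F_hom A.id_hom)
  show "f \<cdot>\<^bsub>B\<^esub> \<iota>\<^bsub>B\<^esub> X = f" "\<iota>\<^bsub>B\<^esub> Y \<cdot>\<^bsub>B\<^esub> f = f" if f: "f \<in> Hom B X Y"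
  proof -
    from f obtain X' Y' f' where f': "f' \<in> Hom A X' Y'" "f = Fa f'" "X = Fo X'" "Y = Fo Y'" "X' \<in> Obj A" "Y' \<in> Obj A"
      by (rule hom_cases')
    then show "f \<cdot>\<^bsub>B\<^esub> \<iota>\<^bsub>B\<^esub> X = f" "\<iota>\<^bsub>B\<^esub> Y \<cdot>\<^bsub>B\<^esub> f = f"
      using F_comp[OF A.id_hom f'(1)] F_comp[OF f'(1) A.id_hom] A.comp_id_right[OF f'(1)] A.comp_id_left[OF f'(1)]
      by (simp_all add: F_id)
  qed
  assume f: "f \<in> Hom B X Y" and g: "g \<in> Hom B Y Z"
  from f obtain X' Y' f' where f': "f' \<in> Hom A X' Y'" "f = Fa f'" "X = Fo X'" "Y = Fo Y'" "Y' \<in> Obj A"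
    by (rule hom_cases')
  have "Z \<in> Obj B" using g dom_cod by (auto simp: Hom_def)
  then obtain Z' where Z': "Z' \<in> Obj A" "Z = Fo Z'" by (rule obj_cases)
  from g f' Z' obtain g' where g': "g' \<in> Hom A Y' Z'" "g = Fa g'" by (metis hom_cases)
  show "g \<cdot>\<^bsub>B\<^esub> f \<in> Hom B X Z"
    using f' g' Z' A.comp_hom[OF f'(1) g'(1)] by (auto simp: F_comp intro: F_hom)
  assume h: "h \<in> Hom B Z W"
  then have "W \<in> Obj B" using dom_cod by (auto simp: Hom_def)
  then obtain W' where W': "W' \<in> Obj A" "W = Fo W'" by (rule obj_cases)
  from h Z' W' obtain h' where h': "h' \<in> Hom A Z' W'" "h = Fa h'" by (metis hom_cases)
  show "(h \<cdot>\<^bsub>B\<^esub> g) \<cdot>\<^bsub>B\<^esub> f = h \<cdot>\<^bsub>B\<^esub> (g \<cdot>\<^bsub>B\<^esub> f)"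
    using A.comp_hom[OF f'(1) g'(1)] A.comp_hom[OF g'(1) h'(1)] f' g' h' A.comp_assoc by (simp add: F_comp)
qed

sublocale B: category B by (rule category_image)

lemma F_hom_tens: "f \<in> Hom A X Y \<Longrightarrow> g \<in> Hom A X' Y' \<Longrightarrow> Fa f \<otimes>\<^bsub>B\<^esub> Fa g = Fa (f \<otimes>\<^bsub>A\<^esub> g)"
  by (rule F_tens) (auto dest: A.HomD)

lemma monoidal_image: "strict_monoidal_category B"
proof
  show "\<I>\<^bsub>B\<^esub> \<in> Obj B" by (simp add: F_unit F_obj A.unit_obj)
  fix X Y Z X' Y' Z' f g f' g' h
  show tensO: "X \<odot>\<^bsub>B\<^esub> Y \<in> Obj B" if "X \<in> Obj B" "Y \<in> Obj B" for X Y
    using that by (elim obj_cases) (auto simp: F_tensO intro: F_obj A.tens_obj)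
  show "f \<otimes>\<^bsub>B\<^esub> g \<in> Hom B (X \<odot>\<^bsub>B\<^esub> X') (Y \<odot>\<^bsub>B\<^esub> Y')" if "f \<in> Hom B X Y" "g \<in> Hom B X' Y'"
    using that by (elim hom_cases') (auto simp: F_tensO F_hom_tens intro: F_hom A.tens_hom)
  show "\<iota>\<^bsub>B\<^esub> X \<otimes>\<^bsub>B\<^esub> \<iota>\<^bsub>B\<^esub> Y = \<iota>\<^bsub>B\<^esub> (X \<odot>\<^bsub>B\<^esub> Y)" if "X \<in> Obj B" "Y \<in> Obj B"
    using that by (elim obj_cases)
      (auto simp: F_tensO F_id F_hom_tens[OF A.id_hom A.id_hom] A.tens_id A.tens_obj)
  show "(X \<odot>\<^bsub>B\<^esub> Y) \<odot>\<^bsub>B\<^esub> Z = X \<odot>\<^bsub>B\<^esub> Y \<odot>\<^bsub>B\<^esub> Z" if "X \<in> Obj B" "Y \<in> Obj B" "Z \<in> Obj B"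
    using that by (elim obj_cases) (auto simp: F_tensO A.assoc_obj A.tens_obj)
  show "\<I>\<^bsub>B\<^esub> \<odot>\<^bsub>B\<^esub> X = X" "X \<odot>\<^bsub>B\<^esub> \<I>\<^bsub>B\<^esub> = X" if "X \<in> Obj B"
    using that by (elim obj_cases, simp add: F_tensO F_unit A.unit_obj A.unit_obj_left A.unit_obj_right)+
  have arr_tens: "f \<otimes>\<^bsub>A\<^esub> g \<in> Arr A" if "f \<in> Arr A" "g \<in> Arr A" for f g
    using A.tens_hom[of f "Dom A f" "Cod A f" g "Dom A g" "Cod A g"] that by (simp add: Hom_def)
  show "(f \<otimes>\<^bsub>B\<^esub> g) \<otimes>\<^bsub>B\<^esub> h = f \<otimes>\<^bsub>B\<^esub> g \<otimes>\<^bsub>B\<^esub> h" if "f \<in> Arr B" "g \<in> Arr B" "h \<in> Arr B"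
    using that by (elim arr_cases) (auto simp: F_tens A.assoc_arr arr_tens)
  have "\<iota>\<^bsub>A\<^esub> \<I>\<^bsub>A\<^esub> \<in> Arr A" using A.id_hom[OF A.unit_obj] by (auto dest: A.HomD)
  then show "\<iota>\<^bsub>B\<^esub> \<I>\<^bsub>B\<^esub> \<otimes>\<^bsub>B\<^esub> f = f" "f \<otimes>\<^bsub>B\<^esub> \<iota>\<^bsub>B\<^esub> \<I>\<^bsub>B\<^esub> = f" if "f \<in> Arr B"
    using that by (elim arr_cases, simp add: F_unit F_id F_tens A.unit_obj A.unit_arr_left A.unit_arr_right)+
  assume "f \<in> Hom B X Y" and g: "g \<in> Hom B Y Z" and "f' \<in> Hom B X' Y'" and g': "g' \<in> Hom B Y' Z'"
  then obtain X\<^sub>0 Y\<^sub>0 f\<^sub>0 X\<^sub>1 Y\<^sub>1 f\<^sub>1 where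
    0: "f\<^sub>0 \<in> Hom A X\<^sub>0 Y\<^sub>0" "f = Fa f\<^sub>0" "X = Fo X\<^sub>0" "Y = Fo Y\<^sub>0" "Y\<^sub>0 \<in> Obj A" and
    1: "f\<^sub>1 \<in> Hom A X\<^sub>1 Y\<^sub>1" "f' = Fa f\<^sub>1" "X' = Fo X\<^sub>1" "Y' = Fo Y\<^sub>1" "Y\<^sub>1 \<in> Obj A"
    by (metis hom_cases')
  from g g' obtain Z\<^sub>0 Z\<^sub>1 where Z: "Z\<^sub>0 \<in> Obj A" "Z = Fo Z\<^sub>0" "Z\<^sub>1 \<in> Obj A" "Z' = Fo Z\<^sub>1"
    by (metis obj_cases B.HomD(5))
  from g g' Z 0 1 obtain g\<^sub>0 g\<^sub>1 where
    2: "g\<^sub>0 \<in> Hom A Y\<^sub>0 Z\<^sub>0" "g = Fa g\<^sub>0" "g\<^sub>1 \<in> Hom A Y\<^sub>1 Z\<^sub>1" "g' = Fa g\<^sub>1"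
    by (metis hom_cases)
  note c = A.comp_hom[OF 0(1) 2(1)] A.comp_hom[OF 1(1) 2(3)]
  show "(g \<cdot>\<^bsub>B\<^esub> f) \<otimes>\<^bsub>B\<^esub> (g' \<cdot>\<^bsub>B\<^esub> f') = (g \<otimes>\<^bsub>B\<^esub> g') \<cdot>\<^bsub>B\<^esub> (f \<otimes>\<^bsub>B\<^esub> f')"
    unfolding 0(2) 1(2) 2(2) 2(4) F_comp[OF 0(1) 2(1)] F_comp[OF 1(1) 2(3)] F_hom_tens[OF c]
      F_hom_tens[OF 0(1) 1(1)] F_hom_tens[OF 2(1,3)] F_comp[OF A.tens_hom[OF 0(1) 1(1)] A.tens_hom[OF 2(1,3)]]
    by (simp only: A.interchange[OF 0(1) 2(1) 1(1) 2(3)])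
qed

sublocale B: strict_monoidal_category B by (rule monoidal_image)

lemma id_iso: "X \<in> Obj B \<Longrightarrow> is_iso B (\<iota>\<^bsub>B\<^esub> X)"
  using B.id_hom[of X] B.comp_id_left[OF B.id_hom] by (auto simp: is_iso_def Hom_def intro!: bexI[of _ "\<iota>\<^bsub>B\<^esub> X"])

lemma F_functor: "cat_functor A B Fo Fa"
  by unfold_locales (auto simp: F_obj F_hom F_id F_comp)

theorem monoidally_isomorphic: "monoidally_isomorphic A B"
proof -
  interpret F: cat_functor A B Fo Fa by (rule F_functor)
  \<comment> \<open>Tensor products are preserved strictly, so identities serve as coherence
    morphisms.\<close>
  define F2 where "F2 X Y = \<iota>\<^bsub>B\<^esub> (Fo (X \<odot>\<^bsub>A\<^esub> Y))" for X Y
  have tens_id: "\<iota>\<^bsub>B\<^esub> (Fo X) \<otimes>\<^bsub>B\<^esub> \<iota>\<^bsub>B\<^esub> (Fo Y) = \<iota>\<^bsub>B\<^esub> (Fo (X \<odot>\<^bsub>A\<^esub> Y))"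
    if "X \<in> Obj A" "Y \<in> Obj A" for X Y
    using that by (simp add: B.tens_id F_obj F_tensO)
  have id2: "\<iota>\<^bsub>B\<^esub> (Fo X) \<cdot>\<^bsub>B\<^esub> \<iota>\<^bsub>B\<^esub> (Fo X) = \<iota>\<^bsub>B\<^esub> (Fo X)" if "X \<in> Obj A" for X
    by (rule B.comp_id_left[OF B.id_hom[OF F_obj[OF that]]])
  have "monoidal_functor A B Fo Fa F2 (\<iota>\<^bsub>B\<^esub> \<I>\<^bsub>B\<^esub>)"
  proof
    fix X Y Z X' Y' f g
    show "is_iso B (\<iota>\<^bsub>B\<^esub> \<I>\<^bsub>B\<^esub>)" "\<iota>\<^bsub>B\<^esub> \<I>\<^bsub>B\<^esub> \<in> Hom B \<I>\<^bsub>B\<^esub> (Fo \<I>\<^bsub>A\<^esub>)"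
      using id_iso B.unit_obj B.id_hom by (simp_all flip: F_unit)
    assume X: "X \<in> Obj A"
    show "F2 \<I>\<^bsub>A\<^esub> X \<cdot>\<^bsub>B\<^esub> (\<iota>\<^bsub>B\<^esub> \<I>\<^bsub>B\<^esub> \<otimes>\<^bsub>B\<^esub> \<iota>\<^bsub>B\<^esub> (Fo X)) = \<iota>\<^bsub>B\<^esub> (Fo X)"
      "F2 X \<I>\<^bsub>A\<^esub> \<cdot>\<^bsub>B\<^esub> (\<iota>\<^bsub>B\<^esub> (Fo X) \<otimes>\<^bsub>B\<^esub> \<iota>\<^bsub>B\<^esub> \<I>\<^bsub>B\<^esub>) = \<iota>\<^bsub>B\<^esub> (Fo X)"
      using X by (simp_all add: F2_def F_unit tens_id A.unit_obj A.unit_obj_left A.unit_obj_right id2)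
    assume Y: "Y \<in> Obj A"
    show "F2 X Y \<in> Hom B (Fo X \<odot>\<^bsub>B\<^esub> Fo Y) (Fo (X \<odot>\<^bsub>A\<^esub> Y))" "is_iso B (F2 X Y)"
      using X Y by (simp_all add: F2_def F_tensO B.id_hom F_obj A.tens_obj id_iso)
    assume Z: "Z \<in> Obj A"
    show "F2 (X \<odot>\<^bsub>A\<^esub> Y) Z \<cdot>\<^bsub>B\<^esub> (F2 X Y \<otimes>\<^bsub>B\<^esub> \<iota>\<^bsub>B\<^esub> (Fo Z)) =
       F2 X (Y \<odot>\<^bsub>A\<^esub> Z) \<cdot>\<^bsub>B\<^esub> (\<iota>\<^bsub>B\<^esub> (Fo X) \<otimes>\<^bsub>B\<^esub> F2 Y Z)"
      using X Y Z by (simp add: F2_def tens_id A.tens_obj A.assoc_obj)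
  next
    fix X Y X' Y' f g assume f: "f \<in> Hom A X X'" and g: "g \<in> Hom A Y Y'"
    note fg = A.tens_hom[OF f g]
    show "F2 X' Y' \<cdot>\<^bsub>B\<^esub> (Fa f \<otimes>\<^bsub>B\<^esub> Fa g) = Fa (f \<otimes>\<^bsub>A\<^esub> g) \<cdot>\<^bsub>B\<^esub> F2 X Y"
      using B.comp_id_left[OF F_hom[OF fg]] B.comp_id_right[OF F_hom[OF fg]]
      by (simp add: F2_def F_hom_tens[OF f g])
  qed
  moreover have "iso_functor A B Fo Fa"
  proof -
    let ?Go = "inv_into (Obj A) Fo" and ?Ga = "inv_into (Arr A) Fa"
    have G: "?Go (Fo X) = X" "?Ga (Fa f) = f" if "X \<in> Obj A" "f \<in> Arr A" for X f
      using iso that by (auto simp: strict_iso_def bij_betw_def)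
    have GO: "?Go (Fo X) = X" if "X \<in> Obj A" for X using iso that by (auto simp: strict_iso_def bij_betw_def)
    have GA: "?Ga (Fa f) = f" if "f \<in> Arr A" for f using iso that by (auto simp: strict_iso_def bij_betw_def)
    have GA': "?Ga (Fa f) = f" if "f \<in> Hom A X Y" for f X Y using GA that by (auto dest: A.HomD)
    have "cat_functor B A ?Go ?Ga"
    proof
      fix X Y Z f g
      show "X \<in> Obj B \<Longrightarrow> ?Go X \<in> Obj A" by (elim obj_cases) (simp add: GO)
      show "f \<in> Hom B X Y \<Longrightarrow> ?Ga f \<in> Hom A (?Go X) (?Go Y)"
        by (elim hom_cases') (simp add: GO GA')
      show "X \<in> Obj B \<Longrightarrow> ?Ga (\<iota>\<^bsub>B\<^esub> X) = \<iota>\<^bsub>A\<^esub> (?Go X)"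
        by (elim obj_cases) (simp add: GO F_id GA'[OF A.id_hom])
      assume f: "f \<in> Hom B X Y" and g: "g \<in> Hom B Y Z"
      then obtain X\<^sub>0 Y\<^sub>0 f\<^sub>0 where
        0: "f\<^sub>0 \<in> Hom A X\<^sub>0 Y\<^sub>0" "f = Fa f\<^sub>0" "X = Fo X\<^sub>0" "Y = Fo Y\<^sub>0" "Y\<^sub>0 \<in> Obj A"
        by (metis hom_cases')
      from g obtain Z\<^sub>0 where Z: "Z\<^sub>0 \<in> Obj A" "Z = Fo Z\<^sub>0" by (metis obj_cases B.HomD(5))
      from g Z 0 obtain g\<^sub>0 where 2: "g\<^sub>0 \<in> Hom A Y\<^sub>0 Z\<^sub>0" "g = Fa g\<^sub>0" by (metis hom_cases)
      show "?Ga (g \<cdot>\<^bsub>B\<^esub> f) = ?Ga g \<cdot>\<^bsub>A\<^esub> ?Ga f"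
        unfolding 0(2) 2(2) F_comp[OF 0(1) 2(1)] GA'[OF 0(1)] GA'[OF 2(1)]
        by (rule GA'[OF A.comp_hom[OF 0(1) 2(1)]])
    qed
    moreover have "\<forall>Y \<in> Obj B. Fo (?Go Y) = Y" by (auto elim!: obj_cases simp: GO)
    moreover have "\<forall>g \<in> Arr B. Fa (?Ga g) = g" by (auto elim!: arr_cases simp: GA)
    ultimately show ?thesis
      unfolding iso_functor_def using F_functor GO GA by blast
  qed
  ultimately show ?thesis unfolding monoidally_isomorphic_def by blast
qed

end

subsection \<open>The left center\<close>

context category
begin

lemma iso_comp:
  assumes f: "f \<in> Hom C X Y" "is_iso C f" and g: "g \<in> Hom C Y Z" "is_iso C g"
  shows "is_iso C (g \<cdot> f)"
proof -
  from f obtain f' where f': "f' \<in> Hom C Y X" "f' \<cdot> f = \<iota> X" "f \<cdot> f' = \<iota> Y"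
    by (auto simp: is_iso_def Hom_def)
  from g obtain g' where g': "g' \<in> Hom C Z Y" "g' \<cdot> g = \<iota> Y" "g \<cdot> g' = \<iota> Z"
    by (auto simp: is_iso_def Hom_def)
  have "(f' \<cdot> g') \<cdot> (g \<cdot> f) = f' \<cdot> (g' \<cdot> g) \<cdot> f"
    using comp_assoc[OF comp_hom[OF f(1) g(1)] g'(1) f'(1)] comp_assoc[OF f(1) g(1) g'(1)] by simp
  also have "\<dots> = \<iota> X" using f' g' comp_id_left[OF f(1)] by simp
  finally have 1: "(f' \<cdot> g') \<cdot> (g \<cdot> f) = \<iota> X" .
  have "(g \<cdot> f) \<cdot> (f' \<cdot> g') = g \<cdot> (f \<cdot> f') \<cdot> g'"
    using comp_assoc[OF comp_hom[OF g'(1) f'(1)] f(1) g(1)] comp_assoc[OF g'(1) f'(1) f(1)] by simp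
  also have "\<dots> = \<iota> Z" using f' g' comp_id_left[OF g'(1)] by simp
  finally have 2: "(g \<cdot> f) \<cdot> (f' \<cdot> g') = \<iota> Z" .
  show ?thesis
    using 1 2 comp_hom[OF g'(1) f'(1)] HomD[OF comp_hom[OF f(1) g(1)]] by (auto simp: is_iso_def)
qed

end

context strict_monoidal_category
begin

lemma iso_tens:
  assumes f: "f \<in> Hom C X Y" "is_iso C f" and g: "g \<in> Hom C X' Y'" "is_iso C g"
  shows "is_iso C (f \<otimes> g)"
proof -
  from f obtain f' where f': "f' \<in> Hom C Y X" "f' \<cdot> f = \<iota> X" "f \<cdot> f' = \<iota> Y"
    by (auto simp: is_iso_def Hom_def)
  from g obtain g' where g': "g' \<in> Hom C Y' X'" "g' \<cdot> g = \<iota> X'" "g \<cdot> g' = \<iota> Y'"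
    by (auto simp: is_iso_def Hom_def)
  have "X \<in> Obj C" "X' \<in> Obj C" "Y \<in> Obj C" "Y' \<in> Obj C" using f g by (auto dest: HomD)
  then have "(f' \<otimes> g') \<cdot> (f \<otimes> g) = \<iota> (X \<odot> X')" "(f \<otimes> g) \<cdot> (f' \<otimes> g') = \<iota> (Y \<odot> Y')"
    using interchange[OF f(1) f'(1) g(1) g'(1)] interchange[OF f'(1) f(1) g'(1) g(1)] f' g'
    by (simp_all add: tens_id)
  then show ?thesis
    using tens_hom[OF f'(1) g'(1)] HomD[OF tens_hom[OF f(1) g(1)]] by (auto simp: is_iso_def)
qed

lemma id_is_iso: "X \<in> Obj C \<Longrightarrow> is_iso C (\<iota> X)"
  using id_hom[of X] comp_id_left[OF id_hom] by (auto simp: is_iso_def Hom_def intro!: bexI[of _ "\<iota> X"])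

lemma half_braidingD:
  assumes "is_half_braiding C V c"
  shows "V \<in> Obj C" "c \<in> extensional (Obj C)"
    "X \<in> Obj C \<Longrightarrow> c X \<in> Hom C (V \<odot> X) (X \<odot> V)" "X \<in> Obj C \<Longrightarrow> is_iso C (c X)"
    "f \<in> Hom C X Y \<Longrightarrow> c Y \<cdot> (\<iota> V \<otimes> f) = (f \<otimes> \<iota> V) \<cdot> c X"
    "X \<in> Obj C \<Longrightarrow> Y \<in> Obj C \<Longrightarrow> c (X \<odot> Y) = (\<iota> X \<otimes> c Y) \<cdot> (c X \<otimes> \<iota> Y)"
  using assms HomD(4,5)[of f X Y] by (auto simp: is_half_braiding_def)

lemma half_braiding_box:
  "is_half_braiding C V c \<Longrightarrow> X \<in> Obj C \<Longrightarrow> is_box ([V, X], c X, [X, V])"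
  using half_braidingD(1,3) by (auto simp: is_box_def)

lemma half_braiding_natural:
  assumes hb: "is_half_braiding C V c" and f: "f \<in> Hom C X Y"
  shows "good ([V, X], [(1, [X], f, [Y]), (0, [V, Y], c Y, [Y, V])], [(0, [V, X], c X, [X, V]), (0, [X], f, [Y])])"
proof -
  have o [simp]: "X \<in> Obj C" "Y \<in> Obj C" "V \<in> Obj C" using f half_braidingD(1)[OF hb] by (auto dest: HomD)
  have fb: "is_box ([X], f, [Y])" using f by (simp add: is_box_def)
  note [reprs] = half_braiding_box[OF hb o(1)] half_braiding_box[OF hb o(2)] fb
  show ?thesis by (rule goodI[OF half_braidingD(5)[OF hb f]]) (rule reprs repr_box | simp)+
qed

lemma center_tens_repr:
  assumes c: "is_half_braiding C V c" and d: "is_half_braiding C W d" and X [simp]: "X \<in> Obj C"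
  shows "repr ((c X \<otimes> \<iota> W) \<cdot> (\<iota> V \<otimes> d X)) [V, W, X]
    [(1, [W, X], d X, [X, W]), (0, [V, X], c X, [X, V])] [X, V, W]"
proof -
  note [simp] = half_braidingD(1)[OF c] half_braidingD(1)[OF d]
  show ?thesis
    by (rule repr_cong)
      (rule reprs half_braiding_box[OF c X] half_braiding_box[OF d X] repr_box | simp)+
qed

lemma half_braiding_tens:
  assumes c: "is_half_braiding C V c" and d: "is_half_braiding C W d"
  shows "is_half_braiding C (V \<odot> W) (\<lambda>X \<in> Obj C. (c X \<otimes> \<iota> W) \<cdot> (\<iota> V \<otimes> d X))"
proof -
  note V [simp] = half_braidingD(1)[OF c] and W [simp] = half_braidingD(1)[OF d]
  have VW: "V \<odot> W \<in> Obj C" by (intro tens_obj) auto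
  have hom: "(c X \<otimes> \<iota> W) \<cdot> (\<iota> V \<otimes> d X) \<in> Hom C ((V \<odot> W) \<odot> X) (X \<odot> V \<odot> W)"
    if [simp]: "X \<in> Obj C" for X
    using repr_hom[OF center_tens_repr[OF c d that]] by (simp add: assoc_obj)
  have iso: "is_iso C ((c X \<otimes> \<iota> W) \<cdot> (\<iota> V \<otimes> d X))" if X: "X \<in> Obj C" for X
  proof (rule iso_comp)
    show "\<iota> V \<otimes> d X \<in> Hom C (V \<odot> W \<odot> X) (V \<odot> X \<odot> W)" "c X \<otimes> \<iota> W \<in> Hom C (V \<odot> X \<odot> W) ((X \<odot> V) \<odot> W)"
      using tens_hom[OF id_hom[OF V] half_braidingD(3)[OF d X]] tens_hom[OF half_braidingD(3)[OF c X] id_hom[OF W]] X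
      by (simp_all add: assoc_obj)
    show "is_iso C (\<iota> V \<otimes> d X)" "is_iso C (c X \<otimes> \<iota> W)"
      by (rule iso_tens[OF id_hom[OF V] id_is_iso[OF V] half_braidingD(3,4)[OF d X]])
        (rule iso_tens[OF half_braidingD(3,4)[OF c X] id_hom[OF W] id_is_iso[OF W]])
  qed
  have nat: "((c Y \<otimes> \<iota> W) \<cdot> (\<iota> V \<otimes> d Y)) \<cdot> (\<iota> (V \<odot> W) \<otimes> f) =
      (f \<otimes> \<iota> (V \<odot> W)) \<cdot> (c X \<otimes> \<iota> W) \<cdot> (\<iota> V \<otimes> d X)" if f: "f \<in> Hom C X Y" for X Y f
  proof -
    have o [simp]: "X \<in> Obj C" "Y \<in> Obj C" using f by (auto dest: HomD)
    have fb: "is_box ([X], f, [Y])" using f by (simp add: is_box_def)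
    note [reprs] = half_braiding_box[OF c o(1)] half_braiding_box[OF c o(2)]
      half_braiding_box[OF d o(1)] half_braiding_box[OF d o(2)] fb
    note nc = half_braiding_natural[OF c f] and nd = half_braiding_natural[OF d f]
    show ?thesis
      by (rule run_eq[OF _ _ _ good_Cons[OF nd good_Cons[OF nc good_Nil]],
        where ms = "[Rw 0 0 1, Rw 1 1 0]"])
        (rule reprs repr_box | simp)+
  qed
  have hex: "(c (X \<odot> Y) \<otimes> \<iota> W) \<cdot> (\<iota> V \<otimes> d (X \<odot> Y)) =
      (\<iota> X \<otimes> ((c Y \<otimes> \<iota> W) \<cdot> (\<iota> V \<otimes> d Y))) \<cdot> (((c X \<otimes> \<iota> W) \<cdot> (\<iota> V \<otimes> d X)) \<otimes> \<iota> Y)"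
    if X [simp]: "X \<in> Obj C" and Y [simp]: "Y \<in> Obj C" for X Y
  proof -
    note [reprs] = half_braiding_box[OF c X] half_braiding_box[OF c Y]
      half_braiding_box[OF d X] half_braiding_box[OF d Y]
    show ?thesis
      \<comment> \<open>Once both hexagons are expanded, only \<open>c X\<close> and
        \<open>d Y\<close> have to be interchanged.\<close>
      unfolding half_braidingD(6)[OF c X Y] half_braidingD(6)[OF d X Y]
      by (rule run_eq[OF _ _ _ good_Nil,
        where ms = "[SL 1]"])
        (rule reprs repr_box | simp)+
  qed
  show ?thesis
    unfolding is_half_braiding_def
    using VW hom iso nat hex tens_obj by auto
qed

lemma strict_monoidal_left_center: "strict_monoidal_category (left_center C)"
proof -
  note tens = half_braiding_tens
  have unit: "is_half_braiding C \<I> (\<lambda>X \<in> Obj C. \<iota> X)"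
    unfolding is_half_braiding_def
    by (auto simp: unit_obj unit_obj_left unit_obj_right unit_arr_left unit_arr_right id_is_iso id_hom
        tens_id tens_obj comp_id_left[OF id_hom] comp_id_left comp_id_right HomD(1))
  have tens_arr: "(\<iota> X \<otimes> f \<otimes> g) \<cdot> (c X \<otimes> \<iota> W) \<cdot> (\<iota> V \<otimes> d X) =
      ((c' X \<otimes> \<iota> W') \<cdot> (\<iota> V' \<otimes> d' X)) \<cdot> ((f \<otimes> g) \<otimes> \<iota> X)"
    if c: "is_half_braiding C V c" and c': "is_half_braiding C V' c'"
      and d: "is_half_braiding C W d" and d': "is_half_braiding C W' d'"
      and f: "f \<in> Hom C V V'" "(\<iota> X \<otimes> f) \<cdot> c X = c' X \<cdot> (f \<otimes> \<iota> X)"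
      and g: "g \<in> Hom C W W'" "(\<iota> X \<otimes> g) \<cdot> d X = d' X \<cdot> (g \<otimes> \<iota> X)" and X [simp]: "X \<in> Obj C"
    for V c V' c' W d W' d' f g X
  proof -
    note [simp] = half_braidingD(1)[OF c] half_braidingD(1)[OF d] half_braidingD(1)[OF c'] half_braidingD(1)[OF d']
    have b: "is_box ([V], f, [V'])" "is_box ([W], g, [W'])" using f g by (auto simp: is_box_def)
    note [reprs] = b half_braiding_box[OF c X] half_braiding_box[OF c' X]
      half_braiding_box[OF d X] half_braiding_box[OF d' X]
    have nc: "good ([V, X], [(0, [V, X], c X, [X, V]), (1, [V], f, [V'])], [(0, [V], f, [V']), (0, [V', X], c' X, [X, V'])])"
      by (rule goodI[OF f(2)]) (rule reprs repr_box | simp)+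
    have nd: "good ([W, X], [(0, [W, X], d X, [X, W]), (1, [W], g, [W'])], [(0, [W], g, [W']), (0, [W', X], d' X, [X, W'])])"
      by (rule goodI[OF g(2)]) (rule reprs repr_box | simp)+
    show ?thesis
      by (rule run_eq[OF _ _ _ good_Cons[OF nd good_Cons[OF nc good_Nil]],
        where ms = "[SR 2, SR 1, Rw 0 0 1, Rw 1 2 0, SL 1, SL 0]"])
        (rule reprs repr_box | simp)+
  qed
  have assoc: "(((c X \<otimes> \<iota> W) \<cdot> (\<iota> V \<otimes> d X)) \<otimes> \<iota> U) \<cdot> (\<iota> (V \<odot> W) \<otimes> e X) =
      (c X \<otimes> \<iota> (W \<odot> U)) \<cdot> (\<iota> V \<otimes> ((d X \<otimes> \<iota> U) \<cdot> (\<iota> W \<otimes> e X)))"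
    if c: "is_half_braiding C V c" and d: "is_half_braiding C W d" and e: "is_half_braiding C U e"
      and X [simp]: "X \<in> Obj C" for V c W d U e X
  proof -
    note [simp] = half_braidingD(1)[OF c] half_braidingD(1)[OF d] half_braidingD(1)[OF e]
    note [reprs] = half_braiding_box[OF c X] half_braiding_box[OF d X]
      half_braiding_box[OF e X]
    show ?thesis
      by (rule run_eq[OF _ _ _ good_Nil, where ms = "[]"]) (rule reprs repr_box | simp)+
  qed
  let ?S = "{(V, c). is_half_braiding C V c}" and ?E = "(\<I>, \<lambda>X \<in> Obj C. \<iota> X)"
  let ?P = "\<lambda>(V, c) f (W, d). \<forall>X \<in> Obj C. (\<iota> X \<otimes> f) \<cdot> c X = d X \<cdot> (f \<otimes> \<iota> X)"
  interpret Z: structured_objects C ?S fst ?P "center_tens C" ?E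
  proof
    fix P Q assume PS: "P \<in> ?S" and QS: "Q \<in> ?S"
    then obtain V c W d where P: "P = (V, c)" "is_half_braiding C V c" and Q: "Q = (W, d)" "is_half_braiding C W d"
      by auto
    note V [simp] = half_braidingD(1)[OF P(2)]
    show "fst P \<in> Obj C" by (simp add: P)
    show "?P P (\<iota> (fst P)) P"
      using half_braidingD(3)[OF P(2)]
      by (auto simp: P tens_id comp_id_left[OF half_braidingD(3)[OF P(2)]] comp_id_right[OF half_braidingD(3)[OF P(2)]])
    show "center_tens C P Q \<in> ?S" "fst (center_tens C P Q) = fst P \<odot> fst Q"
      using half_braiding_tens[OF P(2) Q(2)] by (simp_all add: P Q center_tens_def)
    have "(\<iota> X \<otimes> \<iota> V) \<cdot> (\<iota> \<I> \<otimes> c X) = c X" "(c X \<otimes> \<iota> \<I>) \<cdot> (\<iota> V \<otimes> \<iota> X) = c X" if X: "X \<in> Obj C" for X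
      using half_braidingD(3)[OF P(2) X] X
      by (auto simp: unit_arr_left unit_arr_right tens_id HomD(1) comp_id_left comp_id_right)
    \<comment> \<open>As \<open>c\<close> is extensional, its restriction is \<open>c\<close>
      itself, and the unit laws become equations between families.\<close>
    then have "(\<lambda>X \<in> Obj C. (\<iota> X \<otimes> \<iota> V) \<cdot> (\<iota> \<I> \<otimes> c X)) = restrict c (Obj C)"
      "(\<lambda>X \<in> Obj C. (c X \<otimes> \<iota> \<I>) \<cdot> (\<iota> V \<otimes> \<iota> X)) = restrict c (Obj C)"
      by (auto intro!: restrict_ext)
    then show "center_tens C ?E P = P" "center_tens C P ?E = P"
      using extensional_restrict[OF half_braidingD(2)[OF P(2)]]
      by (simp_all add: P center_tens_def unit_obj_left unit_obj_right cong: restrict_cong)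
    fix S assume SS: "S \<in> ?S"
    then obtain U' e where S: "S = (U', e)" "is_half_braiding C U' e" by auto
    show "center_tens C (center_tens C P Q) S = center_tens C P (center_tens C Q S)"
      using half_braidingD(1)[OF P(2)] half_braidingD(1)[OF Q(2)] half_braidingD(1)[OF S(2)]
        assoc[OF P(2) Q(2) S(2)]
      by (auto simp: P Q S center_tens_def assoc_obj intro!: restrict_ext)
    fix f g
    show "?P P (g \<cdot> f) S" if f: "f \<in> Hom C (fst P) (fst Q)" "?P P f Q" and g: "g \<in> Hom C (fst Q) (fst S)" "?P Q g S"
      unfolding P(1) S(1) prod.case
    proof
      fix X assume X: "X \<in> Obj C"
      note iX = id_hom[OF X] and cX = half_braidingD(3)[OF P(2) X] and dX = half_braidingD(3)[OF Q(2) X]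
        and eX = half_braidingD(3)[OF S(2) X]
      have fg: "f \<in> Hom C V W" "g \<in> Hom C W U'" using f g by (simp_all add: P Q S)
      have "\<iota> X \<otimes> (g \<cdot> f) = (\<iota> X \<otimes> g) \<cdot> (\<iota> X \<otimes> f)" "(g \<cdot> f) \<otimes> \<iota> X = (g \<otimes> \<iota> X) \<cdot> (f \<otimes> \<iota> X)"
        using interchange[OF iX iX fg] interchange[OF fg iX iX] comp_id_left[OF iX] by simp_all
      then show "(\<iota> X \<otimes> (g \<cdot> f)) \<cdot> c X = e X \<cdot> ((g \<cdot> f) \<otimes> \<iota> X)"
        using comp_assoc[OF cX tens_hom[OF iX fg(1)] tens_hom[OF iX fg(2)]]
          comp_assoc[OF tens_hom[OF fg(1) iX] dX tens_hom[OF iX fg(2)]]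
          comp_assoc[OF tens_hom[OF fg(1) iX] tens_hom[OF fg(2) iX] eX] f(2) g(2) X by (simp add: P Q S)
    qed
    fix P' assume "P' \<in> ?S"
    then obtain V' c' where P': "P' = (V', c')" "is_half_braiding C V' c'" by auto
    show "?P (center_tens C P S) (f \<otimes> g) (center_tens C Q P')"
      if "f \<in> Hom C (fst P) (fst Q)" "g \<in> Hom C (fst S) (fst P')" "?P P f Q" "?P S g P'"
      using that tens_arr[OF P(2) Q(2) S(2) P'(2), of f _ g] by (auto simp: P Q S P' center_tens_def)
  qed (use unit in auto)
  have "left_center C = Z.structured"
    unfolding left_center_def Z.structured_def by (auto simp: fun_eq_iff)
  then show ?thesis using Z.strict_monoidal_structured by simp
qed

end

section \<open>Comparison of the left center with the modules over the coend\<close>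

context braided_coend
begin

text \<open>\<open>corresponds_mult\<close> exchanges the hexagon with associativity, and the unit
  of the coend acts by the component at the unit object. What remains is a difference of axioms: a
  half-braiding is invertible but not explicitly trivial at the unit object, while a module provides
  the unit condition but no inverses.\<close>

lemma half_braiding_iff:
  assumes corr: "corresponds V a c" and ext: "c \<in> extensional (Obj C)"
  shows "is_half_braiding C V c \<longleftrightarrow> is_rmodule C B (V, a)"
proof -
  note V = correspondsD(2)[OF corr] and a = correspondsD(1)[OF corr]
  have c: "c X \<in> Hom C (V \<odot> X) (X \<odot> V)" if "X \<in> Obj C" for X
    using corr that by (auto simp: corresponds_def)
  have A: "\<iota> A \<in> Hom C A A" and idV: "\<iota> V \<in> Hom C V V" using V by (auto intro: id_hom)
  have unit: "a \<cdot> (\<iota> V \<otimes> unt B) = c \<I>"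
    using corresponds_unit[OF corr] by (simp add: aut_bialg_def)
  have hom: "a \<cdot> (a \<otimes> \<iota> A) \<in> Hom C (V \<odot> A \<odot> A) V" "a \<cdot> (\<iota> V \<otimes> mlt B) \<in> Hom C (V \<odot> A \<odot> A) V"
    using comp_hom[OF tens_hom[OF a A] a] comp_hom[OF tens_hom[OF idV mlt_B(1)] a] V
    by (simp_all add: assoc_obj)
  show ?thesis
  proof
    assume hb: "is_half_braiding C V c"
    have "a \<cdot> (a \<otimes> \<iota> A) = a \<cdot> (\<iota> V \<otimes> mlt B)"
      by (rule coend_unique2[OF V V hom])
        (simp add: corresponds_mult[OF corr] half_braidingD(6)[OF hb])
    \<comment> \<open>The hexagon at two unit objects makes this component idempotent, and it is
      invertible.\<close>
    moreover have "c \<I> = \<iota> V"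
    proof (rule idem_iso_id)
      show cI: "c \<I> \<in> Hom C V V"
        using half_braidingD(3)[OF hb unit_obj] V by (simp add: unit_obj_left unit_obj_right)
      show "is_iso C (c \<I>)" by (rule half_braidingD(4)[OF hb unit_obj])
      show "c \<I> \<cdot> c \<I> = c \<I>"
        using half_braidingD(6)[OF hb unit_obj unit_obj] HomD(1)[OF cI]
        by (simp add: unit_obj unit_obj_left unit_arr_left unit_arr_right)
    qed
    ultimately show "is_rmodule C B (V, a)" using unit V a by (simp add: is_rmodule_def)
  next
    assume mod: "is_rmodule C B (V, a)"
    have "c \<I> = \<iota> V" using mod unit by (simp add: is_rmodule_def)
    moreover have hex: "c (X \<odot> Y) = (\<iota> X \<otimes> c Y) \<cdot> (c X \<otimes> \<iota> Y)" if X [simp]: "X \<in> Obj C" and Y [simp]: "Y \<in> Obj C" for X Y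
    proof (rule transpose2_inj)
      note [simp] = V
      note [reprs] = correspondsD(4)[OF corr X] correspondsD(4)[OF corr Y]
      show "is_box ([V, X, Y], c (X \<odot> Y), [X, Y, V])"
        using c[OF tens_obj[OF X Y]] V by (simp add: is_box_def assoc_obj)
      have "repr ((\<iota> X \<otimes> c Y) \<cdot> (c X \<otimes> \<iota> Y)) [V, X, Y]
        [(0, [V, X], c X, [X, V]), (1, [V, Y], c Y, [Y, V])] [X, Y, V]"
        by (rule repr_cong) (rule reprs repr_box | simp)+
      then show "is_box ([V, X, Y], (\<iota> X \<otimes> c Y) \<cdot> (c X \<otimes> \<iota> Y), [X, Y, V])" by (rule repr_is_box)
      show "transpose2 V V X Y (c (X \<odot> Y)) = transpose2 V V X Y ((\<iota> X \<otimes> c Y) \<cdot> (c X \<otimes> \<iota> Y))"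
        using mod corresponds_mult[OF corr X Y] by (simp add: is_rmodule_def)
    qed
    ultimately have "is_iso C (c X)" if X: "X \<in> Obj C" for X
    proof -
      \<comment> \<open>The inverse at X comes from the component at an object \<open>Y\<close> that
        has X as its left dual.\<close>
      obtain Y e d where "Y \<in> Obj C" "is_left_dual C Y X e d" using rigid X unfolding rigid_def by blast
      with half_braiding_iso[of V c, OF V c corresponds_natural[OF corr] hex _ X] \<open>c \<I> = \<iota> V\<close> show ?thesis
        by blast
    qed
    then show "is_half_braiding C V c"
      using V ext c corresponds_natural[OF corr] hex by (auto simp: is_half_braiding_def)
  qed
qed

definition action :: "'o \<times> ('o \<Rightarrow> 'a) \<Rightarrow> 'a" where
  "action P = (THE a. corresponds (fst P) a (snd P))"

lemma action_eq: "corresponds V a c \<Longrightarrow> action (V, c) = a"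
  unfolding action_def by (rule the_equality) (auto intro: corresponds_unique)

lemma action: "is_half_braiding C V c \<Longrightarrow> corresponds V (action (V, c)) c"
proof -
  assume hb: "is_half_braiding C V c"
  then obtain a where "corresponds V a c"
    using corresponds_exists[OF half_braidingD(1)[OF hb] half_braidingD(3)[OF hb] half_braidingD(5)[OF hb]] by blast
  then show ?thesis using action_eq by simp
qed

lemma corresponds_cong:
  assumes "\<And>X. X \<in> Obj C \<Longrightarrow> c X = c' X"
  shows "corresponds V a c = corresponds V a c'"
  using assms by (simp add: corresponds_def)

definition center_obj :: "'o \<times> ('o \<Rightarrow> 'a) \<Rightarrow> 'o \<times> 'a" where
  "center_obj P = (fst P, action P)"

definition center_arr ::
  "('o \<times> ('o \<Rightarrow> 'a)) \<times> 'a \<times> ('o \<times> ('o \<Rightarrow> 'a)) \<Rightarrow> ('o \<times> 'a) \<times> 'a \<times> ('o \<times> 'a)" where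
  "center_arr = (\<lambda>(P, f, Q). (center_obj P, f, center_obj Q))"

lemma center_obj_bij: "bij_betw center_obj (Obj (left_center C)) (Obj (rmod C \<Phi> B))"
  unfolding bij_betw_def
proof (intro conjI inj_onI subset_antisym subsetI)
  fix P Q assume "P \<in> Obj (left_center C)" "Q \<in> Obj (left_center C)" and eq: "center_obj P = center_obj Q"
  then obtain V c d where P: "P = (V, c)" "Q = (V, d)" and c: "is_half_braiding C V c" and d: "is_half_braiding C V d"
    by (auto simp: left_center_def center_obj_def)
  have "c X = d X" for X
    using corresponds_unique'[OF action[OF c], of d X] action[OF d] eq
      half_braidingD(2)[OF c] half_braidingD(2)[OF d]
    by (cases "X \<in> Obj C") (auto simp: P center_obj_def extensional_def)
  then show "P = Q" using P by auto
next
  fix M assume "M \<in> center_obj ` Obj (left_center C)"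
  then obtain V c where M: "M = center_obj (V, c)" and c: "is_half_braiding C V c"
    by (auto simp: left_center_def)
  then show "M \<in> Obj (rmod C \<Phi> B)"
    using half_braiding_iff[OF action[OF c] half_braidingD(2)[OF c]]
    by (simp add: rmod_def center_obj_def)
next
  fix M assume "M \<in> Obj (rmod C \<Phi> B)"
  then obtain V a where M: "M = (V, a)" and mod: "is_rmodule C B (V, a)" by (cases M) (auto simp: rmod_def)
  have "V \<in> Obj C" "a \<in> Hom C (V \<odot> A) V" using mod by (auto simp: is_rmodule_def)
  then obtain c where "corresponds V a c" using corresponds_exists' by blast
  \<comment> \<open>Restriction makes the family extensional and does not affect the
    correspondence.\<close>
  then have corr: "corresponds V a (restrict c (Obj C))" using corresponds_cong[of "restrict c (Obj C)" c] by simp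
  then have "is_half_braiding C V (restrict c (Obj C))" using half_braiding_iff mod by simp
  then show "M \<in> center_obj ` Obj (left_center C)"
    using action_eq[OF corr] M by (auto simp: left_center_def center_obj_def image_iff intro!: exI)
qed

lemma center_obj_tens:
  assumes c: "is_half_braiding C V c" and d: "is_half_braiding C W d"
  shows "center_obj (center_tens C (V, c) (W, d)) = rmodule_tens C \<Phi> B (center_obj (V, c)) (center_obj (W, d))"
proof -
  have "corresponds (V \<odot> W) ((action (V, c) \<otimes> action (W, d)) \<cdot> (\<iota> V \<otimes> \<Phi> W A \<otimes> \<iota> A) \<cdot> (\<iota> V \<otimes> \<iota> W \<otimes> cml B))
    (\<lambda>X \<in> Obj C. (c X \<otimes> \<iota> W) \<cdot> (\<iota> V \<otimes> d X))"
    using corresponds_tens[OF action[OF c] action[OF d]]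
    by (subst corresponds_cong[where c' = "\<lambda>X. (c X \<otimes> \<iota> W) \<cdot> (\<iota> V \<otimes> d X)"]) auto
  from action_eq[OF this] show ?thesis by (simp add: center_tens_def rmodule_tens_def center_obj_def)
qed

theorem center_strict_iso: "strict_iso (left_center C) (rmod C \<Phi> B) center_obj center_arr"
proof -
  let ?Z = "left_center C" and ?M = "rmod C \<Phi> B"
  have arrZ: "((V, c), f, (W, d)) \<in> Arr ?Z \<longleftrightarrow> is_half_braiding C V c \<and> is_half_braiding C W d \<and>
    f \<in> Hom C V W \<and> (\<forall>X \<in> Obj C. (\<iota> X \<otimes> f) \<cdot> c X = d X \<cdot> (f \<otimes> \<iota> X))" for V c f W d
    by (simp add: left_center_def)
  have arr_iff: "((V, c), f, (W, d)) \<in> Arr ?Z \<longleftrightarrow> center_arr ((V, c), f, (W, d)) \<in> Arr ?M"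
    if c: "is_half_braiding C V c" and d: "is_half_braiding C W d" for V c f W d
  proof -
    have "center_obj (V, c) \<in> Obj ?M" "center_obj (W, d) \<in> Obj ?M"
      using center_obj_bij c d by (auto simp: bij_betw_def left_center_def)
    then show ?thesis
      using corresponds_arr[OF action[OF c] action[OF d], of f] c d
      by (auto simp: arrZ) (auto simp: rmod_def center_arr_def center_obj_def)
  qed
  have "bij_betw center_arr (Arr ?Z) (Arr ?M)"
    unfolding bij_betw_def
  proof (intro conjI inj_onI subset_antisym subsetI)
    fix F G assume F: "F \<in> Arr ?Z" and G: "G \<in> Arr ?Z" and eq: "center_arr F = center_arr G"
    then have "fst F \<in> Obj ?Z" "fst G \<in> Obj ?Z" "snd (snd F) \<in> Obj ?Z" "snd (snd G) \<in> Obj ?Z"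
      by (auto simp: left_center_def)
    moreover have "center_obj (fst F) = center_obj (fst G)" "fst (snd F) = fst (snd G)"
      "center_obj (snd (snd F)) = center_obj (snd (snd G))"
      using eq by (auto simp: center_arr_def split: prod.splits)
    ultimately have "fst F = fst G" "snd (snd F) = snd (snd G)"
      using center_obj_bij by (auto simp: bij_betw_def dest: inj_onD)
    with \<open>fst (snd F) = fst (snd G)\<close> show "F = G" by (simp add: prod_eq_iff)
  next
    fix K assume "K \<in> center_arr ` Arr ?Z"
    then obtain V c f W d where K: "K = center_arr ((V, c), f, (W, d))" and F: "((V, c), f, (W, d)) \<in> Arr ?Z"
      by (auto simp: left_center_def)
    then show "K \<in> Arr ?M" using arr_iff[of V c W d f] arrZ by simp
  next
    fix K assume K: "K \<in> Arr ?M"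
    then obtain M f N where M: "K = (M, f, N)" "M \<in> Obj ?M" "N \<in> Obj ?M" by (auto simp: rmod_def)
    then have "M \<in> center_obj ` Obj ?Z" "N \<in> center_obj ` Obj ?Z"
      using center_obj_bij by (simp_all add: bij_betw_def)
    then obtain V c W d where *: "M = center_obj (V, c)" "N = center_obj (W, d)"
      "is_half_braiding C V c" "is_half_braiding C W d" by (auto simp: left_center_def)
    then have "((V, c), f, (W, d)) \<in> Arr ?Z" using arr_iff[OF *(3,4)] K M by (simp add: center_arr_def)
    then show "K \<in> center_arr ` Arr ?Z"
      using M * by (auto simp: center_arr_def intro!: image_eqI)
  qed
  moreover have "center_obj (\<I>, \<lambda>X \<in> Obj C. \<iota> X) = (\<I>, cnt B)"
  proof -
    have "corresponds \<I> (cnt B) (\<lambda>X \<in> Obj C. \<iota> X)"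
      using corresponds_unit_obj by (subst corresponds_cong[where c' = \<iota>]) auto
    from action_eq[OF this] show ?thesis by (simp add: center_obj_def)
  qed
  ultimately show ?thesis
    unfolding strict_iso_def using center_obj_bij
    by (auto simp: center_obj_tens left_center_def rmod_def center_arr_def)
      (auto simp: center_obj_def)
qed

end

subsection \<open>Modules over a bialgebra\<close>

locale bialgebra_modules = braided_monoidal_category C \<Phi>
  for C :: "('o, 'a, 'z) moncat_scheme" (structure) and \<Phi> +
  fixes H :: "('o, 'a, 'x) bialg_scheme"
  assumes bialg: "bialgebra C \<Phi> H"
begin

abbreviation "h \<equiv> carr H"
abbreviation "m_bx \<equiv> ([h, h], mlt H, [h])"
abbreviation "u_bx \<equiv> ([], unt H, [h])"
abbreviation "d_bx \<equiv> ([h], cml H, [h, h])"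
abbreviation "e_bx \<equiv> ([h], cnt H, [])"

lemma h_obj [simp]: "h \<in> Obj C"
  using bialg by (simp add: bialgebra_def algebra_def)

lemma m_box: "is_box m_bx" and d_box: "is_box d_bx" and u_box: "is_box u_bx" and e_box: "is_box e_bx"
  using bialg by (auto simp: bialgebra_def algebra_def coalgebra_def is_box_def)

lemmas H_boxes = m_box d_box u_box e_box
lemmas [reprs] = repr_idI

lemma bialg_rule: "good ([h, h], [(0, m_bx), (0, d_bx)],
  [(0, d_bx), (2, d_bx), (1, crossing h h), (0, m_bx), (1, m_bx)])"
proof -
  have "cml H \<cdot> mlt H = tens_mlt C \<Phi> h (mlt H) h (mlt H) \<cdot> (cml H \<otimes> cml H)"
    using bialg by (simp add: bialgebra_def)
  then show ?thesis unfolding tens_mlt_def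
    by (rule goodI) (rule reprs H_boxes repr_box | simp)+
qed

lemma mlt_assoc_rule: "good ([h, h, h], [(0, m_bx), (0, m_bx)], [(1, m_bx), (0, m_bx)])"
proof -
  have "mlt H \<cdot> (mlt H \<otimes> \<iota> h) = mlt H \<cdot> (\<iota> h \<otimes> mlt H)"
    using bialg by (simp add: bialgebra_def algebra_def)
  then show ?thesis by (rule goodI) (rule reprs H_boxes repr_box | simp)+
qed

lemma coassoc_rule: "good ([h], [(0, d_bx), (0, d_bx)], [(0, d_bx), (1, d_bx)])"
proof -
  have "(cml H \<otimes> \<iota> h) \<cdot> cml H = (\<iota> h \<otimes> cml H) \<cdot> cml H"
    using bialg by (simp add: bialgebra_def coalgebra_def)
  then show ?thesis by (rule goodI) (rule reprs H_boxes repr_box | simp)+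
qed

lemma unit_rule: "good ([h], [(0, u_bx), (0, m_bx)], [])" "good ([h], [(1, u_bx), (0, m_bx)], [])"
proof -
  have eq: "mlt H \<cdot> (unt H \<otimes> \<iota> h) = \<iota> h" "mlt H \<cdot> (\<iota> h \<otimes> unt H) = \<iota> h"
    using bialg by (simp_all add: bialgebra_def algebra_def)
  show "good ([h], [(0, u_bx), (0, m_bx)], [])" by (rule goodI[OF eq(1)]) (rule reprs H_boxes repr_box | simp)+
  show "good ([h], [(1, u_bx), (0, m_bx)], [])" by (rule goodI[OF eq(2)]) (rule reprs H_boxes repr_box | simp)+
qed

lemma counit_rule: "good ([h], [(0, d_bx), (0, e_bx)], [])" "good ([h], [(0, d_bx), (1, e_bx)], [])"
proof -
  have eq: "(cnt H \<otimes> \<iota> h) \<cdot> cml H = \<iota> h" "(\<iota> h \<otimes> cnt H) \<cdot> cml H = \<iota> h"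
    using bialg by (simp_all add: bialgebra_def coalgebra_def)
  show "good ([h], [(0, d_bx), (0, e_bx)], [])" by (rule goodI[OF eq(1)]) (rule reprs H_boxes repr_box | simp)+
  show "good ([h], [(0, d_bx), (1, e_bx)], [])" by (rule goodI[OF eq(2)]) (rule reprs H_boxes repr_box | simp)+
qed

lemma cml_unt_rule: "good ([], [(0, u_bx), (0, d_bx)], [(0, u_bx), (1, u_bx)])"
proof -
  have "cml H \<cdot> unt H = unt H \<otimes> unt H" using bialg by (simp add: bialgebra_def)
  then show ?thesis by (rule goodI) (rule reprs H_boxes repr_box | simp)+
qed

lemma cnt_mlt_rule: "good ([h, h], [(0, m_bx), (0, e_bx)], [(0, e_bx), (0, e_bx)])"
proof -
  have "cnt H \<cdot> mlt H = cnt H \<otimes> cnt H" using bialg by (simp add: bialgebra_def)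
  then show ?thesis by (rule goodI) (rule reprs H_boxes repr_box | simp)+
qed

lemma cnt_unt_rule: "good ([], [(0, u_bx), (0, e_bx)], [])"
proof -
  have "cnt H \<cdot> unt H = \<iota> \<I>" using bialg by (simp add: bialgebra_def)
  then show ?thesis by (rule goodI) (rule reprs H_boxes repr_box | simp)+
qed

lemma rmodule_rules:
  assumes "is_rmodule C H (M, \<nu>)"
  shows "M \<in> Obj C" "is_box ([M, h], \<nu>, [M])"
    "good ([M, h, h], [(0, [M, h], \<nu>, [M]), (0, [M, h], \<nu>, [M])], [(1, m_bx), (0, [M, h], \<nu>, [M])])"
    "good ([M], [(1, u_bx), (0, [M, h], \<nu>, [M])], [])"
proof -
  show M [simp]: "M \<in> Obj C" and b: "is_box ([M, h], \<nu>, [M])"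
    using assms by (auto simp: is_box_def is_rmodule_def)
  have eq: "\<nu> \<cdot> (\<nu> \<otimes> \<iota> h) = \<nu> \<cdot> (\<iota> M \<otimes> mlt H)" "\<nu> \<cdot> (\<iota> M \<otimes> unt H) = \<iota> M"
    using assms by (auto simp: is_rmodule_def)
  show "good ([M, h, h], [(0, [M, h], \<nu>, [M]), (0, [M, h], \<nu>, [M])], [(1, m_bx), (0, [M, h], \<nu>, [M])])"
    by (rule goodI[OF eq(1)]) (rule reprs H_boxes b repr_box | simp)+
  show "good ([M], [(1, u_bx), (0, [M, h], \<nu>, [M])], [])"
    by (rule goodI[OF eq(2)]) (rule reprs H_boxes b repr_box | simp)+
qed

lemma linear_rule:
  assumes M: "is_rmodule C H (M, \<nu>)" and N: "is_rmodule C H (N, \<mu>)" and f: "f \<in> Hom C M N"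
    and eq: "f \<cdot> \<nu> = \<mu> \<cdot> (f \<otimes> \<iota> h)"
  shows "is_box ([M], f, [N])"
    "good ([M, h], [(0, [M, h], \<nu>, [M]), (0, [M], f, [N])], [(0, [M], f, [N]), (0, [N, h], \<mu>, [N])])"
proof -
  note M = rmodule_rules[OF M] and N = rmodule_rules[OF N]
  note [simp] = M(1) N(1)
  show b: "is_box ([M], f, [N])" using f by (simp add: is_box_def)
  show "good ([M, h], [(0, [M, h], \<nu>, [M]), (0, [M], f, [N])], [(0, [M], f, [N]), (0, [N, h], \<mu>, [N])])"
    by (rule goodI[OF eq]) (rule reprs b M(2) N(2) repr_box | simp)+
qed

definition tens_action :: "'o \<Rightarrow> 'a \<Rightarrow> 'o \<Rightarrow> 'a \<Rightarrow> 'a" where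
  "tens_action M \<nu> N \<mu> = (\<nu> \<otimes> \<mu>) \<cdot> (\<iota> M \<otimes> \<Phi> N h \<otimes> \<iota> h) \<cdot> (\<iota> M \<otimes> \<iota> N \<otimes> cml H)"

lemma rmodule_tens_eq: "rmodule_tens C \<Phi> H (M, \<nu>) (N, \<mu>) = (M \<odot> N, tens_action M \<nu> N \<mu>)"
  by (simp add: rmodule_tens_def tens_action_def)

lemma tens_action_repr:
  assumes M: "is_box ([M, h], \<nu>, [M])" and N: "is_box ([N, h], \<mu>, [N])"
  shows "repr (tens_action M \<nu> N \<mu>) [M, N, h]
    [(2, d_bx), (1, crossing N h), (0, [M, h], \<nu>, [M]), (1, [N, h], \<mu>, [N])] [M, N]"
proof -
  have [simp]: "M \<in> Obj C" "N \<in> Obj C" using M N by (auto simp: is_box_def)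
  show ?thesis unfolding tens_action_def
    by (rule repr_cong) (rule reprs H_boxes M N repr_box | simp)+
qed

text \<open>Pulling the second factor of H across the action on N creates a crossing of H with
  itself, the very one contained in the compatibility of \<Delta> with the multiplication.\<close>

lemma rmodule_tens_closed:
  assumes M: "is_rmodule C H (M, \<nu>)" and N: "is_rmodule C H (N, \<mu>)"
  shows "is_rmodule C H (M \<odot> N, tens_action M \<nu> N \<mu>)"
proof -
  note M = rmodule_rules[OF M] and N = rmodule_rules[OF N]
  note [simp] = M(1) N(1)
  note [reprs] = H_boxes M(2) N(2)
  have "tens_action M \<nu> N \<mu> \<cdot> (tens_action M \<nu> N \<mu> \<otimes> \<iota> h) = tens_action M \<nu> N \<mu> \<cdot> (\<iota> (M \<odot> N) \<otimes> mlt H)"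
    unfolding tens_action_def
    by (rule run_eq[OF _ _ _ good_Cons[OF M(3) good_Cons[OF natural_left[OF N(2) h_obj] good_Cons[OF
        N(3) good_Cons[OF natural_right[OF m_box N(1)] good_Cons[OF bialg_rule good_Nil]]]]],
      where ms = "[SR 2, SR 3, SR 4, SR 6, SR 5, Rw 0 6 0, SL 5, SL 6, SR 2, Rw 1 3 2, SL 5, SL 6, Rw 2
        7 1, SR 6, SR 5, SR 4, SR 1, SR 2, SR 3, Bw 3 4 1, SL 3, Bw 4 0 2]"])
      (rule reprs repr_box | simp)+
  moreover have "tens_action M \<nu> N \<mu> \<cdot> (\<iota> (M \<odot> N) \<otimes> unt H) = \<iota> (M \<odot> N)"
    unfolding tens_action_def
    by (rule run_eq[OF _ _ _ good_Cons[OF cml_unt_rule good_Cons[OF N(4) good_Cons[OF natural_right[OF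
        u_box N(1)] good_Cons[OF M(4) good_Nil]]]],
      where ms = "[Rw 0 0 2, SL 1, SL 2, Rw 1 3 1, Rw 2 0 1, Rw 3 0 0]"])
      (rule reprs repr_box | simp)+
  moreover have "tens_action M \<nu> N \<mu> \<in> Hom C ((M \<odot> N) \<odot> h) (M \<odot> N)"
    using repr_hom[OF tens_action_repr[OF M(2) N(2)]] by (simp add: assoc_obj)
  ultimately show ?thesis by (simp add: is_rmodule_def tens_obj)
qed

lemma tens_action_linear:
  assumes M: "is_rmodule C H (M, \<nu>)" and M': "is_rmodule C H (M', \<nu>')" and f: "f \<in> Hom C M M'" "f \<cdot> \<nu> = \<nu>' \<cdot> (f \<otimes> \<iota> h)"
    and N: "is_rmodule C H (N, \<mu>)" and N': "is_rmodule C H (N', \<mu>')" and g: "g \<in> Hom C N N'" "g \<cdot> \<mu> = \<mu>' \<cdot> (g \<otimes> \<iota> h)"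
  shows "(f \<otimes> g) \<cdot> tens_action M \<nu> N \<mu> = tens_action M' \<nu>' N' \<mu>' \<cdot> ((f \<otimes> g) \<otimes> \<iota> h)"
proof -
  note lf = linear_rule(2)[OF M M' f] and lg = linear_rule(2)[OF N N' g]
    and b = linear_rule(1)[OF M M' f] linear_rule(1)[OF N N' g]
  note M = rmodule_rules[OF M] and N = rmodule_rules[OF N] and M' = rmodule_rules[OF M'] and N' = rmodule_rules[OF N']
  note [simp] = M(1) N(1) M'(1) N'(1)
  note [reprs] = H_boxes M(2) N(2) M'(2) N'(2) b
  show ?thesis unfolding tens_action_def
    by (rule run_eq[OF _ _ _ good_Cons[OF lf good_Cons[OF lg good_Cons[OF natural_left[OF b(2) h_obj]
        good_Nil]]],
      where ms = "[SR 2, SR 4, SR 3, Rw 0 4 0, SL 3, SL 2, SL 1, SL 0, SL 4, SL 3, Rw 1 4 1, SR 3, Bw 2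
        2 1, SL 1]"])
      (rule reprs repr_box | simp)+
qed

text \<open>Coassociativity, after one \<Delta> has been pulled across P.\<close>

lemma tens_action_assoc:
  assumes M: "is_rmodule C H (M, \<nu>)" and N: "is_rmodule C H (N, \<mu>)" and P: "is_rmodule C H (P, \<pi>)"
  shows "tens_action (M \<odot> N) (tens_action M \<nu> N \<mu>) P \<pi> = tens_action M \<nu> (N \<odot> P) (tens_action N \<mu> P \<pi>)"
proof -
  note M = rmodule_rules[OF M] and N = rmodule_rules[OF N] and P = rmodule_rules[OF P]
  note [simp] = M(1) N(1) P(1)
  note [reprs] = H_boxes M(2) N(2) P(2)
  show ?thesis unfolding tens_action_def
    by (rule run_eq[OF _ _ _ good_Cons[OF natural_right[OF d_box P(1)] good_Cons[OF coassoc_rule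
        good_Nil]],
      where ms = "[Bw 0 1 2, SL 3, SL 4, Rw 1 0 3, SL 1, SL 2, SL 3]"])
      (rule reprs repr_box | simp)+
qed

lemma tens_action_unit:
  assumes M: "is_rmodule C H (M, \<nu>)"
  shows "tens_action \<I> (cnt H) M \<nu> = \<nu>" "tens_action M \<nu> \<I> (cnt H) = \<nu>"
proof -
  note M = rmodule_rules[OF M]
  note [simp] = M(1)
  note r = repr_idI and [reprs] = H_boxes M(2)
  show "tens_action \<I> (cnt H) M \<nu> = \<nu>" unfolding tens_action_def
    by (rule run_eq[OF _ _ _ good_Cons[OF natural_right[OF e_box M(1)] good_Cons[OF counit_rule(1)
        good_Nil]],
      where ms = "[Bw 0 1 0, Rw 1 0 1]"])
      (rule reprs repr_box | simp)+
  show "tens_action M \<nu> \<I> (cnt H) = \<nu>" unfolding tens_action_def braid_unit_left[OF h_obj]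
    by (rule run_eq[OF _ _ _ good_Cons[OF counit_rule(2) good_Nil],
      where ms = "[SR 1, Rw 0 0 1]"])
      (rule reprs repr_box | simp)+
qed

lemma unit_rmodule: "is_rmodule C H (\<I>, cnt H)"
proof -
  have "cnt H \<in> Hom C h \<I>" "cnt H \<cdot> mlt H = cnt H \<otimes> cnt H" "cnt H \<cdot> unt H = \<iota> \<I>" "mlt H \<in> Hom C (h \<odot> h) h"
    "unt H \<in> Hom C \<I> h"
    using bialg by (auto simp: bialgebra_def coalgebra_def algebra_def)
  moreover have "cnt H \<cdot> (cnt H \<otimes> \<iota> h) = cnt H \<otimes> cnt H"
    by (rule run_eq[OF _ _ _ good_Nil, where ms = "[]"])
      (rule reprs H_boxes repr_box | simp)+
  ultimately show ?thesis
    by (auto simp: is_rmodule_def unit_obj unit_obj_left unit_arr_left HomD(1))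
qed

abbreviation "D \<equiv> rmod C \<Phi> H"

lemma D_simps:
  "P \<in> Obj D \<longleftrightarrow> is_rmodule C H P" "\<I>\<^bsub>D\<^esub> = (\<I>, cnt H)" "\<iota>\<^bsub>D\<^esub> P = (P, \<iota> (fst P), P)"
  "(P', g, Q') \<cdot>\<^bsub>D\<^esub> (P, f, Q) = (P, g \<cdot> f, Q')" "P \<odot>\<^bsub>D\<^esub> Q = rmodule_tens C \<Phi> H P Q"
  "(P, f, Q) \<otimes>\<^bsub>D\<^esub> (P', g, Q') = (rmodule_tens C \<Phi> H P P', f \<otimes> g, rmodule_tens C \<Phi> H Q Q')"
  "Dom D (P, f, Q) = P" "Cod D (P, f, Q) = Q"
  by (auto simp: rmod_def)

lemma D_hom: "F \<in> Hom D P Q \<longleftrightarrow> (\<exists>f. F = (P, f, Q) \<and> is_rmodule C H P \<and> is_rmodule C H Q \<and>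
    f \<in> Hom C (fst P) (fst Q) \<and> f \<cdot> snd P = snd Q \<cdot> (f \<otimes> \<iota> h))"
  by (auto simp: Hom_def rmod_def)

theorem strict_monoidal_rmod: "strict_monoidal_category D"
proof -
  let ?P = "\<lambda>P f Q. f \<cdot> snd P = snd Q \<cdot> (f \<otimes> \<iota> h)"
  interpret Z: structured_objects C "{P. is_rmodule C H P}" fst ?P "rmodule_tens C \<Phi> H" "(\<I>, cnt H)"
  proof
    fix P Q assume P: "P \<in> {P. is_rmodule C H P}" and Q: "Q \<in> {P. is_rmodule C H P}"
    then obtain M \<nu> N \<mu> where *: "P = (M, \<nu>)" "Q = (N, \<mu>)" by (metis surj_pair)
    with P Q have M: "is_rmodule C H (M, \<nu>)" and N: "is_rmodule C H (N, \<mu>)" by auto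
    then have \<nu>: "M \<in> Obj C" "\<nu> \<in> Hom C (M \<odot> h) M" and \<mu>: "N \<in> Obj C" "\<mu> \<in> Hom C (N \<odot> h) N"
      by (auto simp: is_rmodule_def)
    show "fst P \<in> Obj C" "?P P (\<iota> (fst P)) P"
      using \<nu> by (simp_all add: * tens_id comp_id_left[OF \<nu>(2)] comp_id_right[OF \<nu>(2)])
    show "rmodule_tens C \<Phi> H P Q \<in> {P. is_rmodule C H P}" "fst (rmodule_tens C \<Phi> H P Q) = fst P \<odot> fst Q"
      using rmodule_tens_closed[OF M N] by (simp_all add: * rmodule_tens_eq)
    show "rmodule_tens C \<Phi> H (\<I>, cnt H) P = P" "rmodule_tens C \<Phi> H P (\<I>, cnt H) = P"
      using tens_action_unit[OF M] \<nu> by (simp_all add: * rmodule_tens_eq unit_obj_left unit_obj_right)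
    fix S assume "S \<in> {P. is_rmodule C H P}"
    then obtain L \<pi> where S: "S = (L, \<pi>)" and L: "is_rmodule C H (L, \<pi>)" by (cases S) auto
    then have \<pi>: "L \<in> Obj C" "\<pi> \<in> Hom C (L \<odot> h) L" by (auto simp: is_rmodule_def)
    show "rmodule_tens C \<Phi> H (rmodule_tens C \<Phi> H P Q) S = rmodule_tens C \<Phi> H P (rmodule_tens C \<Phi> H Q S)"
      using tens_action_assoc[OF M N L] \<nu> \<mu> \<pi> by (simp add: * S rmodule_tens_eq assoc_obj)
    fix f g
    note ih = id_hom[OF h_obj]
    show "?P P (g \<cdot> f) S" if "f \<in> Hom C (fst P) (fst Q)" "g \<in> Hom C (fst Q) (fst S)" "?P P f Q" "?P Q g S"
    proof -
      have f: "f \<in> Hom C M N" "f \<cdot> \<nu> = \<mu> \<cdot> (f \<otimes> \<iota> h)" and g: "g \<in> Hom C N L" "g \<cdot> \<mu> = \<pi> \<cdot> (g \<otimes> \<iota> h)"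
        using that by (simp_all add: * S)
      have "(g \<cdot> f) \<otimes> \<iota> h = (g \<otimes> \<iota> h) \<cdot> (f \<otimes> \<iota> h)"
        using interchange[OF f(1) g(1) ih ih] comp_id_left[OF ih] by simp
      then show ?thesis
        using comp_assoc[OF \<nu>(2) f(1) g(1)] comp_assoc[OF tens_hom[OF f(1) ih] \<mu>(2) g(1)]
          comp_assoc[OF tens_hom[OF f(1) ih] tens_hom[OF g(1) ih] \<pi>(2)] f(2) g(2) by (simp add: * S)
    qed
    fix P' assume "P' \<in> {P. is_rmodule C H P}"
    then obtain M' \<nu>' where P': "P' = (M', \<nu>')" and M': "is_rmodule C H (M', \<nu>')" by (cases P') auto
    show "?P (rmodule_tens C \<Phi> H P S) (f \<otimes> g) (rmodule_tens C \<Phi> H Q P')"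
      if "f \<in> Hom C (fst P) (fst Q)" "g \<in> Hom C (fst S) (fst P')" "?P P f Q" "?P S g P'"
      using that tens_action_linear[OF M N _ _ L M', of f g] by (simp add: * S P' rmodule_tens_eq)
  qed (use unit_rmodule in auto)
  have "D = Z.structured"
    unfolding rmod_def Z.structured_def by (auto simp: fun_eq_iff)
  then show ?thesis using Z.strict_monoidal_structured by simp
qed

end

section \<open>Derived rules, and left duals from right duals\<close>

context strict_monoidal_category
begin

text \<open>A form of \<open>diag.dCons\<close> with \<open>take\<close> and \<open>drop\<close>, so
  that the typing of a concrete diagram is decided by evaluation.\<close>

lemma diag_step:
  assumes "is_box (xs, f, ys)" "n + length xs \<le> length w" "take (length xs) (drop n w) = xs"
    and "diag (take n w @ ys @ drop (n + length xs) w) ds z" "set w \<subseteq> Obj C"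
  shows "diag w ((n, xs, f, ys) # ds) z"
proof -
  have "w = take n w @ xs @ drop (n + length xs) w"
    using assms(3) append_take_drop_id[of n w] append_take_drop_id[of "length xs" "drop n w"]
    by (simp add: add.commute)
  moreover have "set (take n w) \<subseteq> Obj C" "set (drop (n + length xs) w) \<subseteq> Obj C"
    using assms(5) set_take_subset[of n w] set_drop_subset[of "n + length xs" w] by auto
  moreover have "n = length (take n w)" using assms(2) by simp
  ultimately show ?thesis using diag.dCons[OF assms(4,1)] by metis
qed

text \<open>Derives a rule directly between diagrams, without writing its sides as composites of
  morphisms.\<close>

lemma good_run: "list_all good rs \<Longrightarrow> diag w ds z \<Longrightarrow> run rs w ms ds = ds' \<Longrightarrow> good (w, ds, ds')"
  using run_sound[of rs w ds z ms] by (auto simp: good_def)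

end

context braided_monoidal_category
begin

text \<open>The new evaluation carries a crossing and the new coevaluation an inverse crossing.
  Pulling the remaining strand across \<open>e\<close> brings in further crossings; by the
  Yang-Baxter relation one of them meets the inverse crossing and cancels it, and the others vanish
  when the strand is pulled across \<open>d\<close>. What remains is a zigzag of the given
  dual.\<close>

lemma left_dual_of_right_dual:
  assumes dual: "is_left_dual C P X e d" and P: "P \<in> Obj C"
  shows "is_left_dual C X P (e \<cdot> \<Phi> P X) (inv_braid X P \<cdot> d)"
proof -
  note b = left_dual_boxes[of "[P]", simplified, OF dual P] and s = snake_rules[of "[P]", simplified, OF dual P]
  note X = b(1)
  note [simp] = X P and [reprs] = b(2) b(3)
  have e: "repr (e \<cdot> \<Phi> P X) [P, X] [(0, crossing P X), (0, [X, P], e, [])] []"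
    by (rule repr_cong) (rule reprs repr_box | simp)+
  have d: "repr (inv_braid X P \<cdot> d) [] [(0, [], d, [P, X]), (0, uncrossing X P)] [X, P]"
    by (rule repr_cong) (rule reprs repr_box | simp)+
  have "(\<iota> X \<otimes> (e \<cdot> \<Phi> P X)) \<cdot> ((inv_braid X P \<cdot> d) \<otimes> \<iota> X) = \<iota> X"
    by (rule run_eq[OF _ _ _ good_Cons[OF uncross_rule(1)[OF X X] good_Cons[OF natural_right[OF b(2) X]
        good_Cons[OF natural_left[OF crossing_box[OF X P] X] good_Cons[OF uncross_rule(2)[OF X P]
        good_Cons[OF natural_left[OF b(3) X] good_Cons[OF s(2) good_Nil]]]]]],
      where ms = "[Bw 0 3 0, Rw 1 5 0, Rw 0 3 0, Bw 2 2 0, Rw 3 1 0, Rw 4 0 0, Rw 5 0 0]"])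
      (rule reprs repr_box | simp)+
  moreover have "((e \<cdot> \<Phi> P X) \<otimes> \<iota> P) \<cdot> (\<iota> P \<otimes> (inv_braid X P \<cdot> d)) = \<iota> P"
    by (rule run_eq[OF _ _ _ good_Cons[OF uncross_rule(1)[OF P P] good_Cons[OF natural_left[OF b(2) P]
        good_Cons[OF natural_right[OF crossing_box[OF X P] P] good_Cons[OF uncross_rule(2)[OF X P]
        good_Cons[OF natural_right[OF b(3) P] good_Cons[OF s(1) good_Nil]]]]]],
      where ms = "[Bw 0 3 1, Rw 1 5 0, Rw 0 3 1, Bw 2 2 0, Rw 3 1 1, Rw 4 0 0, Rw 5 0 0]"])
      (rule reprs repr_box | simp)+
  ultimately show ?thesis
    using repr_hom[OF e] repr_hom[OF d] by (simp add: is_left_dual_def)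
qed

end

sublocale bialgebra_modules \<subseteq> D: strict_monoidal_category "rmod C \<Phi> H"
  by (rule strict_monoidal_rmod)

subsection \<open>Modules over a quasitriangular Hopf algebra\<close>

locale quasitriangular_hopf_modules = bialgebra_modules C \<Phi> H
  for C :: "('o, 'a, 'z) moncat_scheme" (structure) and \<Phi> and H :: "('o, 'a, 'x) hopf_scheme" +
  fixes R :: 'a
  assumes hopf: "hopf_algebra C \<Phi> H" and quasi: "quasitriangular C \<Phi> H R"
    and central: "in_sym_center C \<Phi> (carr H)" and rigid: "rigid C"
begin

abbreviation "R_bx \<equiv> ([], R, [h, h])"
abbreviation "S_bx \<equiv> ([h], antip H, [h])"

lemma R_box: "is_box R_bx"
  using quasi by (auto simp: quasitriangular_def Let_def is_box_def)

lemma S_box: "is_box S_bx"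
  using hopf by (auto simp: hopf_algebra_def is_box_def)

text \<open>Membership in the symmetric center states one of the two composites. The other follows
  because \<Phi> is invertible and a one-sided inverse of it is then two-sided.\<close>

lemma central_rule:
  assumes X [simp]: "X \<in> Obj C"
  shows "good ([X, h], [(0, crossing X h), (0, crossing h X)], [])"
    "good ([h, X], [(0, crossing h X), (0, crossing X h)], [])"
proof -
  have eq: "\<Phi> X h \<cdot> \<Phi> h X = \<iota> (h \<odot> X)" using central by (auto simp: in_sym_center_def)
  note hom = braid_hom[OF X h_obj] braid_hom[OF h_obj X]
  have inv: "inv_braid h X \<in> Hom C (X \<odot> h) (h \<odot> X)" "inv_braid h X \<cdot> \<Phi> h X = \<iota> (h \<odot> X)"
    "\<Phi> h X \<cdot> inv_braid h X = \<iota> (X \<odot> h)" using inv_braid by auto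
  have "\<Phi> X h = \<Phi> X h \<cdot> \<Phi> h X \<cdot> inv_braid h X" using inv hom by (simp add: comp_id_right)
  also have "\<dots> = (\<Phi> X h \<cdot> \<Phi> h X) \<cdot> inv_braid h X" using comp_assoc[OF inv(1) hom(2,1)] by simp
  also have "\<dots> = inv_braid h X" using eq inv(1) by (simp add: comp_id_left)
  finally have eq': "\<Phi> h X \<cdot> \<Phi> X h = \<iota> (X \<odot> h)" using inv by simp
  show "good ([X, h], [(0, crossing X h), (0, crossing h X)], [])"
    by (rule goodI[OF eq']) (rule reprs repr_box | simp)+
  show "good ([h, X], [(0, crossing h X), (0, crossing X h)], [])"
    by (rule goodI[OF eq]) (rule reprs repr_box | simp)+
qed

lemmas R_boxes = H_boxes R_box

text \<open>The axiom for \<Delta> \<otimes> H with the units in R13 and R23 cancelled: only the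
  last legs of the two copies of R are multiplied.\<close>

lemma R_cml_left: "good ([], [(0, R_bx), (0, d_bx)], [(0, R_bx), (2, R_bx), (1, crossing h h), (2, m_bx)])"
proof -
  note [reprs] = R_boxes
  have "(cml H \<otimes> \<iota> h) \<cdot> R = tens_mlt C \<Phi> (h \<odot> h) (tens_mlt C \<Phi> h (mlt H) h (mlt H)) h (mlt H) \<cdot>
    (((\<iota> h \<otimes> unt H \<otimes> \<iota> h) \<cdot> R) \<otimes> unt H \<otimes> R)"
    using quasi by (simp add: quasitriangular_def Let_def)
  also have "\<dots> = (\<iota> h \<otimes> \<iota> h \<otimes> mlt H) \<cdot> (\<iota> h \<otimes> \<Phi> h h \<otimes> \<iota> h) \<cdot> (R \<otimes> R)"
    unfolding tens_mlt_def
    by (rule run_eq[OF _ _ _ good_Cons[OF natural_right[OF u_box h_obj] good_Cons[OF unit_rule(1)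
        good_Cons[OF unit_rule(2) good_Nil]]],
      where ms = "[SL 3, SL 5, SL 4, SL 6, SR 4, SR 3, SR 2, Rw 0 3 2, SR 5, SR 4, SR 3, SR 7, SR 6, SR
        5, SR 4, Rw 0 5 1, SL 4, SL 3, SL 2, SL 1, SL 5, SL 4, SL 3, SL 2, SL 6, SR 3, SR 4, SR 6, SR 5,
        Rw 1 6 1, SR 2, SR 1, SR 3, SR 2, SR 4, SR 3, Rw 2 4 0]"])
      (rule reprs repr_box | simp)+
  finally show ?thesis by (rule goodI) (rule reprs repr_box | simp)+
qed

text \<open>The axiom for H \<otimes> \<Delta> with the units cancelled: the first legs are
  multiplied, and since the second copy of R can be created between the legs of the first one, no
  crossing is left.\<close>

lemma R_cml_right: "good ([], [(0, R_bx), (1, d_bx)], [(0, R_bx), (1, R_bx), (0, m_bx)])"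
proof -
  note [reprs] = R_boxes
  have "(\<iota> h \<otimes> cml H) \<cdot> R = tens_mlt C \<Phi> (h \<odot> h) (tens_mlt C \<Phi> h (mlt H) h (mlt H)) h (mlt H) \<cdot>
    (((\<iota> h \<otimes> unt H \<otimes> \<iota> h) \<cdot> R) \<otimes> R \<otimes> unt H)"
    using quasi by (simp add: quasitriangular_def Let_def)
  also have "\<dots> = (mlt H \<otimes> \<iota> h \<otimes> \<iota> h) \<cdot> (\<iota> h \<otimes> R \<otimes> \<iota> h) \<cdot> R"
    unfolding tens_mlt_def
    by (rule run_eq[OF _ _ _ good_Cons[OF unit_rule(2) good_Cons[OF natural_right[OF R_box h_obj]
        good_Cons[OF natural_left[OF u_box h_obj] good_Cons[OF unit_rule(1) good_Nil]]]],
      where ms = "[SL 3, SL 4, SL 5, SL 4, SL 6, SL 5, SL 7, Rw 0 8 2, SR 5, SR 4, Rw 1 2 2, SR 1, Rw 2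
        2 1, SL 2, Rw 3 3 1]"])
      (rule reprs repr_box | simp)+
  finally show ?thesis by (rule goodI) (rule reprs repr_box | simp)+
qed

lemma quasi_rule: "good ([h], [(0, d_bx), (0, crossing h h), (2, R_bx), (1, crossing h h), (0, m_bx), (1, m_bx)],
  [(0, R_bx), (2, d_bx), (1, crossing h h), (0, m_bx), (1, m_bx)])"
proof -
  have "tens_mlt C \<Phi> h (mlt H) h (mlt H) \<cdot> ((\<Phi> h h \<cdot> cml H) \<otimes> R) =
    tens_mlt C \<Phi> h (mlt H) h (mlt H) \<cdot> (R \<otimes> cml H)"
    using quasi by (simp add: quasitriangular_def Let_def)
  then show ?thesis unfolding tens_mlt_def
    by (rule goodI) (rule reprs R_boxes repr_box | simp)+
qed

text \<open>The element \<open>(\<epsilon> \<otimes> H) R\<close> is idempotent by the first axiom of \<open>R\<close>, and it is invertible, hence it is the unit.\<close>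

lemma R_counit: "good ([], [(0, R_bx), (0, e_bx)], [(0, u_bx)])"
proof -
  obtain T where T: "T \<in> Hom C \<I> (h \<odot> h)"
    and eq: "tens_mlt C \<Phi> h (mlt H) h (mlt H) \<cdot> (R \<otimes> T) = unt H \<otimes> unt H"
    using quasi by (auto simp: quasitriangular_def Let_def)
  have Tb: "is_box ([], T, [h, h])" using T by (simp add: is_box_def)
  note [reprs] = R_boxes Tb
  have inv: "good ([], [(0, R_bx), (2, [], T, [h, h]), (1, crossing h h), (0, m_bx), (1, m_bx)], [(0, u_bx), (1, u_bx)])"
    using eq unfolding tens_mlt_def by (rule goodI) (rule reprs repr_box | simp)+
  let ?e = "(cnt H \<otimes> \<iota> h) \<cdot> R" and ?t = "(cnt H \<otimes> \<iota> h) \<cdot> T"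
  \<comment> \<open>The counit is applied to both legs of \<Delta> in (\<Delta> \<otimes> H) R; on
    the product of R13 and R23 this gives the square of \<open>?e\<close>.\<close>
  have "?e = mlt H \<cdot> (?e \<otimes> ?e)"
    by (rule run_eq[OF _ _ _ good_Cons[OF counit_rule(1) good_Cons[OF R_cml_left good_Cons[OF
        natural_right[OF e_box h_obj] good_Nil]]],
      where ms = "[Bw 0 1 0, Rw 1 0 0, SL 3, SL 2, SL 1, SL 4, Bw 2 3 0]"])
      (rule reprs repr_box | simp)+
  then have idem: "good ([], [(0, R_bx), (0, e_bx)], [(0, R_bx), (0, e_bx), (1, R_bx), (1, e_bx), (0, m_bx)])"
    by (rule goodI) (rule reprs repr_box | simp)+
  \<comment> \<open>The counit is multiplicative, so applying it to the first leg of the product of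
    R and T gives a right inverse of \<open>?e\<close>.\<close>
  have "mlt H \<cdot> (?e \<otimes> ?t) = unt H"
    by (rule run_eq[OF _ _ _ good_Cons[OF natural_left[OF e_box h_obj] good_Cons[OF natural_right[OF
        e_box h_obj] good_Cons[OF cnt_mlt_rule good_Cons[OF inv good_Cons[OF cnt_unt_rule good_Nil]]]]],
      where ms = "[SR 1, SR 2, SR 3, Rw 0 4 0, Rw 1 2 1, Bw 0 5 0, SL 4, SL 3, SL 2, SL 1, SR 4, SR 1,
        SR 2, SR 3, Bw 2 4 0, SL 3, Rw 3 0 0, SL 1, SL 1, SL 0, Rw 4 1 1]"])
      (rule reprs repr_box | simp)+
  then have inv: "good ([], [(0, R_bx), (0, e_bx), (1, [], T, [h, h]), (1, e_bx), (0, m_bx)], [(0, u_bx)])"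
    by (rule goodI) (rule reprs repr_box | simp)+
  \<comment> \<open>With e and t for \<open>?e\<close> and \<open>?t\<close>: e = e (e t) = (e e) t
    = e t = 1.\<close>
  have "?e = unt H"
    by (rule run_eq[OF _ _ _ good_Cons[OF unit_rule(2) good_Cons[OF inv good_Cons[OF mlt_assoc_rule
        good_Cons[OF idem good_Nil]]]],
      where ms = "[Bw 0 2 0, Bw 1 2 1, Bw 2 6 0, SL 5, SR 3, SR 2, SR 1, SR 0, SR 5, SR 4, SR 3, SR 2,
        SR 1, Bw 3 2 0, SL 1, SL 0, SL 2, SL 1, Rw 1 0 0]"])
      (rule reprs repr_box | simp)+
  then show ?thesis by (rule goodI) (rule reprs repr_box | simp)+
qed

definition mod_braid :: "'o \<Rightarrow> 'a \<Rightarrow> 'o \<Rightarrow> 'a \<Rightarrow> 'a" where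
  "mod_braid M \<nu> N \<mu> = (\<mu> \<otimes> \<nu>) \<cdot> (\<iota> N \<otimes> \<Phi> M h \<otimes> \<iota> h) \<cdot> (\<Phi> M N \<otimes> R)"

lemma rmod_braiding_eq: "rmod_braiding C \<Phi> H R (M, \<nu>) (N, \<mu>) =
    ((M \<odot> N, tens_action M \<nu> N \<mu>), mod_braid M \<nu> N \<mu>, (N \<odot> M, tens_action N \<mu> M \<nu>))"
  by (simp add: rmod_braiding_def rmodule_tens_eq mod_braid_def)

lemma mod_braid_repr:
  assumes M: "is_box ([M, h], \<nu>, [M])" and N: "is_box ([N, h], \<mu>, [N])"
  shows "repr (mod_braid M \<nu> N \<mu>) [M, N]
    [(0, crossing M N), (2, R_bx), (1, crossing M h), (0, [N, h], \<mu>, [N]), (1, [M, h], \<nu>, [M])] [N, M]"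
proof -
  have [simp]: "M \<in> Obj C" "N \<in> Obj C" using M N by (auto simp: is_box_def)
  show ?thesis unfolding mod_braid_def
    by (rule repr_cong) (rule reprs R_boxes M N repr_box | simp)+
qed

text \<open>This is the axiom relating R to \<Delta> and its opposite, spread over two modules. The
  opposite comultiplication is formed with a crossing of H with itself, whereas here N also crosses
  H and back; as H is transparent, this double crossing disappears.\<close>

lemma mod_braid_linear:
  assumes M: "is_rmodule C H (M, \<nu>)" and N: "is_rmodule C H (N, \<mu>)"
  shows "mod_braid M \<nu> N \<mu> \<cdot> tens_action M \<nu> N \<mu> = tens_action N \<mu> M \<nu> \<cdot> (mod_braid M \<nu> N \<mu> \<otimes> \<iota> h)"
proof -
  note M = rmodule_rules[OF M] and N = rmodule_rules[OF N]
  note [simp] = M(1) N(1) and [reprs] = R_boxes M(2) N(2)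
  show ?thesis unfolding tens_action_def mod_braid_def
    by (rule run_eq[OF _ _ _ good_Cons[OF natural_right[OF N(2) M(1)] good_Cons[OF N(3) good_Cons[OF
        natural_left[OF M(2) N(1)] good_Cons[OF central_rule(1)[OF N(1)] good_Cons[OF natural_left[OF
        M(2) h_obj] good_Cons[OF natural_right[OF m_box M(1)] good_Cons[OF M(3) good_Cons[OF quasi_rule
        good_Nil]]]]]]]],
      where ms = "[SR 4, SR 3, Rw 0 4 0, SL 3, SL 4, SR 6, SR 8, SR 7, Rw 1 8 0, SL 7, SL 8, SR 4, SR 3,
        SR 2, Rw 2 3 0, SR 1, Rw 3 2 1, SL 1, SL 0, Rw 4 3 1, SL 2, SL 3, Rw 4 5 2, SL 7, SL 8, SR 3, SR
        4, Bw 5 5 1, Rw 6 8 1, SR 7, SR 6, Rw 7 1 2, SR 4, Rw 5 5 1, SL 4, SL 3, SL 2, SL 5, SL 6, SL 7,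
        Bw 6 8 1, SR 7, SR 6, Bw 4 4 2, SL 3, SR 7, SR 6, Bw 1 7 0, SL 6, SL 7, SL 5, SL 4, SL 3]"])
      (rule reprs repr_box | simp)+
qed

lemma mod_braid_natural:
  assumes M: "is_rmodule C H (M, \<nu>)" and M2: "is_rmodule C H (M', \<nu>')" and f: "f \<in> Hom C M M'" "f \<cdot> \<nu> = \<nu>' \<cdot> (f \<otimes> \<iota> h)"
    and N: "is_rmodule C H (N, \<mu>)" and N2: "is_rmodule C H (N', \<mu>')" and g: "g \<in> Hom C N N'" "g \<cdot> \<mu> = \<mu>' \<cdot> (g \<otimes> \<iota> h)"
  shows "mod_braid M' \<nu>' N' \<mu>' \<cdot> (f \<otimes> g) = (g \<otimes> f) \<cdot> mod_braid M \<nu> N \<mu>"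
proof -
  note lf = linear_rule(2)[OF M M2 f] and lg = linear_rule(2)[OF N N2 g]
    and b = linear_rule(1)[OF M M2 f] linear_rule(1)[OF N N2 g]
  note M = rmodule_rules[OF M] and N = rmodule_rules[OF N] and M2 = rmodule_rules[OF M2] and N2 = rmodule_rules[OF N2]
  note [simp] = M(1) N(1) M2(1) N2(1)
  note [reprs] = R_boxes M(2) N(2) M2(2) N2(2) b
  show ?thesis unfolding mod_braid_def
    by (rule run_eq[OF _ _ _ good_Cons[OF natural_right[OF b(2) M2(1)] good_Cons[OF lg good_Cons[OF
        natural_left[OF b(1) N(1)] good_Cons[OF natural_left[OF b(1) h_obj] good_Cons[OF lf
        good_Nil]]]]],
      where ms = "[SR 2, SR 1, Rw 0 2 0, SL 1, SR 3, SR 5, SR 4, Bw 1 5 0, SL 4, SL 5, SR 1, SR 0, Rw 2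
        1 0, SL 0, Rw 3 2 1, SL 3, SL 4, Bw 4 5 1, SR 4]"])
      (rule reprs repr_box | simp)+
qed

text \<open>In \<Omega> the first leg of R acts on the second argument and the second leg on the
  first. Hence the first equation splits the second leg by the axiom for H \<otimes> \<Delta>, and
  the second splits the first leg by the one for \<Delta> \<otimes> H. In the latter a double
  crossing of P with H has to be inserted, which is possible because H is transparent.\<close>

lemma mod_braid_hexagon:
  assumes M: "is_rmodule C H (M, \<nu>)" and N: "is_rmodule C H (N, \<mu>)" and P: "is_rmodule C H (P, \<pi>)"
  shows "mod_braid (M \<odot> N) (tens_action M \<nu> N \<mu>) P \<pi> =
      (mod_braid M \<nu> P \<pi> \<otimes> \<iota> N) \<cdot> (\<iota> M \<otimes> mod_braid N \<mu> P \<pi>)"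
    and "mod_braid M \<nu> (N \<odot> P) (tens_action N \<mu> P \<pi>) =
      (\<iota> N \<otimes> mod_braid M \<nu> P \<pi>) \<cdot> (mod_braid M \<nu> N \<mu> \<otimes> \<iota> P)"
proof -
  note M = rmodule_rules[OF M] and N = rmodule_rules[OF N] and P = rmodule_rules[OF P]
  note [simp] = M(1) N(1) P(1) and [reprs] = R_boxes M(2) N(2) P(2)
  show "mod_braid (M \<odot> N) (tens_action M \<nu> N \<mu>) P \<pi> =
      (mod_braid M \<nu> P \<pi> \<otimes> \<iota> N) \<cdot> (\<iota> M \<otimes> mod_braid N \<mu> P \<pi>)"
    unfolding tens_action_def mod_braid_def
    by (rule run_eq[OF _ _ _ good_Cons[OF R_cml_right good_Cons[OF natural_right[OF m_box N(1)]
        good_Cons[OF natural_right[OF R_box N(1)] good_Cons[OF natural_right[OF m_box M(1)] good_Cons[OF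
        P(3) good_Cons[OF natural_right[OF P(2) M(1)] good_Nil]]]]]],
      where ms = "[SR 5, SR 4, SR 3, Rw 0 2 3, Rw 1 4 2, SL 3, SR 8, SR 7, SR 6, Rw 2 4 3, SR 8, SR 7,
        SR 6, SR 5, Rw 3 6 1, SL 5, SL 4, SL 6, SL 7, SL 8, SL 9, SR 8, SR 9, SR 7, SR 8, Bw 4 9 0, SL
        8, SL 9, SL 7, SL 8, SL 6, SL 5, SR 9, SR 8, SR 7, SR 5, SR 6, SR 4, SR 5, SR 1, SR 2, SR 3, SR
        4, Bw 5 5 0, SL 4, SL 5, SL 6, SL 7, SL 8, SL 3, SL 4, SR 8, SR 7, SR 6, SR 5, SR 4]"])
      (rule reprs repr_box | simp)+
  show "mod_braid M \<nu> (N \<odot> P) (tens_action N \<mu> P \<pi>) =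
      (\<iota> N \<otimes> mod_braid M \<nu> P \<pi>) \<cdot> (mod_braid M \<nu> N \<mu> \<otimes> \<iota> P)"
    unfolding tens_action_def mod_braid_def
    by (rule run_eq[OF _ _ _ good_Cons[OF natural_right[OF d_box M(1)] good_Cons[OF R_cml_left
        good_Cons[OF M(3) good_Cons[OF natural_left[OF M(2) h_obj] good_Cons[OF natural_right[OF
        crossing_box[OF P(1) h_obj] M(1)] good_Cons[OF central_rule(1)[OF P(1)] good_Cons[OF
        natural_right[OF R_box P(1)] good_Cons[OF natural_left[OF M(2) P(1)] good_Nil]]]]]]]],
      where ms = "[Bw 0 3 2, SL 5, SL 6, Rw 1 2 3, SL 5, SL 4, SL 3, SL 6, SL 5, SL 4, SL 7, SL 6, SL 5,
        SL 8, SL 9, Bw 2 10 2, SR 9, Bw 3 7 2, SL 6, SR 1, SR 6, SR 5, SR 4, SR 3, SR 2, Bw 4 3 1, SL 2,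
        SL 3, SL 4, SL 5, SL 4, SR 5, Bw 5 6 2, SL 5, SR 4, SR 5, SR 3, SR 4, SR 3, SR 2, SR 1, Rw 6 2
        2, SL 1, SL 2, SL 3, Bw 7 5 1, SL 4, SL 5]"])
      (rule reprs repr_box | simp)+
qed

text \<open>Deduced from \<open>R_counit\<close> and not from the argument with an invertible
  idempotent, because the invertibility of \<Omega> is itself derived from this equation.\<close>

lemma mod_braid_unit:
  assumes M: "is_rmodule C H (M, \<nu>)"
  shows "mod_braid M \<nu> \<I> (cnt H) = \<iota> M"
proof -
  note M = rmodule_rules[OF M]
  note [simp] = M(1) and [reprs] = R_boxes M(2)
  show ?thesis unfolding mod_braid_def braid_unit_right[OF M(1)]
    by (rule run_eq[OF _ _ _ good_Cons[OF natural_right[OF e_box M(1)] good_Cons[OF R_counit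
        good_Cons[OF M(4) good_Nil]]],
      where ms = "[Bw 0 1 0, Rw 1 0 1, Rw 2 0 0]"])
      (rule reprs repr_box | simp)+
qed

section \<open>The antipode and duals of modules\<close>

lemma antipode_rule: "good ([h], [(0, d_bx), (0, S_bx), (0, m_bx)], [(0, e_bx), (0, u_bx)])"
  "good ([h], [(0, d_bx), (1, S_bx), (0, m_bx)], [(0, e_bx), (0, u_bx)])"
proof -
  have eq: "mlt H \<cdot> (antip H \<otimes> \<iota> h) \<cdot> cml H = unt H \<cdot> cnt H" "mlt H \<cdot> (\<iota> h \<otimes> antip H) \<cdot> cml H = unt H \<cdot> cnt H"
    using hopf by (auto simp: hopf_algebra_def)
  show "good ([h], [(0, d_bx), (0, S_bx), (0, m_bx)], [(0, e_bx), (0, u_bx)])"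
    by (rule goodI[OF eq(1)]) (rule reprs H_boxes S_box repr_box | simp)+
  show "good ([h], [(0, d_bx), (1, S_bx), (0, m_bx)], [(0, e_bx), (0, u_bx)])"
    by (rule goodI[OF eq(2)]) (rule reprs H_boxes S_box repr_box | simp)+
qed

text \<open>Both \<open>S \<nabla>\<close> and \<open>\<nabla> \<Phi> (S \<otimes> S)\<close> are convolution inverses of \<open>\<nabla>\<close>.\<close>

lemma antipode_mult: "good ([h, h], [(0, m_bx), (0, S_bx)], [(0, crossing h h), (0, S_bx), (1, S_bx), (0, m_bx)])"
proof -
  \<comment> \<open>Write L for S \<nabla>, G for \<nabla> and P for the product of the antipodes in
    reversed order. \<open>LG\<close> and \<open>GP\<close> say that L G and G P are the unit for
    convolution on H \<otimes> H.\<close>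
  have LG: "good ([h, h], [(0, d_bx), (2, d_bx), (1, crossing h h), (0, m_bx), (0, S_bx), (1, m_bx), (0, m_bx)],
    [(0, e_bx), (0, e_bx), (0, u_bx)])"
    by (rule good_run[OF good_Cons[OF bialg_rule good_Cons[OF antipode_rule(1) good_Cons[OF cnt_mlt_rule
        good_Nil]]],
      where ms = "[SR 4, Bw 0 0 0, Rw 1 1 0, SL 1, SL 0, Rw 2 1 1, SR 0, SR 1]"])
      (rule diag_step diag.dNil crossing_box H_boxes S_box | simp)+
  have GP: "good ([h, h], [(0, d_bx), (2, d_bx), (1, crossing h h), (0, m_bx), (1, crossing h h), (1, S_bx),
    (2, S_bx), (1, m_bx), (0, m_bx)], [(0, e_bx), (0, e_bx), (0, u_bx)])"
    by (rule good_run[OF good_Cons[OF mlt_assoc_rule good_Cons[OF natural_right[OF d_box h_obj]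
        good_Cons[OF antipode_rule(2) good_Cons[OF unit_rule(1) good_Cons[OF natural_right[OF e_box
        h_obj] good_Cons[OF natural_left[OF d_box h_obj] good_Cons[OF natural_left[OF e_box h_obj]
        good_Nil]]]]]]],
      where ms = "[SR 3, SR 4, SR 5, SR 6, Rw 0 7 0, Bw 0 6 1, SL 5, Rw 1 1 1, SR 4, SR 3, SR 2, Rw 2 3
        1, SL 2, Rw 3 4 1, Rw 4 2 0, Rw 5 0 0, SL 1, Rw 2 2 0, SL 2, SL 1, SL 0, SR 2, SR 0, SR 1, Bw 6
        0 0, SR 1]"])
      (rule diag_step diag.dNil crossing_box H_boxes S_box | simp)+
  \<comment> \<open>In the convolution algebra, L = L (G P) = (L G) P = P.\<close>
  show ?thesis
    by (rule good_run[OF good_Cons[OF counit_rule(2) good_Cons[OF natural_left[OF e_box h_obj]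
        good_Cons[OF unit_rule(2) good_Cons[OF GP good_Cons[OF natural_left[OF d_box h_obj] good_Cons[OF
        coassoc_rule good_Cons[OF natural_right[OF d_box h_obj] good_Cons[OF mlt_assoc_rule good_Cons[OF
        LG good_Cons[OF unit_rule(1) good_Cons[OF natural_right[OF e_box h_obj] good_Cons[OF
        counit_rule(1) good_Nil]]]]]]]]]]]],
      where ms = "[Bw 0 0 1, Bw 0 2 0, SL 1, SL 2, SL 3, SL 4, SL 0, SL 1, SR 4, SR 3, SR 1, SR 2, Rw 1
        3 1, SL 4, SL 5, SL 2, SL 3, SL 4, SL 5, Bw 2 7 0, Bw 3 5 1, SR 5, SR 4, SR 3, SR 2, SR 5, SR 4,
        Bw 4 3 1, SL 2, SL 1, SL 3, SL 4, SL 5, SL 6, SR 1, SR 0, SR 6, SR 5, SR 4, SR 3, SR 2, SR 1, Bw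
        5 2 0, SL 1, SL 0, SL 2, SL 1, Bw 5 2 3, SR 7, SR 6, SR 5, Rw 6 3 2, Bw 7 13 0, SL 12, SL 11, SL
        10, SL 9, SR 1, SR 2, SR 9, SR 8, SR 7, SR 6, SR 5, SR 4, SR 3, SR 10, SR 9, SR 8, SR 7, SR 6,
        SR 5, SR 4, SR 11, SR 10, SR 9, SR 8, SR 7, SR 6, SR 5, SR 12, SR 11, SR 10, SR 9, SR 8, SR 7,
        SR 6, Rw 8 7 0, SL 6, SL 5, SL 4, SL 3, SL 2, SL 1, SL 7, SL 6, SL 5, SL 4, Rw 9 9 0, Bw 10 3 0,
        SR 1, SR 0, SR 2, SR 1, Rw 11 2 0, Rw 11 0 1]"])
      (rule diag_step diag.dNil crossing_box H_boxes S_box | simp)+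
qed

text \<open>As \<Delta> maps 1 to 1 \<otimes> 1, the first antipode equation at 1 reads S(1) 1 =
  \<epsilon>(1) 1.\<close>

lemma antipode_unit: "good ([], [(0, u_bx), (0, S_bx)], [(0, u_bx)])"
  by (rule good_run[OF good_Cons[OF unit_rule(2) good_Cons[OF cml_unt_rule good_Cons[OF
      antipode_rule(1) good_Cons[OF cnt_unt_rule good_Nil]]]],
    where ms = "[Bw 0 2 0, SR 1, Bw 1 0 0, Rw 2 1 0, SL 1, SL 0, Rw 3 1 1]"])
    (rule diag_step diag.dNil crossing_box H_boxes S_box | simp)+

text \<open>The right dual of a module is the right dual of the underlying object with the action \<open>(f h)(m) = f(m S(h))\<close>.\<close>

definition dual_action :: "'o \<Rightarrow> 'a \<Rightarrow> 'o \<Rightarrow> 'a \<Rightarrow> 'a \<Rightarrow> 'a" where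
  "dual_action M \<nu> Y e d = (\<iota> Y \<otimes> e) \<cdot> (\<iota> Y \<otimes> \<nu> \<otimes> \<iota> Y) \<cdot> (\<iota> Y \<otimes> \<iota> M \<otimes> antip H \<otimes> \<iota> Y) \<cdot>
    (\<iota> Y \<otimes> \<iota> M \<otimes> \<Phi> Y h) \<cdot> (d \<otimes> \<iota> Y \<otimes> \<iota> h)"

text \<open>After the typing, the claims rest in turn on the antipode reversing products, on its
  value at the unit, and on its two defining equations, one for the linearity of the evaluation and
  one for that of the coevaluation.\<close>

lemma dual_action_rules:
  assumes M: "is_rmodule C H (M, \<nu>)" and Y: "Y \<in> Obj C" and dual: "is_left_dual C Y M e d"
  defines "k \<equiv> ([Y, h], dual_action M \<nu> Y e d, [Y])"
  shows "is_box k"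
    and "good ([Y, h, h], [(0, k), (0, k)], [(1, m_bx), (0, k)])"
    and "good ([Y], [(1, u_bx), (0, k)], [])"
    and "good ([M, Y, h], [(2, d_bx), (1, crossing Y h), (0, [M, h], \<nu>, [M]), (1, k), (0, [M, Y], e, [])],
      [(0, [M, Y], e, []), (0, e_bx)])"
    and "good ([h], [(0, [], d, [Y, M]), (2, d_bx), (1, crossing M h), (0, k), (1, [M, h], \<nu>, [M])],
      [(0, e_bx), (0, [], d, [Y, M])])"
proof -
  note M = rmodule_rules[OF M]
  note b = left_dual_boxes[of "[Y]", simplified, OF dual Y] and s = snake_rules[of "[Y]", simplified, OF dual Y]
  note eb = b(2) and db = b(3)
  note [simp] = M(1) Y
  have kr: "repr (dual_action M \<nu> Y e d) [Y, h]
    [(0, [], d, [Y, M]), (2, crossing Y h), (2, S_bx), (1, [M, h], \<nu>, [M]), (1, [M, Y], e, [])] [Y]"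
    unfolding dual_action_def
    by (rule repr_cong) (rule reprs eb db M(2) S_box
      repr_box | simp)+
  have kb: "is_box ([Y, h], dual_action M \<nu> Y e d, [Y])" by (rule repr_is_box[OF kr])
  then show "is_box k" by (simp add: k_def)
  note bx = H_boxes S_box M(2) eb db kb
  have k: "good ([Y, h], [(0, [Y, h], dual_action M \<nu> Y e d, [Y])],
    [(0, [], d, [Y, M]), (2, crossing Y h), (2, S_bx), (1, [M, h], \<nu>, [M]), (1, [M, Y], e, [])])"
    by (rule goodI[OF refl repr_box[OF kb] kr]) auto
  \<comment> \<open>The action in terms of the pairing; a zigzag has absorbed the coevaluation that
    occurs in its definition. The claims below are reduced to this form.\<close>
  have K: "good ([M, Y, h], [(1, [Y, h], dual_action M \<nu> Y e d, [Y]), (0, [M, Y], e, [])],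
    [(1, crossing Y h), (1, S_bx), (0, [M, h], \<nu>, [M]), (0, [M, Y], e, [])])"
    by (rule good_run[OF good_Cons[OF k good_Cons[OF s(2) good_Nil]],
      where ms = "[Rw 0 0 1, SL 4, SL 3, SL 2, SR 0, SR 2, SR 1, Rw 1 2 0]"])
      (rule diag_step diag.dNil crossing_box bx | simp)+
  show "good ([Y, h, h], [(0, k), (0, k)], [(1, m_bx), (0, k)])"
    unfolding k_def
    by (rule good_run[OF good_Cons[OF s(1) good_Cons[OF K good_Cons[OF natural_left[OF kb h_obj]
        good_Cons[OF M(3) good_Cons[OF natural_left[OF crossing_box[OF Y h_obj] h_obj] good_Cons[OF
        antipode_mult good_Cons[OF natural_right[OF m_box Y] good_Nil]]]]]]],
      where ms = "[Bw 0 2 0, SL 1, SL 0, Rw 1 2 1, Rw 2 1 2, SL 3, SL 4, Rw 1 5 1, SR 4, SR 5, Rw 3 6 1,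
        SR 3, Bw 4 1 2, Bw 5 3 2, Bw 6 1 2, Bw 1 2 1, SR 0, SR 1, Rw 0 2 0]"])
      (rule diag_step diag.dNil crossing_box bx | simp)+
  show "good ([Y], [(1, u_bx), (0, k)], [])"
    unfolding k_def
    by (rule good_run[OF good_Cons[OF s(1) good_Cons[OF K good_Cons[OF natural_right[OF u_box Y]
        good_Cons[OF antipode_unit good_Cons[OF M(4) good_Nil]]]]],
      where ms = "[Bw 0 2 0, SL 1, SL 0, Rw 1 2 1, Rw 2 1 2, Rw 3 1 2, Rw 4 1 1, Rw 0 0 0]"])
      (rule diag_step diag.dNil crossing_box bx | simp)+
  show "good ([M, Y, h], [(2, d_bx), (1, crossing Y h), (0, [M, h], \<nu>, [M]), (1, k), (0, [M, Y], e, [])],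
      [(0, [M, Y], e, []), (0, e_bx)])"
    unfolding k_def
    by (rule good_run[OF good_Cons[OF K good_Cons[OF M(3) good_Cons[OF natural_right[OF d_box Y]
        good_Cons[OF antipode_rule(2) good_Cons[OF M(4) good_Cons[OF natural_right[OF e_box Y]
        good_Nil]]]]]],
      where ms = "[Rw 0 3 0, SR 2, SR 3, Rw 1 4 0, Rw 2 0 1, Rw 3 1 1, Rw 4 2 0, Bw 5 0 1, SL 0]"])
      (rule diag_step diag.dNil crossing_box bx | simp)+
  show "good ([h], [(0, [], d, [Y, M]), (2, d_bx), (1, crossing M h), (0, k), (1, [M, h], \<nu>, [M])],
      [(0, e_bx), (0, [], d, [Y, M])])"
    unfolding k_def
    by (rule good_run[OF good_Cons[OF s(1) good_Cons[OF K good_Cons[OF natural_left[OF db h_obj]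
        good_Cons[OF s(2) good_Cons[OF M(3) good_Cons[OF antipode_rule(1) good_Cons[OF M(4)
        good_Nil]]]]]]],
      where ms = "[Bw 0 5 0, SL 4, SL 5, SL 3, SL 2, SL 1, SL 0, SR 5, SR 4, Rw 1 5 1, SL 4, SL 5, SL 6,
        SL 7, SR 1, Rw 2 2 2, SL 2, SL 3, Rw 3 4 1, Rw 4 3 1, Rw 5 1 2, Rw 6 2 1, SR 0]"])
      (rule diag_step diag.dNil crossing_box bx | simp)+
qed

lemma good_eq: "good (w, l, r) \<Longrightarrow> repr e w l z \<Longrightarrow> repr e' w r z' \<Longrightarrow> e = e'"
  by (auto simp: good_def repr_def)

text \<open>Evaluation and coevaluation of the underlying object become linear by the last two of
  \<open>dual_action_rules\<close>. The zigzag identities are those in C, as arrows of modules are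
  composed and tensored there.\<close>

lemma right_dual_exists:
  assumes P: "is_rmodule C H P"
  shows "\<exists>Q e d. is_rmodule C H Q \<and> is_left_dual D Q P e d"
proof -
  obtain M \<nu> where PM: "P = (M, \<nu>)" by (cases P)
  note M = P[unfolded PM]
  note MR = rmodule_rules[OF M]
  obtain Y e d where Y: "Y \<in> Obj C" and dual: "is_left_dual C Y M e d"
    using rigid MR(1) unfolding rigid_def by blast
  define \<kappa> where "\<kappa> = dual_action M \<nu> Y e d"
  note K = dual_action_rules[OF M Y dual, folded \<kappa>_def]
  note b = left_dual_boxes[of "[Y]", simplified, OF dual Y]
  note [simp] = MR(1) Y
  note [reprs] = H_boxes MR(2) K(1) b(2) b(3)
  have \<kappa>: "is_rmodule C H (Y, \<kappa>)"
  proof -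
    have "\<kappa> \<cdot> (\<kappa> \<otimes> \<iota> h) = \<kappa> \<cdot> (\<iota> Y \<otimes> mlt H)"
      by (rule good_eq[OF K(2)]; rule repr_cong) (rule reprs repr_box | simp)+
    moreover have "\<kappa> \<cdot> (\<iota> Y \<otimes> unt H) = \<iota> Y"
      by (rule good_eq[OF K(3)]; rule repr_cong) (rule reprs repr_box | simp)+
    ultimately show ?thesis using K(1) by (simp add: is_rmodule_def is_box_def)
  qed
  have e_lin: "e \<cdot> tens_action M \<nu> Y \<kappa> = cnt H \<cdot> (e \<otimes> \<iota> h)"
    unfolding tens_action_def by (rule good_eq[OF K(4)]; rule repr_cong) (rule reprs repr_box | simp)+
  have d_lin: "tens_action Y \<kappa> M \<nu> \<cdot> (d \<otimes> \<iota> h) = d \<cdot> cnt H"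
    unfolding tens_action_def by (rule good_eq[OF K(5)]; rule repr_cong) (rule reprs repr_box | simp)+
  have C: "e \<in> Hom C (M \<odot> Y) \<I>" "d \<in> Hom C \<I> (Y \<odot> M)" "(\<iota> Y \<otimes> e) \<cdot> (d \<otimes> \<iota> Y) = \<iota> Y" "(e \<otimes> \<iota> M) \<cdot> (\<iota> M \<otimes> d) = \<iota> M"
    using dual by (auto simp: is_left_dual_def)
  let ?P = "(M, \<nu>)" and ?Q = "(Y, \<kappa>)"
  have PQ: "?P \<in> Obj D" "?Q \<in> Obj D" using M \<kappa> by (simp_all add: D_simps)
  let ?e = "(rmodule_tens C \<Phi> H ?P ?Q, e, (\<I>, cnt H))" and ?d = "((\<I>, cnt H), d, rmodule_tens C \<Phi> H ?Q ?P)"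
  have unit_tens: "rmodule_tens C \<Phi> H (\<I>, cnt H) S = S" "rmodule_tens C \<Phi> H S (\<I>, cnt H) = S" if "is_rmodule C H S" for S
    using D.unit_obj_left[of S] D.unit_obj_right[of S] that by (simp_all add: D_simps)
  have assoc: "rmodule_tens C \<Phi> H (rmodule_tens C \<Phi> H S T) U = rmodule_tens C \<Phi> H S (rmodule_tens C \<Phi> H T U)"
    if "is_rmodule C H S" "is_rmodule C H T" "is_rmodule C H U" for S T U
    using D.assoc_obj[of S T U] that by (simp add: D_simps)
  have "?e \<in> Hom D (?P \<odot>\<^bsub>D\<^esub> ?Q) \<I>\<^bsub>D\<^esub>"
    using e_lin C M \<kappa> unit_rmodule rmodule_tens_closed[OF M \<kappa>] by (simp add: D_hom D_simps rmodule_tens_eq)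
  moreover have "?d \<in> Hom D \<I>\<^bsub>D\<^esub> (?Q \<odot>\<^bsub>D\<^esub> ?P)"
    using d_lin C M \<kappa> unit_rmodule rmodule_tens_closed[OF \<kappa> M] by (simp add: D_hom D_simps rmodule_tens_eq)
  moreover have "(\<iota>\<^bsub>D\<^esub> ?Q \<otimes>\<^bsub>D\<^esub> ?e) \<cdot>\<^bsub>D\<^esub> (?d \<otimes>\<^bsub>D\<^esub> \<iota>\<^bsub>D\<^esub> ?Q) = \<iota>\<^bsub>D\<^esub> ?Q"
    "(?e \<otimes>\<^bsub>D\<^esub> \<iota>\<^bsub>D\<^esub> ?P) \<cdot>\<^bsub>D\<^esub> (\<iota>\<^bsub>D\<^esub> ?P \<otimes>\<^bsub>D\<^esub> ?d) = \<iota>\<^bsub>D\<^esub> ?P"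
    using C M \<kappa> by (simp_all add: D_simps unit_tens)
  ultimately have "is_left_dual D ?Q ?P ?e ?d" using PQ by (simp add: is_left_dual_def)
  with \<kappa> PM show ?thesis by blast
qed

section \<open>The braiding on the category of modules\<close>

abbreviation "\<Omega> \<equiv> rmod_braiding C \<Phi> H R"

lemma \<Omega>_hom: "P \<in> Obj D \<Longrightarrow> Q \<in> Obj D \<Longrightarrow> \<Omega> P Q \<in> Hom D (P \<odot>\<^bsub>D\<^esub> Q) (Q \<odot>\<^bsub>D\<^esub> P)"
proof -
  assume "P \<in> Obj D" "Q \<in> Obj D"
  then obtain M \<nu> N \<mu> where P: "P = (M, \<nu>)" "Q = (N, \<mu>)" and M: "is_rmodule C H (M, \<nu>)" and N: "is_rmodule C H (N, \<mu>)"
    by (cases P; cases Q) (auto simp: D_simps)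
  then show ?thesis
    using repr_hom[OF mod_braid_repr[OF rmodule_rules(2)[OF M] rmodule_rules(2)[OF N]]]
      mod_braid_linear[OF M N] rmodule_tens_closed[OF M N] rmodule_tens_closed[OF N M]
    by (simp add: D_hom D_simps rmod_braiding_eq rmodule_tens_eq)
qed

lemma \<Omega>_natural:
  assumes F: "F \<in> Hom D P P'" and G: "G \<in> Hom D Q Q'"
  shows "\<Omega> P' Q' \<cdot>\<^bsub>D\<^esub> (F \<otimes>\<^bsub>D\<^esub> G) = (G \<otimes>\<^bsub>D\<^esub> F) \<cdot>\<^bsub>D\<^esub> \<Omega> P Q"
proof -
  obtain M \<nu> M' \<nu>' N \<mu> N' \<mu>' where *: "P = (M, \<nu>)" "P' = (M', \<nu>')" "Q = (N, \<mu>)" "Q' = (N', \<mu>')"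
    by (metis surj_pair)
  from F G obtain f g where **: "F = (P, f, P')" "G = (Q, g, Q')"
    and mods: "is_rmodule C H (M, \<nu>)" "is_rmodule C H (M', \<nu>')" "is_rmodule C H (N, \<mu>)" "is_rmodule C H (N', \<mu>')"
    and f: "f \<in> Hom C M M'" "f \<cdot> \<nu> = \<nu>' \<cdot> (f \<otimes> \<iota> h)"
    and g: "g \<in> Hom C N N'" "g \<cdot> \<mu> = \<mu>' \<cdot> (g \<otimes> \<iota> h)"
    unfolding D_hom by (auto simp: *)
  show ?thesis
    using mod_braid_natural[OF mods(1,2) f mods(3,4) g]
    by (simp add: * ** D_simps rmod_braiding_eq rmodule_tens_eq)
qed

lemma \<Omega>_hexagon:
  assumes "P \<in> Obj D" "Q \<in> Obj D" "S \<in> Obj D"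
  shows "\<Omega> (P \<odot>\<^bsub>D\<^esub> Q) S = (\<Omega> P S \<otimes>\<^bsub>D\<^esub> \<iota>\<^bsub>D\<^esub> Q) \<cdot>\<^bsub>D\<^esub> (\<iota>\<^bsub>D\<^esub> P \<otimes>\<^bsub>D\<^esub> \<Omega> Q S)"
    and "\<Omega> P (Q \<odot>\<^bsub>D\<^esub> S) = (\<iota>\<^bsub>D\<^esub> Q \<otimes>\<^bsub>D\<^esub> \<Omega> P S) \<cdot>\<^bsub>D\<^esub> (\<Omega> P Q \<otimes>\<^bsub>D\<^esub> \<iota>\<^bsub>D\<^esub> S)"
proof -
  obtain M \<nu> N \<mu> T \<pi> where *: "P = (M, \<nu>)" "Q = (N, \<mu>)" "S = (T, \<pi>)" by (metis surj_pair)
  then have mods: "is_rmodule C H (M, \<nu>)" "is_rmodule C H (N, \<mu>)" "is_rmodule C H (T, \<pi>)"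
    using assms by (simp_all add: D_simps)
  note a = D.assoc_obj[OF assms] D.assoc_obj[OF assms(3,1,2)] D.assoc_obj[OF assms(1,3,2)] D.assoc_obj[OF assms(2,3,1)]
    D.assoc_obj[OF assms(2,1,3)]
  show "\<Omega> (P \<odot>\<^bsub>D\<^esub> Q) S = (\<Omega> P S \<otimes>\<^bsub>D\<^esub> \<iota>\<^bsub>D\<^esub> Q) \<cdot>\<^bsub>D\<^esub> (\<iota>\<^bsub>D\<^esub> P \<otimes>\<^bsub>D\<^esub> \<Omega> Q S)"
    "\<Omega> P (Q \<odot>\<^bsub>D\<^esub> S) = (\<iota>\<^bsub>D\<^esub> Q \<otimes>\<^bsub>D\<^esub> \<Omega> P S) \<cdot>\<^bsub>D\<^esub> (\<Omega> P Q \<otimes>\<^bsub>D\<^esub> \<iota>\<^bsub>D\<^esub> S)"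
    using mod_braid_hexagon[OF mods] a by (simp_all add: * D_simps rmod_braiding_eq rmodule_tens_eq)
qed

lemma \<Omega>_unit: "P \<in> Obj D \<Longrightarrow> \<Omega> P \<I>\<^bsub>D\<^esub> = \<iota>\<^bsub>D\<^esub> P"
proof -
  assume P: "P \<in> Obj D"
  then obtain M \<nu> where *: "P = (M, \<nu>)" and M: "is_rmodule C H (M, \<nu>)" by (cases P) (auto simp: D_simps)
  show ?thesis
    using mod_braid_unit[OF M] D.unit_obj_left[OF P] D.unit_obj_right[OF P]
    by (simp add: * D_simps rmod_braiding_eq rmodule_tens_eq)
qed

text \<open>For fixed P the family of \<Omega> with first argument P satisfies the premises of
  \<open>half_braiding_iso\<close>, so an object \<open>Q'\<close> having Q as its left dual yields
  the inverse.\<close>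

lemma \<Omega>_iso:
  assumes P: "P \<in> Obj D" and Q: "Q \<in> Obj D"
  shows "is_iso D (\<Omega> P Q)"
proof -
  have "is_rmodule C H Q" using Q by (simp add: D_simps)
  from right_dual_exists[OF this] obtain Q' e d where Q': "is_rmodule C H Q'" "is_left_dual D Q' Q e d"
    by blast
  show ?thesis
  proof (rule D.half_braiding_iso[of P "\<Omega> P" Q Q' e d])
    show "\<Omega> P S \<in> Hom D (P \<odot>\<^bsub>D\<^esub> S) (S \<odot>\<^bsub>D\<^esub> P)" if "S \<in> Obj D" for S using \<Omega>_hom P that by simp
    show "\<Omega> P T \<cdot>\<^bsub>D\<^esub> (\<iota>\<^bsub>D\<^esub> P \<otimes>\<^bsub>D\<^esub> F) = (F \<otimes>\<^bsub>D\<^esub> \<iota>\<^bsub>D\<^esub> P) \<cdot>\<^bsub>D\<^esub> \<Omega> P S" if "F \<in> Hom D S T" for S T F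
      using \<Omega>_natural[OF D.id_hom[OF P] that] .
    show "\<Omega> P (S \<odot>\<^bsub>D\<^esub> T) = (\<iota>\<^bsub>D\<^esub> S \<otimes>\<^bsub>D\<^esub> \<Omega> P T) \<cdot>\<^bsub>D\<^esub> (\<Omega> P S \<otimes>\<^bsub>D\<^esub> \<iota>\<^bsub>D\<^esub> T)" if "S \<in> Obj D" "T \<in> Obj D" for S T
      using \<Omega>_hexagon(2)[OF P that] .
    show "\<Omega> P \<I>\<^bsub>D\<^esub> = \<iota>\<^bsub>D\<^esub> P" using \<Omega>_unit[OF P] .
    show "Q' \<in> Obj D" "is_left_dual D Q' Q e d" "P \<in> Obj D" "Q \<in> Obj D"
      using Q' P Q by (simp_all add: D_simps)
  qed
qed

theorem braided_rmod: "braided_monoidal_category D \<Omega>"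
  by unfold_locales (use \<Omega>_hom \<Omega>_iso \<Omega>_natural \<Omega>_hexagon in auto)

theorem rigid_rmod: "Defs.rigid D"
proof -
  interpret DB: braided_monoidal_category D \<Omega> by (rule braided_rmod)
  have "(\<exists>Q e d. is_left_dual D P Q e d) \<and> (\<exists>Q \<in> Obj D. \<exists>e d. is_left_dual D Q P e d)" if P: "P \<in> Obj D" for P
  proof -
    have "is_rmodule C H P" using P by (simp add: D_simps)
    from right_dual_exists[OF this] obtain Q e d where Q: "Q \<in> Obj D" "is_left_dual D Q P e d"
      unfolding D_simps by blast
    then show ?thesis using DB.left_dual_of_right_dual[OF Q(2,1)] by blast
  qed
  then show ?thesis by (simp add: rigid_def)
qed

end

subsection \<open>Modules over the bosonization\<close>

text \<open>The comparison is made for any \<open>B\<close> with linear structure morphisms and unit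
  laws; the coend is substituted in the final proof. The unit laws are what separates an action of
  the bosonization into two.\<close>

locale bosonization_modules = quasitriangular_hopf_modules C \<Phi> H R
  for C :: "('o, 'a, 'z) moncat_scheme" (structure) and \<Phi> and H :: "('o, 'a, 'x) hopf_scheme" and R +
  fixes B :: "('o \<times> 'a, ('o \<times> 'a) \<times> 'a \<times> ('o \<times> 'a), 'y) bialg_scheme"
  assumes B_obj: "carr B \<in> Obj (rmod C \<Phi> H)"
    and B_mlt: "mlt B \<in> Hom (rmod C \<Phi> H) (carr B \<odot>\<^bsub>rmod C \<Phi> H\<^esub> carr B) (carr B)"
    and B_unt: "unt B \<in> Hom (rmod C \<Phi> H) \<I>\<^bsub>rmod C \<Phi> H\<^esub> (carr B)"
    and B_cml: "cml B \<in> Hom (rmod C \<Phi> H) (carr B) (carr B \<odot>\<^bsub>rmod C \<Phi> H\<^esub> carr B)"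
    and B_cnt: "cnt B \<in> Hom (rmod C \<Phi> H) (carr B) \<I>\<^bsub>rmod C \<Phi> H\<^esub>"
    and B_unit_left: "mlt B \<cdot>\<^bsub>rmod C \<Phi> H\<^esub> (unt B \<otimes>\<^bsub>rmod C \<Phi> H\<^esub> \<iota>\<^bsub>rmod C \<Phi> H\<^esub> (carr B)) =
      \<iota>\<^bsub>rmod C \<Phi> H\<^esub> (carr B)"
    and B_unit_right: "mlt B \<cdot>\<^bsub>rmod C \<Phi> H\<^esub> (\<iota>\<^bsub>rmod C \<Phi> H\<^esub> (carr B) \<otimes>\<^bsub>rmod C \<Phi> H\<^esub> unt B) =
      \<iota>\<^bsub>rmod C \<Phi> H\<^esub> (carr B)"
begin

abbreviation "b \<equiv> fst (carr B)"
abbreviation "act \<equiv> snd (carr B)"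
abbreviation "act_bx \<equiv> ([b, h], act, [b])"
abbreviation "mb_bx \<equiv> ([b, b], und (mlt B), [b])"
abbreviation "ub_bx \<equiv> ([], und (unt B), [b])"
abbreviation "db_bx \<equiv> ([b], und (cml B), [b, b])"
abbreviation "eb_bx \<equiv> ([b], und (cnt B), [])"

lemma B_module: "is_rmodule C H (b, act)"
  using B_obj by (simp add: D_simps)

lemmas act_rules = rmodule_rules[OF B_module]

lemma und_simp [simp]: "und (P, f, Q) = f"
  by (simp add: und_def)

lemma carr_tens: "rmodule_tens C \<Phi> H (carr B) (carr B) = (b \<odot> b, tens_action b act b act)"
  using rmodule_tens_eq[of b act b act] by simp

lemma B_eqs:
  "mlt B = (rmodule_tens C \<Phi> H (carr B) (carr B), und (mlt B), carr B)"
  "unt B = ((\<I>, cnt H), und (unt B), carr B)"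
  "cml B = (carr B, und (cml B), rmodule_tens C \<Phi> H (carr B) (carr B))"
  "cnt B = (carr B, und (cnt B), (\<I>, cnt H))"
  using B_mlt B_unt B_cml B_cnt by (auto simp: D_hom D_simps)

lemma B_homs:
  "und (mlt B) \<in> Hom C (b \<odot> b) b" "und (unt B) \<in> Hom C \<I> b"
  "und (cml B) \<in> Hom C b (b \<odot> b)" "und (cnt B) \<in> Hom C b \<I>"
  "und (unt B) \<cdot> cnt H = act \<cdot> (und (unt B) \<otimes> \<iota> h)"
  using B_mlt B_unt B_cml B_cnt by (auto simp: D_hom D_simps carr_tens)

lemma mb_box: "is_box mb_bx" and ub_box: "is_box ub_bx" and db_box: "is_box db_bx" and eb_box: "is_box eb_bx"
  using B_homs act_rules(1) by (auto simp: is_box_def)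

lemmas B_boxes = R_boxes act_rules(2) mb_box ub_box db_box eb_box

lemma B_unt_linear: "good ([h], [(0, ub_bx), (0, act_bx)], [(0, e_bx), (0, ub_bx)])"
  by (rule goodI[OF B_homs(5)[symmetric]]) (rule reprs B_boxes repr_box | simp add: act_rules(1))+

lemma B_unit_rules: "good ([b], [(0, ub_bx), (0, mb_bx)], [])" "good ([b], [(1, ub_bx), (0, mb_bx)], [])"
proof -
  have eq: "und (mlt B) \<cdot> (und (unt B) \<otimes> \<iota> b) = \<iota> b" "und (mlt B) \<cdot> (\<iota> b \<otimes> und (unt B)) = \<iota> b"
  proof -
    obtain m u where "mlt B = (rmodule_tens C \<Phi> H (carr B) (carr B), m, carr B)" "unt B = ((\<I>, cnt H), u, carr B)"
      using B_eqs(1,2) by blast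
    then show "und (mlt B) \<cdot> (und (unt B) \<otimes> \<iota> b) = \<iota> b" "und (mlt B) \<cdot> (\<iota> b \<otimes> und (unt B)) = \<iota> b"
      using B_unit_left B_unit_right by (simp_all add: D_simps)
  qed
  show "good ([b], [(0, ub_bx), (0, mb_bx)], [])"
    by (rule goodI[OF eq(1)]) (rule reprs B_boxes repr_box | simp add: act_rules(1))+
  show "good ([b], [(1, ub_bx), (0, mb_bx)], [])"
    by (rule goodI[OF eq(2)]) (rule reprs B_boxes repr_box | simp add: act_rules(1))+
qed

text \<open>The known notion behind this formula is a B-module in the category of H-modules,
  expressed in C by the action \<nu> of H and the H-linear action \<open>a\<close> of B.\<close>

definition bos_module :: "'o \<Rightarrow> 'a \<Rightarrow> 'a \<Rightarrow> bool" where
  "bos_module M \<nu> a \<longleftrightarrow> is_rmodule C H (M, \<nu>) \<and> a \<in> Hom C (M \<odot> b) M \<and>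
     a \<cdot> tens_action M \<nu> b act = \<nu> \<cdot> (a \<otimes> \<iota> h) \<and>
     a \<cdot> (a \<otimes> \<iota> b) = a \<cdot> (\<iota> M \<otimes> und (mlt B)) \<and> a \<cdot> (\<iota> M \<otimes> und (unt B)) = \<iota> M"

lemma bos_module_iff: "is_rmodule D B (P, \<alpha>) \<longleftrightarrow>
    bos_module (fst P) (snd P) (und \<alpha>) \<and> \<alpha> = (rmodule_tens C \<Phi> H P (carr B), und \<alpha>, P)"
proof -
  obtain M \<nu> where P: "P = (M, \<nu>)" by (cases P)
  have tens: "rmodule_tens C \<Phi> H P (carr B) = (M \<odot> b, tens_action M \<nu> b act)"
    using rmodule_tens_eq[of M \<nu> b act] by (simp add: P)
  obtain m u where m: "mlt B = (rmodule_tens C \<Phi> H (carr B) (carr B), m, carr B)" and u: "unt B = ((\<I>, cnt H), u, carr B)"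
    using B_eqs(1,2) by blast
  have *: "rmodule_tens C \<Phi> H (rmodule_tens C \<Phi> H P (carr B)) (carr B) =
      rmodule_tens C \<Phi> H P (rmodule_tens C \<Phi> H (carr B) (carr B))"
    "rmodule_tens C \<Phi> H P (\<I>, cnt H) = P" if "is_rmodule C H P"
    using D.assoc_obj[of P "carr B" "carr B"] D.unit_obj_right[of P] that B_obj by (simp_all add: D_simps)
  show ?thesis
  proof
    assume mod: "is_rmodule D B (P, \<alpha>)"
    then have Pm: "is_rmodule C H P" and "\<alpha> \<in> Hom D (P \<odot>\<^bsub>D\<^esub> carr B) P" by (auto simp: is_rmodule_def D_simps)
    then obtain a where \<alpha>: "\<alpha> = (rmodule_tens C \<Phi> H P (carr B), a, P)" and a: "a \<in> Hom C (M \<odot> b) M"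
      "a \<cdot> tens_action M \<nu> b act = \<nu> \<cdot> (a \<otimes> \<iota> h)"
      using tens by (auto simp: D_hom D_simps P)
    from mod have "\<alpha> \<cdot>\<^bsub>D\<^esub> (\<alpha> \<otimes>\<^bsub>D\<^esub> \<iota>\<^bsub>D\<^esub> (carr B)) = \<alpha> \<cdot>\<^bsub>D\<^esub> (\<iota>\<^bsub>D\<^esub> P \<otimes>\<^bsub>D\<^esub> mlt B)"
      "\<alpha> \<cdot>\<^bsub>D\<^esub> (\<iota>\<^bsub>D\<^esub> P \<otimes>\<^bsub>D\<^esub> unt B) = \<iota>\<^bsub>D\<^esub> P" by (auto simp: is_rmodule_def)
    then have "a \<cdot> (a \<otimes> \<iota> b) = a \<cdot> (\<iota> M \<otimes> und (mlt B))" "a \<cdot> (\<iota> M \<otimes> und (unt B)) = \<iota> M"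
      by (simp_all add: m u \<alpha> D_simps P)
    then show "bos_module (fst P) (snd P) (und \<alpha>) \<and> \<alpha> = (rmodule_tens C \<Phi> H P (carr B), und \<alpha>, P)"
      using Pm a by (simp add: bos_module_def \<alpha> P)
  next
    assume r: "bos_module (fst P) (snd P) (und \<alpha>) \<and> \<alpha> = (rmodule_tens C \<Phi> H P (carr B), und \<alpha>, P)"
    then obtain a where \<alpha>: "\<alpha> = (rmodule_tens C \<Phi> H P (carr B), a, P)" and a: "bos_module M \<nu> a" by (auto simp: P)
    then have Pm: "is_rmodule C H P" by (simp add: bos_module_def P)
    have "is_rmodule C H (rmodule_tens C \<Phi> H P (carr B))"
      unfolding tens using rmodule_tens_closed Pm B_module by (simp add: P)
    then have "\<alpha> \<in> Hom D (P \<odot>\<^bsub>D\<^esub> carr B) P"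
      using Pm a tens by (simp add: D_hom D_simps \<alpha> bos_module_def P)
    moreover have "\<alpha> \<cdot>\<^bsub>D\<^esub> (\<alpha> \<otimes>\<^bsub>D\<^esub> \<iota>\<^bsub>D\<^esub> (carr B)) = \<alpha> \<cdot>\<^bsub>D\<^esub> (\<iota>\<^bsub>D\<^esub> P \<otimes>\<^bsub>D\<^esub> mlt B)"
      using a *[OF Pm] by (simp add: m u \<alpha> D_simps bos_module_def P)
    moreover have "\<alpha> \<cdot>\<^bsub>D\<^esub> (\<iota>\<^bsub>D\<^esub> P \<otimes>\<^bsub>D\<^esub> unt B) = \<iota>\<^bsub>D\<^esub> P"
      using a *[OF Pm] by (simp add: m u \<alpha> D_simps bos_module_def P)
    ultimately show "is_rmodule D B (P, \<alpha>)"
      using Pm by (simp add: is_rmodule_def[of D B] D_simps(1))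
  qed
qed

lemma bos_moduleD:
  assumes "bos_module M \<nu> a"
  shows "is_rmodule C H (M, \<nu>)" "is_box ([M, b], a, [M])"
    "good ([M, b, h], [(0, [M, b], a, [M]), (0, [M, h], \<nu>, [M])],
      [(2, d_bx), (1, crossing b h), (0, [M, h], \<nu>, [M]), (1, act_bx), (0, [M, b], a, [M])])"
    "good ([M, b, b], [(0, [M, b], a, [M]), (0, [M, b], a, [M])], [(1, mb_bx), (0, [M, b], a, [M])])"
    "good ([M], [(1, ub_bx), (0, [M, b], a, [M])], [])"
proof -
  show M: "is_rmodule C H (M, \<nu>)" using assms by (simp add: bos_module_def)
  note M = rmodule_rules[OF M]
  note [simp] = M(1) act_rules(1)
  show ab: "is_box ([M, b], a, [M])" using assms by (simp add: bos_module_def is_box_def)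
  have eq: "\<nu> \<cdot> (a \<otimes> \<iota> h) = a \<cdot> tens_action M \<nu> b act" "a \<cdot> (a \<otimes> \<iota> b) = a \<cdot> (\<iota> M \<otimes> und (mlt B))"
    "a \<cdot> (\<iota> M \<otimes> und (unt B)) = \<iota> M"
    using assms by (auto simp: bos_module_def)
  note r = reprs B_boxes ab M(2)
  show "good ([M, b, h], [(0, [M, b], a, [M]), (0, [M, h], \<nu>, [M])],
      [(2, d_bx), (1, crossing b h), (0, [M, h], \<nu>, [M]), (1, act_bx), (0, [M, b], a, [M])])"
    using eq(1) unfolding tens_action_def by (rule goodI) (rule r repr_box | simp)+
  show "good ([M, b, b], [(0, [M, b], a, [M]), (0, [M, b], a, [M])], [(1, mb_bx), (0, [M, b], a, [M])])"
    by (rule goodI[OF eq(2)]) (rule r repr_box | simp)+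
  show "good ([M], [(1, ub_bx), (0, [M, b], a, [M])], [])"
    by (rule goodI[OF eq(3)]) (rule r repr_box | simp)+
qed

abbreviation "K \<equiv> bosonization C \<Phi> H R B"

lemma carr_K: "carr K = h \<odot> b"
  by (simp add: bosonization_def Let_def)

lemma mlt_K_repr: "repr (mlt K) [h, b, h, b]
    [(2, d_bx), (1, crossing b h), (2, act_bx), (0, m_bx), (1, mb_bx)] [h, b]"
proof -
  note [simp] = act_rules(1)
  show ?thesis
    unfolding bosonization_def Let_def bialg.simps
    by (rule repr_cong) (rule reprs B_boxes repr_box | simp)+
qed

lemma unt_K_repr: "repr (unt K) [] [(0, u_bx), (1, ub_bx)] [h, b]"
  unfolding bosonization_def Let_def bialg.simps
  by (rule repr_cong) (rule reprs B_boxes repr_box | simp)+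

lemma cml_K_repr: "repr (cml K) [h, b]
    [(1, db_bx), (0, d_bx), (3, R_bx), (2, act_bx), (1, crossing h b), (2, m_bx)] [h, b, h, b]"
proof -
  note [simp] = act_rules(1)
  show ?thesis
    unfolding bosonization_def Let_def bialg.simps
    by (rule repr_cong) (rule reprs B_boxes repr_box | simp)+
qed

text \<open>Drawing the carrier of the bosonization as two strands turns the module axioms into
  rules that certificates can use.\<close>

lemma rmodule_K_iff: "is_rmodule C K (M, \<beta>) \<longleftrightarrow> is_box ([M, h, b], \<beta>, [M]) \<and>
    good ([M, h, b, h, b], [(0, [M, h, b], \<beta>, [M]), (0, [M, h, b], \<beta>, [M])],
      [(3, d_bx), (2, crossing b h), (3, act_bx), (1, m_bx), (2, mb_bx), (0, [M, h, b], \<beta>, [M])]) \<and>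
    good ([M], [(1, u_bx), (2, ub_bx), (0, [M, h, b], \<beta>, [M])], [])"
proof (cases "is_box ([M, h, b], \<beta>, [M])")
  case True
  then have [simp]: "M \<in> Obj C" by (simp add: is_box_def)
  note [simp] = act_rules(1)
  note r = reprs B_boxes True mlt_K_repr unt_K_repr
  have "repr (\<beta> \<cdot> (\<beta> \<otimes> \<iota> (h \<odot> b))) [M, h, b, h, b] [(0, [M, h, b], \<beta>, [M]), (0, [M, h, b], \<beta>, [M])] [M]"
    "repr (\<beta> \<cdot> (\<iota> M \<otimes> mlt K)) [M, h, b, h, b]
      [(3, d_bx), (2, crossing b h), (3, act_bx), (1, m_bx), (2, mb_bx), (0, [M, h, b], \<beta>, [M])] [M]"
    "repr (\<beta> \<cdot> (\<iota> M \<otimes> unt K)) [M] [(1, u_bx), (2, ub_bx), (0, [M, h, b], \<beta>, [M])] [M]"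
    "repr (\<iota> M) [M] [] [M]"
    by (rule repr_cong, (rule r repr_box | simp)+)+
  then show ?thesis
    using True by (auto simp: is_rmodule_def carr_K is_box_def good_def repr_def)
qed (auto simp: is_rmodule_def carr_K is_box_def h_obj act_rules(1))

lemma bos_action_repr:
  assumes "bos_module M \<nu> a"
  shows "repr (a \<cdot> (\<nu> \<otimes> \<iota> b)) [M, h, b] [(0, [M, h], \<nu>, [M]), (0, [M, b], a, [M])] [M]"
proof -
  note M = rmodule_rules[OF bos_moduleD(1)[OF assms]] and ab = bos_moduleD(2)[OF assms]
  note [simp] = M(1) act_rules(1)
  show ?thesis by (rule repr_cong) (rule reprs ab M(2) repr_box | simp)+
qed

text \<open>In the product of two actions the second factor of H has to pass the first factor of B.
  The linearity of \<open>a\<close> does this by \<Delta> and the action on B, as the multiplication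
  of the bosonization prescribes. The last two claims recover \<nu> and \<open>a\<close> by
  inserting units, and give injectivity on objects.\<close>

lemma bos_to_K:
  assumes bos_module: "bos_module M \<nu> a"
  shows "is_rmodule C K (M, a \<cdot> (\<nu> \<otimes> \<iota> b))"
    "(a \<cdot> (\<nu> \<otimes> \<iota> b)) \<cdot> (\<iota> M \<otimes> \<iota> h \<otimes> und (unt B)) = \<nu>"
    "(a \<cdot> (\<nu> \<otimes> \<iota> b)) \<cdot> (\<iota> M \<otimes> unt H \<otimes> \<iota> b) = a"
proof -
  note ab = bos_moduleD(2)[OF bos_module] and lin = bos_moduleD(3)[OF bos_module] and aa = bos_moduleD(4)[OF bos_module] and au = bos_moduleD(5)[OF bos_module]
  note M = rmodule_rules[OF bos_moduleD(1)[OF bos_module]]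
  note [simp] = M(1) act_rules(1) and bx = H_boxes act_rules(2) mb_box ub_box ab M(2)
  define \<beta> where "\<beta> = a \<cdot> (\<nu> \<otimes> \<iota> b)"
  note br = bos_action_repr[OF bos_module, folded \<beta>_def]
  note bb = repr_is_box[OF br]
  have be: "good ([M, h, b], [(0, [M, h, b], \<beta>, [M])], [(0, [M, h], \<nu>, [M]), (0, [M, b], a, [M])])"
    by (rule goodI[OF refl repr_box[OF bb] br]) auto
  have ass: "good ([M, h, b, h, b], [(0, [M, h], \<nu>, [M]), (0, [M, b], a, [M]), (0, [M, h], \<nu>, [M]), (0, [M, b], a, [M])],
     [(3, d_bx), (2, crossing b h), (3, act_bx), (1, m_bx), (2, mb_bx), (0, [M, h], \<nu>, [M]), (0, [M, b], a, [M])])"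
    by (rule good_run[OF good_Cons[OF lin good_Cons[OF M(3) good_Cons[OF aa good_Nil]]],
      where ms = "[Rw 0 1 0, SR 0, SR 1, SR 3, SR 2, Rw 1 3 0, SL 2, SL 3, Rw 2 5 0, SR 3, SR 4, SR
        2]"])
      (rule diag_step diag.dNil crossing_box bx | simp)+
  have "good ([M, h, b, h, b], [(0, [M, h, b], \<beta>, [M]), (0, [M, h, b], \<beta>, [M])],
      [(3, d_bx), (2, crossing b h), (3, act_bx), (1, m_bx), (2, mb_bx), (0, [M, h, b], \<beta>, [M])])"
    by (rule good_run[OF good_Cons[OF be good_Cons[OF ass good_Nil]], where ms = "[Rw 0 0 0, Rw 0 2 0, Rw 1 0 0, Bw 0 5 0]"])
      (rule diag_step diag.dNil crossing_box bx bb | simp)+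
  moreover have unt: "good ([M], [(1, u_bx), (2, ub_bx), (0, [M, h], \<nu>, [M]), (0, [M, b], a, [M])], [])"
    by (rule good_run[OF good_Cons[OF M(4) good_Cons[OF au good_Nil]],
      where ms = "[SR 0, Rw 0 1 0, Rw 1 0 0]"])
      (rule diag_step diag.dNil crossing_box bx | simp)+
  have "good ([M], [(1, u_bx), (2, ub_bx), (0, [M, h, b], \<beta>, [M])], [])"
    by (rule good_run[OF good_Cons[OF be good_Cons[OF unt good_Nil]], where ms = "[Rw 0 2 0, Rw 1 0 0]"])
      (rule diag_step diag.dNil crossing_box bx bb | simp)+
  ultimately show "is_rmodule C K (M, a \<cdot> (\<nu> \<otimes> \<iota> b))"
    using bb rmodule_K_iff by (simp add: \<beta>_def)
  note r = reprs B_boxes ab M(2)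
  have gn: "good ([M, h], [(2, ub_bx), (0, [M, h], \<nu>, [M]), (0, [M, b], a, [M])], [(0, [M, h], \<nu>, [M])])"
    by (rule good_run[OF good_Cons[OF au good_Nil],
      where ms = "[SL 0, Rw 0 1 0]"])
      (rule diag_step diag.dNil crossing_box bx | simp)+
  show "(a \<cdot> (\<nu> \<otimes> \<iota> b)) \<cdot> (\<iota> M \<otimes> \<iota> h \<otimes> und (unt B)) = \<nu>"
    by (rule good_eq[OF gn]; rule repr_cong) (rule r repr_box | simp)+
  have ga: "good ([M, b], [(1, u_bx), (0, [M, h], \<nu>, [M]), (0, [M, b], a, [M])], [(0, [M, b], a, [M])])"
    by (rule good_run[OF good_Cons[OF M(4) good_Nil],
      where ms = "[Rw 0 0 0]"])
      (rule diag_step diag.dNil crossing_box bx | simp)+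
  show "(a \<cdot> (\<nu> \<otimes> \<iota> b)) \<cdot> (\<iota> M \<otimes> unt H \<otimes> \<iota> b) = a"
    by (rule good_eq[OF ga]; rule repr_cong) (rule r repr_box | simp)+
qed

text \<open>In elements, \<nu> and \<open>a\<close> are the actions of h \<otimes> 1 and 1 \<otimes>
  b. The axioms to be verified are products of such elements, computed with the multiplication of
  the bosonization and the unit laws.\<close>

lemma K_to_bos:
  assumes mod: "is_rmodule C K (M, \<beta>)"
  defines "\<nu> \<equiv> \<beta> \<cdot> (\<iota> M \<otimes> \<iota> h \<otimes> und (unt B))" and "a \<equiv> \<beta> \<cdot> (\<iota> M \<otimes> unt H \<otimes> \<iota> b)"
  shows "bos_module M \<nu> a" "a \<cdot> (\<nu> \<otimes> \<iota> b) = \<beta>"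
proof -
  have bb: "is_box ([M, h, b], \<beta>, [M])"
    and ba: "good ([M, h, b, h, b], [(0, [M, h, b], \<beta>, [M]), (0, [M, h, b], \<beta>, [M])],
      [(3, d_bx), (2, crossing b h), (3, act_bx), (1, m_bx), (2, mb_bx), (0, [M, h, b], \<beta>, [M])])"
    and bu: "good ([M], [(1, u_bx), (2, ub_bx), (0, [M, h, b], \<beta>, [M])], [])"
    using mod rmodule_K_iff by auto
  then have M [simp]: "M \<in> Obj C" by (simp add: is_box_def)
  note b = act_rules(1)
  note [simp] = b and bx = H_boxes act_rules(2) mb_box ub_box bb
  note r = reprs B_boxes bb
  have \<nu>: "repr \<nu> [M, h] [(2, ub_bx), (0, [M, h, b], \<beta>, [M])] [M]" and a: "repr a [M, b] [(1, u_bx), (0, [M, h, b], \<beta>, [M])] [M]"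
    unfolding \<nu>_def a_def by (rule repr_cong, (rule r repr_box | simp)+)+
  note r' = reprs B_boxes \<nu> a
  \<comment> \<open>The product of h \<otimes> 1 and 1 \<otimes> b is h \<otimes> b, so the combined
    action is determined by \<nu> and \<open>a\<close>.\<close>
  have dec: "good ([M, h, b], [(2, ub_bx), (0, [M, h, b], \<beta>, [M]), (1, u_bx), (0, [M, h, b], \<beta>, [M])], [(0, [M, h, b], \<beta>, [M])])"
    by (rule good_run[OF good_Cons[OF ba good_Cons[OF cml_unt_rule good_Cons[OF act_rules(4) good_Cons[OF
        natural_left[OF ub_box h_obj] good_Cons[OF unit_rule(2) good_Cons[OF B_unit_rules(1) good_Nil]]]]]],
      where ms = "[SR 1, Rw 0 2 0, SL 4, Rw 1 1 3, SL 2, SL 3, Rw 2 4 2, SR 0, Rw 3 1 2, SR 0, SR 2, SR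
        1, Rw 4 2 1, Rw 5 0 2]"])
      (rule diag_step diag.dNil crossing_box bx | simp)+
  show "a \<cdot> (\<nu> \<otimes> \<iota> b) = \<beta>"
    by (rule good_eq[OF dec]; rule repr_cong) (rule r' bb repr_box | simp)+
  \<comment> \<open>The product of h \<otimes> 1 and h' \<otimes> 1 is hh' \<otimes> 1, because H
    acts on the unit of B through the counit.\<close>
  have nua: "good ([M, h, h], [(2, ub_bx), (0, [M, h, b], \<beta>, [M]), (2, ub_bx), (0, [M, h, b], \<beta>, [M])],
     [(1, m_bx), (2, ub_bx), (0, [M, h, b], \<beta>, [M])])"
    by (rule good_run[OF good_Cons[OF ba good_Cons[OF natural_left[OF ub_box h_obj] good_Cons[OF B_unt_linear
        good_Cons[OF counit_rule(2) good_Cons[OF unit_rule(2) good_Cons[OF act_rules(4) good_Cons[OF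
        cml_unt_rule good_Cons[OF dec good_Nil]]]]]]]],
      where ms = "[SR 1, Rw 0 2 0, SL 1, SL 2, SL 3, SL 4, SL 3, SR 0, SR 4, SR 3, SR 2, SR 1, Rw 1 2 2,
        SL 1, SL 2, SL 1, SR 2, Rw 2 3 2, SL 2, SL 2, SL 3, SL 2, SR 3, SR 2, SR 1, Rw 3 0 2, Bw 4 4 1,
        SL 3, SL 4, SL 2, SL 3, SL 1, SR 3, SR 2, Bw 1 3 2, SL 2, SL 3, SL 4, SL 1, Bw 5 6 2, SL 5, SR
        4, SR 5, SR 3, SR 4, SR 3, SR 2, Bw 6 3 3, SL 2, SL 3, SL 4, SL 5, SL 6, SR 5, SR 6, SR 5, SR 4,
        SR 3, Bw 0 4 0, SL 3, SL 2, SR 3, SR 2, SR 1, Rw 7 2 0]"])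
      (rule diag_step diag.dNil crossing_box bx | simp)+
  have nuu: "good ([M], [(1, u_bx), (2, ub_bx), (0, [M, h, b], \<beta>, [M])], [])"
    by (rule good_run[OF good_Cons[OF bu good_Nil],
      where ms = "[Rw 0 0 0]"])
      (rule diag_step diag.dNil crossing_box bx | simp)+
  \<comment> \<open>In the product of 1 \<otimes> b and h \<otimes> 1, h is moved past b by \<Delta>
    and the action on b: this smash product relation is the linearity of \<open>a\<close>.\<close>
  have alin: "good ([M, b, h], [(1, u_bx), (0, [M, h, b], \<beta>, [M]), (2, ub_bx), (0, [M, h, b], \<beta>, [M])],
     [(2, d_bx), (1, crossing b h), (2, ub_bx), (0, [M, h, b], \<beta>, [M]), (1, act_bx), (1, u_bx), (0, [M, h, b], \<beta>, [M])])"
    by (rule good_run[OF good_Cons[OF ba good_Cons[OF unit_rule(1) good_Cons[OF B_unit_rules(2) good_Cons[OF dec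
        good_Nil]]]],
      where ms = "[SR 1, Rw 0 2 0, SL 1, SL 2, SL 3, SL 4, SL 3, SR 0, SR 1, SR 3, SR 2, SR 4, SR 3, SR
        5, SR 4, Rw 1 5 1, Rw 2 3 2, Bw 3 3 0, SL 2, SL 3]"])
      (rule diag_step diag.dNil crossing_box bx | simp)+
  \<comment> \<open>The product of 1 \<otimes> b and 1 \<otimes> b' is 1 \<otimes> bb', because the
    unit of H acts trivially on b.\<close>
  have aass: "good ([M, b, b], [(1, u_bx), (0, [M, h, b], \<beta>, [M]), (1, u_bx), (0, [M, h, b], \<beta>, [M])],
     [(1, mb_bx), (1, u_bx), (0, [M, h, b], \<beta>, [M])])"
    by (rule good_run[OF good_Cons[OF ba good_Cons[OF cml_unt_rule good_Cons[OF unit_rule(1)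
        good_Cons[OF act_rules(4) good_Cons[OF dec good_Cons[OF natural_right[OF u_box b] good_Nil]]]]]],
      where ms = "[SR 1, Rw 0 2 0, SL 4, Rw 1 1 3, SL 2, SL 3, SR 0, SR 1, SR 3, SR 2, SR 4, SR 3, SR 5,
        SR 4, Rw 2 5 1, Rw 3 2 2, Bw 4 3 0, SL 2, SL 3, SL 4, SR 3, SR 4, Rw 0 5 0, SL 7, SL 4, SL 5, SL
        6, SL 7, Rw 5 0 1, SR 5, SR 6, SR 5, SR 4, SR 3, Bw 0 4 0, SL 3, SL 2, SR 3, SR 2, SR 1, Rw 4 2
        0, SR 0]"])
      (rule diag_step diag.dNil crossing_box bx | simp)+
  have aun: "good ([M], [(1, ub_bx), (1, u_bx), (0, [M, h, b], \<beta>, [M])], [])"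
    by (rule good_run[OF good_Cons[OF bu good_Nil],
      where ms = "[SL 0, Rw 0 0 0]"])
      (rule diag_step diag.dNil crossing_box bx | simp)+
  have "\<nu> \<cdot> (\<nu> \<otimes> \<iota> h) = \<nu> \<cdot> (\<iota> M \<otimes> mlt H)"
    by (rule good_eq[OF nua]; rule repr_cong) (rule r' repr_box | simp)+
  moreover have "\<nu> \<cdot> (\<iota> M \<otimes> unt H) = \<iota> M"
    by (rule good_eq[OF nuu]; rule repr_cong) (rule r' repr_box | simp)+
  moreover have "a \<cdot> tens_action M \<nu> b act = \<nu> \<cdot> (a \<otimes> \<iota> h)"
    unfolding tens_action_def
    by (rule sym, rule good_eq[OF alin]; rule repr_cong) (rule r' repr_box | simp)+
  moreover have "a \<cdot> (a \<otimes> \<iota> b) = a \<cdot> (\<iota> M \<otimes> und (mlt B))"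
    by (rule good_eq[OF aass]; rule repr_cong) (rule r' repr_box | simp)+
  moreover have "a \<cdot> (\<iota> M \<otimes> und (unt B)) = \<iota> M"
    by (rule good_eq[OF aun]; rule repr_cong) (rule r' repr_box | simp)+
  ultimately show "bos_module M \<nu> a"
    using repr_hom[OF \<nu>] repr_hom[OF a] by (simp add: bos_module_def is_rmodule_def)
qed

text \<open>Forward, the two squares are composed. Backward, inserting the unit of B or of H
  extracts one action from the combined one.\<close>

lemma bos_arr:
  assumes M: "bos_module M \<nu> a" and N: "bos_module N \<mu> a'" and f: "f \<in> Hom C M N"
  shows "f \<cdot> \<nu> = \<mu> \<cdot> (f \<otimes> \<iota> h) \<and> f \<cdot> a = a' \<cdot> (f \<otimes> \<iota> b) \<longleftrightarrow>
    f \<cdot> (a \<cdot> (\<nu> \<otimes> \<iota> b)) = (a' \<cdot> (\<mu> \<otimes> \<iota> b)) \<cdot> (f \<otimes> \<iota> (h \<odot> b))" (is "?l \<longleftrightarrow> ?r")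
proof -
  note MR = rmodule_rules[OF bos_moduleD(1)[OF M]] and NR = rmodule_rules[OF bos_moduleD(1)[OF N]]
  note [simp] = MR(1) NR(1) act_rules(1)
  have fb: "is_box ([M], f, [N])" using f by (simp add: is_box_def)
  note R0 = B_boxes bos_moduleD(2)[OF M] bos_moduleD(2)[OF N] MR(2) NR(2) fb
  show ?thesis
  proof
    assume l: ?l
    note [reprs] = R0
    have fn: "good ([M, h], [(0, [M, h], \<nu>, [M]), (0, [M], f, [N])], [(0, [M], f, [N]), (0, [N, h], \<mu>, [N])])"
      by (rule goodI[OF conjunct1[OF l]]) (rule reprs repr_box | simp)+
    have fa: "good ([M, b], [(0, [M, b], a, [M]), (0, [M], f, [N])], [(0, [M], f, [N]), (0, [N, b], a', [N])])"
      by (rule goodI[OF conjunct2[OF l]]) (rule reprs repr_box | simp)+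
    show ?r
      by (rule run_eq[OF _ _ _ good_Cons[OF fa good_Cons[OF fn good_Nil]],
        where ms = "[Rw 0 1 0, Rw 1 0 0]"])
        (rule reprs repr_box | simp)+
  next
    assume r: ?r
    define \<beta> \<beta>' where "\<beta> = a \<cdot> (\<nu> \<otimes> \<iota> b)" and "\<beta>' = a' \<cdot> (\<mu> \<otimes> \<iota> b)"
    have bb: "is_box ([M, h, b], \<beta>, [M])" "is_box ([N, h, b], \<beta>', [N])"
      using repr_is_box[OF bos_action_repr[OF M]] repr_is_box[OF bos_action_repr[OF N]] by (simp_all add: \<beta>_def \<beta>'_def)
    note [reprs] = R0 bb
    have fb: "good ([M, h, b], [(0, [M, h, b], \<beta>, [M]), (0, [M], f, [N])], [(0, [M], f, [N]), (0, [N, h, b], \<beta>', [N])])"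
      by (rule goodI[OF r[folded \<beta>_def \<beta>'_def]]) (rule reprs repr_box | simp)+
    have "f \<cdot> (\<beta> \<cdot> (\<iota> M \<otimes> \<iota> h \<otimes> und (unt B))) = (\<beta>' \<cdot> (\<iota> N \<otimes> \<iota> h \<otimes> und (unt B))) \<cdot> (f \<otimes> \<iota> h)"
      by (rule run_eq[OF _ _ _ good_Cons[OF fb good_Nil],
        where ms = "[Rw 0 1 0, SL 0]"])
        (rule reprs repr_box | simp)+
    moreover have "f \<cdot> (\<beta> \<cdot> (\<iota> M \<otimes> unt H \<otimes> \<iota> b)) = (\<beta>' \<cdot> (\<iota> N \<otimes> unt H \<otimes> \<iota> b)) \<cdot> (f \<otimes> \<iota> b)"
      by (rule run_eq[OF _ _ _ good_Cons[OF fb good_Nil],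
        where ms = "[Rw 0 1 0, SL 0]"])
        (rule reprs repr_box | simp)+
    ultimately show ?l
      using bos_to_K(2,3)[OF M] bos_to_K(2,3)[OF N] by (simp add: \<beta>_def \<beta>'_def)
  qed
qed

text \<open>On the left \<Delta> of H acts first, and then \<Omega> lets R act on the first copy of
  b and on N. On the right the comultiplication of the bosonization contains the same R: its first
  leg acts on that copy of b, and its second leg is multiplied to the part of \<Delta> that acts on
  N.\<close>

lemma bos_tens:
  assumes M: "bos_module M \<nu> a" and N: "bos_module N \<mu> a'"
  shows "((a \<otimes> a') \<cdot> (\<iota> M \<otimes> mod_braid N \<mu> b act \<otimes> \<iota> b) \<cdot> (\<iota> M \<otimes> \<iota> N \<otimes> und (cml B))) \<cdot> (tens_action M \<nu> N \<mu> \<otimes> \<iota> b) =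
    ((a \<cdot> (\<nu> \<otimes> \<iota> b)) \<otimes> (a' \<cdot> (\<mu> \<otimes> \<iota> b))) \<cdot> (\<iota> M \<otimes> \<Phi> N (h \<odot> b) \<otimes> \<iota> (h \<odot> b)) \<cdot> (\<iota> M \<otimes> \<iota> N \<otimes> cml K)"
proof -
  note ab = bos_moduleD(2)[OF M] and ab' = bos_moduleD(2)[OF N]
  note M = rmodule_rules[OF bos_moduleD(1)[OF M]] and N = rmodule_rules[OF bos_moduleD(1)[OF N]]
  note b = act_rules(1)
  note [simp] = M(1) N(1) b
  note [reprs] = B_boxes ab ab' M(2) N(2) cml_K_repr
  show ?thesis unfolding tens_action_def mod_braid_def
    by (rule run_eq[OF _ _ _ good_Cons[OF natural_right[OF act_rules(2) N(1)] good_Cons[OF natural_left[OF N(2)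
        b] good_Cons[OF N(3) good_Nil]]],
      where ms = "[SL 9, SR 5, Bw 0 6 1, SR 3, SR 4, SR 5, Rw 1 6 1, SL 8, Rw 2 9 1, SR 8, SR 2, SR 3,
        SR 4, SR 5, SR 6, SR 7, SR 6, SR 1, SR 2, SR 3, SR 4, SR 5, SR 0]"])
      (rule reprs repr_box | simp)+
qed

section \<open>The strict isomorphism between B-modules and modules over the bosonization\<close>

definition bos_obj :: "('o \<times> 'a) \<times> ('o \<times> 'a) \<times> 'a \<times> ('o \<times> 'a) \<Rightarrow> 'o \<times> 'a" where
  "bos_obj X = (fst (fst X), und (snd X) \<cdot> (snd (fst X) \<otimes> \<iota> b))"

definition bos_map where
  "bos_map F = (case F of (X, f, Y) \<Rightarrow> (bos_obj X, und f, bos_obj Y))"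

abbreviation "DB \<equiv> rmod D \<Omega> B"
abbreviation "CK \<equiv> rmod C \<Phi> K"

lemma DB_objE:
  assumes "X \<in> Obj DB"
  obtains M \<nu> a where "X = ((M, \<nu>), (rmodule_tens C \<Phi> H (M, \<nu>) (carr B), a, (M, \<nu>)))" "bos_module M \<nu> a"
    "bos_obj X = (M, a \<cdot> (\<nu> \<otimes> \<iota> b))"
proof -
  obtain P \<alpha> where X: "X = (P, \<alpha>)" by (cases X)
  obtain M \<nu> where P: "P = (M, \<nu>)" by (cases P)
  have "is_rmodule D B (P, \<alpha>)" using assms by (simp add: rmod_def[of D] X)
  then have "bos_module M \<nu> (und \<alpha>)" "\<alpha> = (rmodule_tens C \<Phi> H P (carr B), und \<alpha>, P)" using bos_module_iff P by auto
  then show thesis using that[of M \<nu> "und \<alpha>"] by (simp add: X P bos_obj_def)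
qed

lemma DB_objI: "bos_module M \<nu> a \<Longrightarrow> ((M, \<nu>), (rmodule_tens C \<Phi> H (M, \<nu>) (carr B), a, (M, \<nu>))) \<in> Obj DB"
  using bos_module_iff[of "(M, \<nu>)" "(rmodule_tens C \<Phi> H (M, \<nu>) (carr B), a, (M, \<nu>))"] by (simp add: rmod_def[of D])

lemma bos_obj_bij: "bij_betw bos_obj (Obj DB) (Obj CK)"
  unfolding bij_betw_def
proof (intro conjI inj_onI subset_antisym subsetI)
  fix X Y assume X: "X \<in> Obj DB" and Y: "Y \<in> Obj DB" and eq: "bos_obj X = bos_obj Y"
  from X obtain M \<nu> a where *: "X = ((M, \<nu>), (rmodule_tens C \<Phi> H (M, \<nu>) (carr B), a, (M, \<nu>)))" "bos_module M \<nu> a"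
    "bos_obj X = (M, a \<cdot> (\<nu> \<otimes> \<iota> b))" by (rule DB_objE)
  from Y obtain N \<mu> a' where **: "Y = ((N, \<mu>), (rmodule_tens C \<Phi> H (N, \<mu>) (carr B), a', (N, \<mu>)))" "bos_module N \<mu> a'"
    "bos_obj Y = (N, a' \<cdot> (\<mu> \<otimes> \<iota> b))" by (rule DB_objE)
  have "M = N" "\<nu> = \<mu>" "a = a'"
    using bos_to_K(2,3)[OF *(2)] bos_to_K(2,3)[OF **(2)] eq *(3) **(3) by auto
  then show "X = Y" using * ** by simp
next
  fix Q assume "Q \<in> bos_obj ` Obj DB"
  then obtain X where X: "X \<in> Obj DB" "Q = bos_obj X" by auto
  from X(1) show "Q \<in> Obj CK"
    by (rule DB_objE) (use X(2) bos_to_K(1) in \<open>simp add: rmod_def[of C]\<close>)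
next
  fix Q assume "Q \<in> Obj CK"
  then obtain M \<beta> where Q: "Q = (M, \<beta>)" and mod: "is_rmodule C K (M, \<beta>)" by (cases Q) (auto simp: rmod_def[of C])
  note K = K_to_bos[OF mod]
  show "Q \<in> bos_obj ` Obj DB"
    using DB_objI[OF K(1)] K(2) by (intro image_eqI) (auto simp: bos_obj_def Q)
qed

text \<open>Arrows of B-modules are nested: their middle component is itself a triple, an arrow of
  H-modules. Both sides share the same \<open>f\<close> in C, so the claim reduces to
  \<open>bos_arr\<close>.\<close>

lemma DB_arr_iff:
  assumes X: "X \<in> Obj DB" and Y: "Y \<in> Obj DB"
  shows "(X, (fst X, f, fst Y), Y) \<in> Arr DB \<longleftrightarrow> (bos_obj X, f, bos_obj Y) \<in> Arr CK"
proof -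
  from X obtain M \<nu> a where *: "X = ((M, \<nu>), (rmodule_tens C \<Phi> H (M, \<nu>) (carr B), a, (M, \<nu>)))" "bos_module M \<nu> a"
    "bos_obj X = (M, a \<cdot> (\<nu> \<otimes> \<iota> b))" by (rule DB_objE)
  from Y obtain N \<mu> a' where **: "Y = ((N, \<mu>), (rmodule_tens C \<Phi> H (N, \<mu>) (carr B), a', (N, \<mu>)))" "bos_module N \<mu> a'"
    "bos_obj Y = (N, a' \<cdot> (\<mu> \<otimes> \<iota> b))" by (rule DB_objE)
  have mods: "is_rmodule D B X" "is_rmodule D B Y" "is_rmodule C K (bos_obj X)" "is_rmodule C K (bos_obj Y)"
    using X Y bos_obj_bij by (auto simp: rmod_def bij_betw_def)
  have CH: "is_rmodule C H (M, \<nu>)" "is_rmodule C H (N, \<mu>)" using bos_moduleD(1) *(2) **(2) by auto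
  have "(X, (fst X, f, fst Y), Y) \<in> Arr DB \<longleftrightarrow> f \<in> Hom C M N \<and> f \<cdot> \<nu> = \<mu> \<cdot> (f \<otimes> \<iota> h) \<and> f \<cdot> a = a' \<cdot> (f \<otimes> \<iota> b)"
    using mods(1,2) CH by (auto simp: rmod_def[of D] D_hom D_simps * **)
  moreover have "(bos_obj X, f, bos_obj Y) \<in> Arr CK \<longleftrightarrow> f \<in> Hom C M N \<and>
      f \<cdot> (a \<cdot> (\<nu> \<otimes> \<iota> b)) = (a' \<cdot> (\<mu> \<otimes> \<iota> b)) \<cdot> (f \<otimes> \<iota> (h \<odot> b))"
    using mods(3,4) by (auto simp: rmod_def[of C] *(3) **(3) carr_K)
  ultimately show ?thesis using bos_arr[OF *(2) **(2)] by blast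
qed

lemma DB_arrE:
  assumes "F \<in> Arr DB"
  obtains X f Y where "F = (X, (fst X, f, fst Y), Y)" "X \<in> Obj DB" "Y \<in> Obj DB" "bos_map F = (bos_obj X, f, bos_obj Y)"
proof -
  from assms obtain X g Y where F: "F = (X, g, Y)" "X \<in> Obj DB" "Y \<in> Obj DB" "g \<in> Hom D (fst X) (fst Y)"
    by (cases F) (auto simp: rmod_def[of D])
  then obtain f where "g = (fst X, f, fst Y)" by (auto simp: D_hom)
  with F that show thesis by (auto simp: bos_map_def)
qed

lemma bos_obj_tens:
  assumes X: "X \<in> Obj DB" and Y: "Y \<in> Obj DB"
  shows "bos_obj (rmodule_tens D \<Omega> B X Y) = rmodule_tens C \<Phi> K (bos_obj X) (bos_obj Y)"
proof -
  from X obtain M \<nu> a where *: "X = ((M, \<nu>), (rmodule_tens C \<Phi> H (M, \<nu>) (carr B), a, (M, \<nu>)))" "bos_module M \<nu> a"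
    "bos_obj X = (M, a \<cdot> (\<nu> \<otimes> \<iota> b))" by (rule DB_objE)
  from Y obtain N \<mu> a' where **: "Y = ((N, \<mu>), (rmodule_tens C \<Phi> H (N, \<mu>) (carr B), a', (N, \<mu>)))" "bos_module N \<mu> a'"
    "bos_obj Y = (N, a' \<cdot> (\<mu> \<otimes> \<iota> b))" by (rule DB_objE)
  obtain d where d: "cml B = (carr B, d, rmodule_tens C \<Phi> H (carr B) (carr B))" using B_eqs(3) by blast
  have br: "\<Omega> (N, \<mu>) (carr B) =
    (rmodule_tens C \<Phi> H (N, \<mu>) (carr B), mod_braid N \<mu> b act, rmodule_tens C \<Phi> H (carr B) (N, \<mu>))"
    using rmod_braiding_eq[of N \<mu> b act] rmodule_tens_eq[of N \<mu> b act] rmodule_tens_eq[of b act N \<mu>] by simp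
  have "und (snd (rmodule_tens D \<Omega> B X Y)) =
    (a \<otimes> a') \<cdot> (\<iota> M \<otimes> mod_braid N \<mu> b act \<otimes> \<iota> b) \<cdot> (\<iota> M \<otimes> \<iota> N \<otimes> und (cml B))"
    by (simp add: rmodule_tens_def[of D] * ** D_simps br d)
  moreover have "fst (rmodule_tens D \<Omega> B X Y) = (M \<odot> N, tens_action M \<nu> N \<mu>)"
    by (simp add: rmodule_tens_def[of D] * ** D_simps rmodule_tens_eq)
  ultimately show ?thesis
    using bos_tens[OF *(2) **(2)]
    by (simp add: bos_obj_def[of "rmodule_tens D \<Omega> B X Y"] *(3) **(3) rmodule_tens_def[of C _ K] carr_K)
qed

theorem bos_strict_iso: "strict_iso DB CK bos_obj bos_map"
proof -
  have inj: "X = Y" if "bos_obj X = bos_obj Y" "X \<in> Obj DB" "Y \<in> Obj DB" for X Y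
    using bos_obj_bij that by (auto simp: bij_betw_def dest: inj_onD)
  have "bij_betw bos_map (Arr DB) (Arr CK)"
    unfolding bij_betw_def
  proof (intro conjI inj_onI subset_antisym subsetI)
    fix F G assume F: "F \<in> Arr DB" and G: "G \<in> Arr DB" and eq: "bos_map F = bos_map G"
    from F obtain X f Y where "F = (X, (fst X, f, fst Y), Y)" "X \<in> Obj DB" "Y \<in> Obj DB" "bos_map F = (bos_obj X, f, bos_obj Y)"
      by (rule DB_arrE)
    moreover from G obtain X' g Y' where "G = (X', (fst X', g, fst Y'), Y')" "X' \<in> Obj DB" "Y' \<in> Obj DB"
      "bos_map G = (bos_obj X', g, bos_obj Y')" by (rule DB_arrE)
    ultimately show "F = G" using eq inj[of X X'] inj[of Y Y'] by simp
  next
    fix F assume "F \<in> bos_map ` Arr DB"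
    then obtain G where G: "G \<in> Arr DB" "F = bos_map G" by auto
    from G(1) show "F \<in> Arr CK"
      by (rule DB_arrE) (use G DB_arr_iff in auto)
  next
    fix F assume F: "F \<in> Arr CK"
    then obtain Q f Q' where Q: "F = (Q, f, Q')" "Q \<in> Obj CK" "Q' \<in> Obj CK" by (auto simp: rmod_def[of C])
    then have "Q \<in> bos_obj ` Obj DB" "Q' \<in> bos_obj ` Obj DB" using bos_obj_bij by (auto simp: bij_betw_def)
    then obtain X Y where XY: "X \<in> Obj DB" "Q = bos_obj X" "Y \<in> Obj DB" "Q' = bos_obj Y" by auto
    then have "(X, (fst X, f, fst Y), Y) \<in> Arr DB" using DB_arr_iff F Q by simp
    moreover have "F = bos_map (X, (fst X, f, fst Y), Y)" using Q XY by (simp add: bos_map_def)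
    ultimately show "F \<in> bos_map ` Arr DB" by blast
  qed
  moreover have "Dom CK (bos_map F) = bos_obj (Dom DB F) \<and> Cod CK (bos_map F) = bos_obj (Cod DB F)"
    if "F \<in> Arr DB" for F
    using that by (rule DB_arrE) (auto simp: rmod_def)
  moreover have "bos_map (\<iota>\<^bsub>DB\<^esub> X) = \<iota>\<^bsub>CK\<^esub> (bos_obj X)" if "X \<in> Obj DB" for X
    using that by (rule DB_objE) (auto simp: rmod_def bos_map_def)
  moreover have "bos_map (G \<cdot>\<^bsub>DB\<^esub> F) = bos_map G \<cdot>\<^bsub>CK\<^esub> bos_map F"
    if F: "F \<in> Arr DB" and G: "G \<in> Arr DB" for F G
  proof -
    from F obtain X f Y where "F = (X, (fst X, f, fst Y), Y)" "bos_map F = (bos_obj X, f, bos_obj Y)"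
      by (rule DB_arrE)
    moreover from G obtain X' g Y' where "G = (X', (fst X', g, fst Y'), Y')" "bos_map G = (bos_obj X', g, bos_obj Y')"
      by (rule DB_arrE)
    ultimately show ?thesis by (simp add: rmod_def bos_map_def)
  qed
  moreover have "bos_map (F \<otimes>\<^bsub>DB\<^esub> G) = bos_map F \<otimes>\<^bsub>CK\<^esub> bos_map G" if F: "F \<in> Arr DB" and G: "G \<in> Arr DB" for F G
  proof -
    from F obtain X f Y where "F = (X, (fst X, f, fst Y), Y)" "bos_map F = (bos_obj X, f, bos_obj Y)" "X \<in> Obj DB" "Y \<in> Obj DB"
      by (rule DB_arrE)
    moreover from G obtain X' g Y' where "G = (X', (fst X', g, fst Y'), Y')" "bos_map G = (bos_obj X', g, bos_obj Y')"
      "X' \<in> Obj DB" "Y' \<in> Obj DB"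
      by (rule DB_arrE)
    ultimately show ?thesis
      using bos_obj_tens[of X X'] bos_obj_tens[of Y Y'] by (simp add: rmod_def[of D \<Omega>] rmod_def[of C \<Phi> K] bos_map_def D_simps)
  qed
  moreover have "bos_obj \<I>\<^bsub>DB\<^esub> = \<I>\<^bsub>CK\<^esub>"
  proof -
    \<comment> \<open>On the unit object both actions are counits, and combined they give the counit
      of the bosonization.\<close>
    have "und (cnt B) \<cdot> (cnt H \<otimes> \<iota> b) = cnt K"
    proof -
      have "und (cnt B) \<cdot> (cnt H \<otimes> \<iota> b) = cnt H \<otimes> und (cnt B)"
        by (rule run_eq[OF _ _ _ good_Nil, where ms = "[]"]) (rule reprs B_boxes repr_box | simp add: act_rules(1))+
      then show ?thesis by (simp add: bosonization_def Let_def)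
    qed
    then show ?thesis by (simp add: rmod_def bos_obj_def)
  qed
  ultimately show ?thesis
    using bos_obj_bij bos_obj_tens by (simp add: strict_iso_def rmod_def[of D \<Omega>] rmod_def[of C \<Phi> K])
qed

end

theorem proposition7p4:
  fixes C :: "('o, 'a) moncat"
    and \<Phi> :: "'o \<Rightarrow> 'o \<Rightarrow> 'a"
    and H :: "('o, 'a) hopf"
    and R :: 'a
    and A :: "'o \<times> 'a"
    and i :: "'o \<times> 'a \<Rightarrow> ('o \<times> 'a) \<times> 'a \<times> ('o \<times> 'a)"
  assumes "braided_monoidal_category C \<Phi>"
    and "rigid C"
    and "cocomplete TYPE('u) C"
    and "hopf_algebra C \<Phi> H"
    and "is_iso C (antip H)"
    and "in_sym_center C \<Phi> (carr H)"
    and "quasitriangular C \<Phi> H R"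
    and "is_aut_coend (rmod C \<Phi> H) A i"
  shows "monoidally_isomorphic
    (left_center (rmod C \<Phi> H))
    (rmod C \<Phi> (bosonization C \<Phi> H R
      (aut_bialg (rmod C \<Phi> H) (rmod_braiding C \<Phi> H R) A i)))"
proof -
  interpret braided_monoidal_category C \<Phi> by fact
  interpret Q: quasitriangular_hopf_modules C \<Phi> H R
    using assms by unfold_locales (auto simp: hopf_algebra_def)
  let ?D = "rmod C \<Phi> H" and ?\<Omega> = "rmod_braiding C \<Phi> H R"
  let ?B = "aut_bialg ?D ?\<Omega> A i"
  interpret DB: braided_monoidal_category ?D ?\<Omega> by (rule Q.braided_rmod)
  interpret DC: braided_coend ?D ?\<Omega> A i
    by unfold_locales (use Q.rigid_rmod assms(8) in auto)
  interpret K: bosonization_modules C \<Phi> H R ?B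
    by unfold_locales (use DC.mlt_B(1) DC.unt_B DC.cml_B(1) DC.cnt_B(1) in auto)
  have Z: "strict_monoidal_category (left_center ?D)" by (rule Q.D.strict_monoidal_left_center)
  have "strict_iso (left_center ?D) (rmod C \<Phi> (bosonization C \<Phi> H R ?B))
    (K.bos_obj \<circ> DC.center_obj) (K.bos_map \<circ> DC.center_arr)"
    by (rule strict_iso_trans[OF Z DC.center_strict_iso K.bos_strict_iso])
  with Z have "strict_isomorphism (left_center ?D) (rmod C \<Phi> (bosonization C \<Phi> H R ?B))
    (K.bos_obj \<circ> DC.center_obj) (K.bos_map \<circ> DC.center_arr)"
    by (simp add: strict_isomorphism_def strict_isomorphism_axioms_def)
  then show ?thesis by (rule strict_isomorphism.monoidally_isomorphic)
qed

end
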